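(* Assume the standing assumptions (A) and let $(\mathcal D_m)_{m\in\mathbb{N}}$ be a sequence of Gradient Discretisations with piecewise constant reconstructions such that: (i) (coercivity) $(C_{\mathcal D_m})_{m}$ is bounded; (ii) (consistency) $\lim_{m\to\infty}S_{\mathcal D_m}(\varphi)=0$ for all $\varphi\in H^1_0(\Omega)$, and $\lim_{m\to\infty}\|Q_{\mathcal D_m}f-f\|_{L^2}=0$; (iii) (limit-conformity) $\lim_{m\to\infty}W_{\mathcal D_m}(\psi)=0$ for all $\psi\in H_{\mathrm{div}}(\Omega)$; (iv) (compactness) for any sequence $v_m\in X_{\mathcal D_m,0}$ with $(\nabla_{\mathcal D_m}v_m)_m$ bounded in $L^2(\Omega)^d$, the set $\{\Pi_{\mathcal D_m}v_m: m\in\mathbb{N}\}$ is relatively compact in $L^2(\Omega)$. For each $m$ let $u_m$ be a solution of the Gradient Scheme (GS) with $\mathcal D=\mathcal D_m$. Then there exists a solution $\bar u$ of the weak problem (W) such that, as $m\to\infty$, $\Pi_{\mathcal D_m}\zeta(u_m)\to\zeta(\bar u)$ strongly in $L^2(\Omega)$, $\nabla_{\mathcal D_m}\zeta(u_m)\to\nabla\zeta(\bar u)$ strongly in $L^2(\Omega)^d$, and $\Pi_{\mathcal D_m}\beta(u_m)\to\beta(\bar u)$ weakly in $L^2(\Omega)$.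
   Context: Standing assumptions (A): $\Omega$ is an open bounded connected subset of $\mathbb{R}^d$; $\zeta:\mathbb{R}\to\mathbb{R}$ is continuous, non-decreasing, $\zeta(0)=0$ and there are $M_0,M_1>0$ with $|\zeta(s)|\ge M_0|s|-M_1$ for all $s$; $\beta:\mathbb{R}\to\mathbb{R}$ is continuous, non-decreasing, $\beta(0)=0$ and there are $K_0,K_1>0$ with $|\beta(s)|\le K_0|s|+K_1$ for all $s$; $\beta+\zeta$ is strictly increasing; $\Lambda:\Omega\to M_d(\mathbb{R})$ is measurable and there are $\overline\lambda\ge\underline\lambda>0$ such that for a.e. $x$, $\Lambda(x)$ is symmetric with eigenvalues in $[\underline\lambda,\overline\lambda]$; $f\in L^2(\Omega)$, $F\in L^2(\Omega)^d$. Weak problem (W): find $\bar u\in L^2(\Omega)$ with $\zeta(\bar u)\in H^1_0(\Omega)$ and $\int_\Omega\beta(\bar u)\bar v+\int_\Omega\Lambda\nabla\zeta(\bar u)\cdot\nabla\bar v=\int_\Omega f\bar v-\int_\Omega F\cdot\nabla\bar v$ for all $\bar v\in H^1_0(\Omega)$. Gradient Discretisation (GD): $\mathcal D=(X_{\mathcal D,0},\Pi_{\mathcal D},\nabla_{\mathcal D},Q_{\mathcal D})$ where $X_{\mathcal D,0}$ is a finite-dimensional space, $\Pi_{\mathcal D}:X_{\mathcal D,0}\to L^2(\Omega)$ and $\nabla_{\mathcal D}:X_{\mathcal D,0}\to L^2(\Omega)^d$ are linear with $\|v\|_{\mathcal D}:=\|\nabla_{\mathcal D}v\|_{L^2}$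 a norm on $X_{\mathcal D,0}$, and $Q_{\mathcal D}:L^2(\Omega)\to L^2(\Omega)$ is a (not necessarily linear or bounded) map called the quadrature operator. Piecewise constant reconstruction: there are finite sets $I_{\partial\Omega}\subset I$ with $X_{\mathcal D,0}=\{v=(v_i)_{i\in I}: v_i\in\mathbb{R},\ v_i=0\ \forall i\in I_{\partial\Omega}\}$ and a partition $(U_i)_{i\in I}$ of $\Omega$ (some $U_i$ possibly empty) with $\Pi_{\mathcal D}v=\sum_{i\in I}v_i\mathbf 1_{U_i}$. For $g:\mathbb{R}\to\mathbb{R}$ with $g(0)=0$, $g(v):=(g(v_i))_{i\in I}\in X_{\mathcal D,0}$. Gradient Scheme (GS): find $u\in X_{\mathcal D,0}$ such that for all $v\in X_{\mathcal D,0}$, $\int_\Omega\beta(\Pi_{\mathcal D}u)\Pi_{\mathcal D}v+\int_\Omega\Lambda\nabla_{\mathcal D}\zeta(u)\cdot\nabla_{\mathcal D}v=\int_\Omega Q_{\mathcal D}f\,\Pi_{\mathcal D}v-\int_\Omega F\cdot\nabla_{\mathcal D}v$. Quantities: $C_{\mathcal D}:=\max_{v\ne0}\|\Pi_{\mathcal D}v\|_{L^2}/\|\nabla_{\mathcal D}v\|_{L^2}$; for $\varphi\in H^1_0(\Omega)$, $S_{\mathcal D}(\varphi):=\min_{v\in X_{\mathcal D,0}}(\|\nabla_{\mathcal D}v-\nabla\varphi\|_{L^2}+\|\Pi_{\mathcal D}v-\varphi\|_{L^2})$; for $\psi\in H_{\mathrm{div}}(\Omega)$, $W_{\mathcal D}(\psi):=\max_{v\ne0}\frac{1}{\|\nabla_{\mathcal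 D}v\|_{L^2}}\left|\int_\Omega\nabla_{\mathcal D}v\cdot\psi+\Pi_{\mathcal D}v\,\mathrm{div}\psi\right|$. *)

theory Defs
  imports "HOL-Analysis.Analysis"
begin

definition L2 :: "(real^'n) set \<Rightarrow> (real^'n \<Rightarrow> real) \<Rightarrow> bool" where
  "L2 \<Omega> g \<longleftrightarrow> g \<in> borel_measurable (lebesgue_on \<Omega>)
      \<and> integrable (lebesgue_on \<Omega>) (\<lambda>x. (g x)^2)"

definition L2v :: "(real^'n) set \<Rightarrow> (real^'n \<Rightarrow> real^'n) \<Rightarrow> bool" where
  "L2v \<Omega> G \<longleftrightarrow> G \<in> borel_measurable (lebesgue_on \<Omega>)
      \<and> integrable (lebesgue_on \<Omega>) (\<lambda>x. (norm (G x))^2)"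

definition L2norm :: "(real^'n) set \<Rightarrow> (real^'n \<Rightarrow> real) \<Rightarrow> real" where
  "L2norm \<Omega> g = sqrt (integral\<^sup>L (lebesgue_on \<Omega>) (\<lambda>x. (g x)^2))"

definition L2vnorm :: "(real^'n) set \<Rightarrow> (real^'n \<Rightarrow> real^'n) \<Rightarrow> real" where
  "L2vnorm \<Omega> G = sqrt (integral\<^sup>L (lebesgue_on \<Omega>) (\<lambda>x. (norm (G x))^2))"

definition partial :: "'n::finite \<Rightarrow> (real^'n \<Rightarrow> real) \<Rightarrow> real^'n \<Rightarrow> real" where
  "partial i f x = frechet_derivative f (at x) (axis i 1)"

fun iter_partial :: "'n::finite list \<Rightarrow> (real^'n \<Rightarrow> real) \<Rightarrow> real^'n \<Rightarrow> real" where
  "iter_partial [] f = f"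
| "iter_partial (i # is) f = partial i (iter_partial is f)"

definition smooth_fun :: "(real^'n::finite \<Rightarrow> real) \<Rightarrow> bool" where
  "smooth_fun f \<longleftrightarrow> (\<forall>is x. iter_partial is f differentiable (at x))"

definition grad :: "(real^'n::finite \<Rightarrow> real) \<Rightarrow> real^'n \<Rightarrow> real^'n" where
  "grad f x = (\<chi> i. partial i f x)"

definition Cc_inf :: "(real^'n::finite) set \<Rightarrow> (real^'n \<Rightarrow> real) \<Rightarrow> bool" where
  "Cc_inf \<Omega> \<phi> \<longleftrightarrow> smooth_fun \<phi> \<and> compact (closure {x. \<phi> x \<noteq> 0})
      \<and> closure {x. \<phi> x \<noteq> 0} \<subseteq> \<Omega>"

definition H10 :: "(real^'n::finite) set \<Rightarrow> (real^'n \<Rightarrow> real) \<Rightarrow> (real^'n \<Rightarrow> real^'n) \<Rightarrow> bool" where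
  "H10 \<Omega> u G \<longleftrightarrow> L2 \<Omega> u \<and> L2v \<Omega> G \<and>
     (\<exists>\<phi>::nat \<Rightarrow> real^'n \<Rightarrow> real. (\<forall>k. Cc_inf \<Omega> (\<phi> k))
        \<and> (\<lambda>k. L2norm \<Omega> (\<lambda>x. \<phi> k x - u x)) \<longlonglongrightarrow> 0
        \<and> (\<lambda>k. L2vnorm \<Omega> (\<lambda>x. grad (\<phi> k) x - G x)) \<longlonglongrightarrow> 0)"

definition Hdiv :: "(real^'n::finite) set \<Rightarrow> (real^'n \<Rightarrow> real^'n) \<Rightarrow> (real^'n \<Rightarrow> real) \<Rightarrow> bool" where
  "Hdiv \<Omega> \<psi> D \<longleftrightarrow> L2v \<Omega> \<psi> \<and> L2 \<Omega> D \<and>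
     (\<forall>\<phi>. Cc_inf \<Omega> \<phi> \<longrightarrow>
        integral\<^sup>L (lebesgue_on \<Omega>) (\<lambda>x. \<psi> x \<bullet> grad \<phi> x + D x * \<phi> x) = 0)"

text \<open>Unknowns are indexed by a finite set I of natural numbers; elements of
  X_{D,0} are represented as functions nat => real vanishing outside I and on I_bd.
  The reconstruction Pi_D is determined by the partition (U_i).\<close>
record ('n::finite) gd =
  gd_I :: "nat set"
  gd_Ibd :: "nat set"
  gd_U :: "nat \<Rightarrow> (real^'n) set"
  gd_grad :: "(nat \<Rightarrow> real) \<Rightarrow> real^'n \<Rightarrow> real^'n"
  gd_Q :: "(real^'n \<Rightarrow> real) \<Rightarrow> real^'n \<Rightarrow> real"

definition gd_X :: "'n::finite gd \<Rightarrow> (nat \<Rightarrow> real) set" where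
  "gd_X D = {v. \<forall>i. (i \<notin> gd_I D \<or> i \<in> gd_Ibd D) \<longrightarrow> v i = 0}"

definition gd_Pi :: "'n::finite gd \<Rightarrow> (nat \<Rightarrow> real) \<Rightarrow> real^'n \<Rightarrow> real" where
  "gd_Pi D v x = (\<Sum>i\<in>gd_I D. v i * indicator (gd_U D i) x)"

definition is_pc_GD :: "(real^'n::finite) set \<Rightarrow> 'n gd \<Rightarrow> bool" where
  "is_pc_GD \<Omega> D \<longleftrightarrow>
     finite (gd_I D) \<and> gd_Ibd D \<subseteq> gd_I D
     \<and> (\<forall>i\<in>gd_I D. gd_U D i \<in> sets lebesgue \<and> gd_U D i \<subseteq> \<Omega>)
     \<and> (\<forall>i\<in>gd_I D. \<forall>j\<in>gd_I D. i \<noteq> j \<longrightarrow> gd_U D i \<inter> gd_U D j = {})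
     \<and> (\<Union>i\<in>gd_I D. gd_U D i) = \<Omega>
     \<and> (\<forall>u\<in>gd_X D. \<forall>v\<in>gd_X D. \<forall>a b. gd_grad D (\<lambda>i. a * u i + b * v i)
            = (\<lambda>x. a *\<^sub>R gd_grad D u x + b *\<^sub>R gd_grad D v x))
     \<and> (\<forall>v\<in>gd_X D. L2v \<Omega> (gd_grad D v))
     \<and> (\<forall>v\<in>gd_X D. L2vnorm \<Omega> (gd_grad D v) = 0 \<longrightarrow> v = (\<lambda>i. 0))
     \<and> (\<forall>g. L2 \<Omega> g \<longrightarrow> L2 \<Omega> (gd_Q D g))"

definition gd_C :: "(real^'n::finite) set \<Rightarrow> 'n gd \<Rightarrow> real" where
  "gd_C \<Omega> D = (SUP v\<in>{v\<in>gd_X D. v \<noteq> (\<lambda>i. 0)}.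
                   L2norm \<Omega> (gd_Pi D v) / L2vnorm \<Omega> (gd_grad D v))"

definition gd_S :: "(real^'n::finite) set \<Rightarrow> 'n gd \<Rightarrow> (real^'n \<Rightarrow> real) \<Rightarrow> (real^'n \<Rightarrow> real^'n) \<Rightarrow> real" where
  "gd_S \<Omega> D \<phi> G\<phi> = (INF v\<in>gd_X D.
       L2vnorm \<Omega> (\<lambda>x. gd_grad D v x - G\<phi> x) + L2norm \<Omega> (\<lambda>x. gd_Pi D v x - \<phi> x))"

definition gd_W :: "(real^'n::finite) set \<Rightarrow> 'n gd \<Rightarrow> (real^'n \<Rightarrow> real^'n) \<Rightarrow> (real^'n \<Rightarrow> real) \<Rightarrow> real" where
  "gd_W \<Omega> D \<psi> div\<psi> = (SUP v\<in>{v\<in>gd_X D. v \<noteq> (\<lambda>i. 0)}.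
       \<bar>integral\<^sup>L (lebesgue_on \<Omega>) (\<lambda>x. gd_grad D v x \<bullet> \<psi> x + gd_Pi D v x * div\<psi> x)\<bar>
         / L2vnorm \<Omega> (gd_grad D v))"

definition solves_GS ::
  "(real^'n::finite) set \<Rightarrow> (real \<Rightarrow> real) \<Rightarrow> (real \<Rightarrow> real) \<Rightarrow> (real^'n \<Rightarrow> real^'n^'n)
    \<Rightarrow> (real^'n \<Rightarrow> real) \<Rightarrow> (real^'n \<Rightarrow> real^'n) \<Rightarrow> 'n gd \<Rightarrow> (nat \<Rightarrow> real) \<Rightarrow> bool" where
  "solves_GS \<Omega> \<zeta> \<beta> \<Lambda> f F D u \<longleftrightarrow> u \<in> gd_X D \<and>
     (\<forall>v\<in>gd_X D.
        integral\<^sup>L (lebesgue_on \<Omega>) (\<lambda>x. \<beta> (gd_Pi D u x) * gd_Pi D v x)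
      + integral\<^sup>L (lebesgue_on \<Omega>) (\<lambda>x. (\<Lambda> x *v gd_grad D (\<lambda>i. \<zeta> (u i)) x) \<bullet> gd_grad D v x)
      = integral\<^sup>L (lebesgue_on \<Omega>) (\<lambda>x. gd_Q D f x * gd_Pi D v x)
      - integral\<^sup>L (lebesgue_on \<Omega>) (\<lambda>x. F x \<bullet> gd_grad D v x))"

definition solves_W ::
  "(real^'n::finite) set \<Rightarrow> (real \<Rightarrow> real) \<Rightarrow> (real \<Rightarrow> real) \<Rightarrow> (real^'n \<Rightarrow> real^'n^'n)
    \<Rightarrow> (real^'n \<Rightarrow> real) \<Rightarrow> (real^'n \<Rightarrow> real^'n) \<Rightarrow> (real^'n \<Rightarrow> real) \<Rightarrow> (real^'n \<Rightarrow> real^'n) \<Rightarrow> bool" where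
  "solves_W \<Omega> \<zeta> \<beta> \<Lambda> f F ubar G \<longleftrightarrow> L2 \<Omega> ubar \<and> H10 \<Omega> (\<lambda>x. \<zeta> (ubar x)) G \<and>
     (\<forall>vbar Gv. H10 \<Omega> vbar Gv \<longrightarrow>
        integral\<^sup>L (lebesgue_on \<Omega>) (\<lambda>x. \<beta> (ubar x) * vbar x)
      + integral\<^sup>L (lebesgue_on \<Omega>) (\<lambda>x. (\<Lambda> x *v G x) \<bullet> Gv x)
      = integral\<^sup>L (lebesgue_on \<Omega>) (\<lambda>x. f x * vbar x)
      - integral\<^sup>L (lebesgue_on \<Omega>) (\<lambda>x. F x \<bullet> Gv x))"

end

(* Testing the scheme with zeta(u_m) bounds its discrete gradients, so along a subsequence
   Pi zeta(u_m) -> Z strongly, Pi beta(u_m) -> B weakly and grad zeta(u_m) -> G weakly in L^2.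
   Because zeta o (beta + zeta)^(-1) is firmly nonexpansive, the function ubar with
   beta(ubar) + zeta(ubar) = B + Z satisfies zeta(ubar) = Z and beta(ubar) = B.
   Limit-conformity makes (Z, G) orthogonal to all pairs (div psi, psi), which are the orthogonal
   complement of the graph of the gradient, so that G = grad Z; consistency passes the scheme to the
   limit, and convergence of the energies gives strong convergence of the gradients.
   Solutions of the weak problem have unique zeta(ubar), gradient and beta(ubar), hence the whole
   sequence converges. *)
theory Submission
  imports Defs "HOL-Library.Diagonal_Subsequence"
begin

section \<open>Square integrable functions\<close>

text \<open>\<open>\<zeta>\<close> and \<open>\<beta>\<close> may each be constant on intervals, so
  only their sum determines the unknown, and of the two summands only one converges strongly. The
  square of \<open>z - \<zeta> v\<close> is dominated pointwise by the product of a weakly null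
  factor \<open>b + z - w\<close> and a strongly convergent one, and integrals of such products pass
  to the limit. Elements of L2 are genuine functions rather than classes. Uniqueness is therefore
  expressed by vanishing norms of differences or by equal pairings, and a pair \<open>(u, G)\<close>
  in \<open>H10\<close> is treated as one square integrable function with values in a product space.
  Hilbert space theory for arbitrary Euclidean values thus serves scalars, vector fields and pairs
  at once. A further obstacle is that \<open>gd_C\<close> and \<open>gd_W\<close> are suprema of
  sets of reals: they dominate their members only once these sets are known to be bounded above,
  which rests on the equivalence of norms in finite dimension.\<close>

definition sqint :: "'a measure \<Rightarrow> ('a \<Rightarrow> 'b::euclidean_space) \<Rightarrow> bool" where
  "sqint M f \<longleftrightarrow> f \<in> borel_measurable M \<and> integrable M (\<lambda>x. (norm (f x))\<^sup>2)"

definition sqnorm :: "'a measure \<Rightarrow> ('a \<Rightarrow> 'b::euclidean_space) \<Rightarrow> real" where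
  "sqnorm M f = sqrt (\<integral>x. (norm (f x))\<^sup>2 \<partial>M)"

text \<open>The integral defaults to 0 when the product is not integrable. Symmetry and homogeneity
  hold for arbitrary functions, while additivity below asks for \<open>sqint\<close>.\<close>

definition sqip :: "'a measure \<Rightarrow> ('a \<Rightarrow> 'b::euclidean_space) \<Rightarrow> ('a \<Rightarrow> 'b) \<Rightarrow> real" where
  "sqip M f g = (\<integral>x. f x \<bullet> g x \<partial>M)"

lemma sqint_measurable: "sqint M f \<Longrightarrow> f \<in> borel_measurable M"
  by (simp add: sqint_def)

lemma sqintI_bound:
  assumes "f \<in> borel_measurable M" "integrable M h" "\<And>x. x \<in> space M \<Longrightarrow> (norm (f x))\<^sup>2 \<le> h x"
  shows "sqint M f"
  unfolding sqint_def
proof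
  have [measurable]: "f \<in> borel_measurable M" by fact
  show "integrable M (\<lambda>x. (norm (f x))\<^sup>2)"
    by (rule Bochner_Integration.integrable_bound[OF assms(2)])
      (auto intro!: AE_I2 order_trans[OF assms(3)])
qed fact

lemma sqint_bound:
  assumes "f \<in> borel_measurable M" "sqint M g" "\<And>x. x \<in> space M \<Longrightarrow> norm (f x) \<le> norm (g x)"
  shows "sqint M f"
  by (rule sqintI_bound[OF assms(1), where h = "\<lambda>x. (norm (g x))\<^sup>2"])
    (use assms in \<open>auto simp: sqint_def intro!: power_mono\<close>)

lemma sqint_scaleR: "sqint M f \<Longrightarrow> sqint M (\<lambda>x. a *\<^sub>R f x)"
  unfolding sqint_def by (auto simp: power_mult_distrib)

lemma sqint_add:
  assumes "sqint M f" "sqint M g"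
  shows "sqint M (\<lambda>x. f x + g x)"
proof (rule sqintI_bound[where h = "\<lambda>x. 2 * (norm (f x))\<^sup>2 + 2 * (norm (g x))\<^sup>2"])
  fix x
  have "(norm (f x + g x))\<^sup>2 \<le> (norm (f x) + norm (g x))\<^sup>2"
    by (intro power_mono norm_triangle_ineq) auto
  also have "\<dots> \<le> 2 * (norm (f x))\<^sup>2 + 2 * (norm (g x))\<^sup>2"
    using zero_le_power2[of "norm (f x) - norm (g x)"] by (simp add: power2_eq_square algebra_simps)
  finally show "(norm (f x + g x))\<^sup>2 \<le> 2 * (norm (f x))\<^sup>2 + 2 * (norm (g x))\<^sup>2" .
qed (use assms in \<open>auto simp: sqint_def\<close>)

lemma sqint_diff: "sqint M f \<Longrightarrow> sqint M g \<Longrightarrow> sqint M (\<lambda>x. f x - g x)"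
  using sqint_add[of M f "\<lambda>x. (-1) *\<^sub>R g x"] sqint_scaleR[of M g "-1"] by simp

lemma sqint_zero: "sqint M (\<lambda>x. 0)"
  by (simp add: sqint_def)

lemma sqint_sum: "(\<And>i. i \<in> I \<Longrightarrow> sqint M (f i)) \<Longrightarrow> sqint M (\<lambda>x. \<Sum>i\<in>I. f i x)"
  by (induction I rule: infinite_finite_induct) (auto intro: sqint_add sqint_zero)

lemma sqint_const: "finite_measure M \<Longrightarrow> sqint M (\<lambda>x. c)"
  by (simp add: sqint_def finite_measure.integrable_const)

text \<open>Cauchy-Schwarz in the value space and
  \<open>2 * s * t \<le> s\<^sup>2 + t\<^sup>2\<close> dominate the inner product by a sum of two
  integrable squares.\<close>

lemma integrable_inner_sqint:
  assumes "sqint M f" "sqint M g"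
  shows "integrable M (\<lambda>x. f x \<bullet> g x)"
proof -
  have [measurable]: "f \<in> borel_measurable M" "g \<in> borel_measurable M"
    using assms by (auto simp: sqint_def)
  have "integrable M (\<lambda>x. (norm (f x))\<^sup>2 + (norm (g x))\<^sup>2)"
    using assms by (auto simp: sqint_def)
  then show ?thesis
  proof (rule Bochner_Integration.integrable_bound)
    show "AE x in M. norm (f x \<bullet> g x) \<le> norm ((norm (f x))\<^sup>2 + (norm (g x))\<^sup>2)"
    proof (intro AE_I2)
      fix x
      have "2 * (norm (f x) * norm (g x)) \<le> (norm (f x))\<^sup>2 + (norm (g x))\<^sup>2"
        using zero_le_power2[of "norm (f x) - norm (g x)"] by (simp add: power2_eq_square algebra_simps)
      moreover have "0 \<le> norm (f x) * norm (g x)" by simp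
      ultimately have "norm (f x) * norm (g x) \<le> (norm (f x))\<^sup>2 + (norm (g x))\<^sup>2" by linarith
      then show "norm (f x \<bullet> g x) \<le> norm ((norm (f x))\<^sup>2 + (norm (g x))\<^sup>2)"
        using Cauchy_Schwarz_ineq2[of "f x" "g x"] by simp
    qed
  qed simp
qed

lemma sqip_commute: "sqip M f g = sqip M g f"
  by (simp add: sqip_def inner_commute)

lemma sqip_add_left:
  "sqint M f \<Longrightarrow> sqint M g \<Longrightarrow> sqint M h \<Longrightarrow> sqip M (\<lambda>x. f x + g x) h = sqip M f h + sqip M g h"
  unfolding sqip_def inner_add_left
  by (intro Bochner_Integration.integral_add integrable_inner_sqint)

lemma sqip_diff_left:
  "sqint M f \<Longrightarrow> sqint M g \<Longrightarrow> sqint M h \<Longrightarrow> sqip M (\<lambda>x. f x - g x) h = sqip M f h - sqip M g h"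
  unfolding sqip_def inner_diff_left
  by (intro Bochner_Integration.integral_diff integrable_inner_sqint)

lemma sqip_scaleR_left: "sqip M (\<lambda>x. a *\<^sub>R f x) h = a * sqip M f h"
  by (simp add: sqip_def)

lemma sqip_add_right:
  "sqint M f \<Longrightarrow> sqint M g \<Longrightarrow> sqint M h \<Longrightarrow> sqip M h (\<lambda>x. f x + g x) = sqip M h f + sqip M h g"
  using sqip_add_left[of M f g h] by (simp add: sqip_commute)

lemma sqip_diff_right:
  "sqint M f \<Longrightarrow> sqint M g \<Longrightarrow> sqint M h \<Longrightarrow> sqip M h (\<lambda>x. f x - g x) = sqip M h f - sqip M h g"
  using sqip_diff_left[of M f g h] by (simp add: sqip_commute)

lemma sqip_scaleR_right: "sqip M h (\<lambda>x. a *\<^sub>R f x) = a * sqip M h f"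
  by (simp add: sqip_def)

lemma sqip_self: "sqip M f f = (sqnorm M f)\<^sup>2"
  by (simp add: sqip_def sqnorm_def power2_norm_eq_inner)

lemma sqnorm_nonneg [simp]: "0 \<le> sqnorm M f"
  by (simp add: sqnorm_def)

lemma sqnorm_scaleR: "sqnorm M (\<lambda>x. a *\<^sub>R f x) = \<bar>a\<bar> * sqnorm M f"
  by (simp add: sqnorm_def power_mult_distrib real_sqrt_mult)

lemma sqnorm_minus_commute: "sqnorm M (\<lambda>x. f x - g x) = sqnorm M (\<lambda>x. g x - f x)"
  by (simp add: sqnorm_def norm_minus_commute)

text \<open>The real parameter \<open>t\<close> turns the extremality arguments below
  (Cauchy-Schwarz, the parallelogram law, the first variation of a minimiser) into statements about
  a quadratic polynomial.\<close>

lemma sqnorm_add_power2: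
  assumes "sqint M f" "sqint M g"
  shows "(sqnorm M (\<lambda>x. f x + t *\<^sub>R g x))\<^sup>2 = (sqnorm M f)\<^sup>2 + 2 * t * sqip M f g + t\<^sup>2 * (sqnorm M g)\<^sup>2"
  unfolding sqip_self[symmetric]
  using assms sqint_scaleR[OF assms(2), of t] sqint_add[OF assms(1) sqint_scaleR[OF assms(2), of t]]
  by (simp add: sqip_add_left sqip_add_right sqip_scaleR_left sqip_scaleR_right
      sqip_commute[of M g f] power2_eq_square algebra_simps)

text \<open>The discriminant of a nonnegative quadratic polynomial is not positive. With
  \<open>a = 0\<close> this says that the linear coefficient vanishes, which is the Euler equation
  of a minimiser.\<close>

lemma quadratic_nonneg_imp_le:
  fixes a b c :: real
  assumes "\<And>t. 0 \<le> a + 2 * t * b + t\<^sup>2 * c" "0 \<le> c"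
  shows "b\<^sup>2 \<le> a * c"
proof (cases "c = 0")
  case True
  have "b = 0"
  proof (rule ccontr)
    assume "b \<noteq> 0"
    \<comment> \<open>At this \<open>t\<close> the polynomial, which is affine here, takes the value
      -1.\<close>
    then show False using assms(1)[of "- (a + 1) / (2 * b)"] True by (simp add: field_simps)
  qed
  then show ?thesis using True by simp
next
  case False
  then have "c > 0" using assms(2) by simp
  have "0 \<le> a + 2 * (- b / c) * b + (- b / c)\<^sup>2 * c" by (rule assms)
  also have "\<dots> = a - b\<^sup>2 / c" using \<open>c > 0\<close> by (simp add: field_simps power2_eq_square)
  finally show ?thesis using \<open>c > 0\<close> by (simp add: field_simps)
qed

lemma sqip_Cauchy_Schwarz:
  assumes "sqint M f" "sqint M g"
  shows "\<bar>sqip M f g\<bar> \<le> sqnorm M f * sqnorm M g"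
proof -
  have "(sqip M f g)\<^sup>2 \<le> (sqnorm M f)\<^sup>2 * (sqnorm M g)\<^sup>2"
    by (rule quadratic_nonneg_imp_le) (simp_all add: sqnorm_add_power2[OF assms, symmetric])
  also have "\<dots> = (sqnorm M f * sqnorm M g)\<^sup>2" by (simp add: power_mult_distrib)
  finally show ?thesis
    by (metis abs_le_square_iff abs_of_nonneg mult_nonneg_nonneg sqnorm_nonneg)
qed

lemma sqnorm_triangle:
  assumes "sqint M f" "sqint M g"
  shows "sqnorm M (\<lambda>x. f x + g x) \<le> sqnorm M f + sqnorm M g"
proof (rule power2_le_imp_le)
  show "(sqnorm M (\<lambda>x. f x + g x))\<^sup>2 \<le> (sqnorm M f + sqnorm M g)\<^sup>2"
    using sqnorm_add_power2[OF assms, of 1] sqip_Cauchy_Schwarz[OF assms]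
    by (simp add: power2_eq_square algebra_simps)
qed (simp)

lemma sqnorm_triangle_diff:
  assumes "sqint M f" "sqint M g" "sqint M h"
  shows "sqnorm M (\<lambda>x. f x - h x) \<le> sqnorm M (\<lambda>x. f x - g x) + sqnorm M (\<lambda>x. g x - h x)"
  using sqnorm_triangle[OF sqint_diff[OF assms(1,2)] sqint_diff[OF assms(2,3)]] by simp

lemma sqnorm_le_add_diff:
  assumes "sqint M f" "sqint M g"
  shows "sqnorm M f \<le> sqnorm M (\<lambda>x. f x - g x) + sqnorm M g"
  using sqnorm_triangle[OF sqint_diff[OF assms] assms(2)] by simp

lemma sqnorm_diff_le_add:
  assumes "sqint M f" "sqint M g"
  shows "sqnorm M (\<lambda>x. f x - g x) \<le> sqnorm M f + sqnorm M g"
  using sqnorm_triangle[OF assms(1) sqint_scaleR[OF assms(2), of "-1"]] sqnorm_scaleR[of M "-1" g]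
  by simp

lemma sqnorm_eq_0_imp_AE:
  assumes "sqint M f" "sqnorm M f = 0"
  shows "AE x in M. f x = 0"
proof -
  have "(\<integral>x. (norm (f x))\<^sup>2 \<partial>M) = 0" using assms(2) by (simp add: sqnorm_def)
  then have "AE x in M. (norm (f x))\<^sup>2 = 0"
    using assms(1) by (subst (asm) integral_nonneg_eq_0_iff_AE) (auto simp: sqint_def)
  then show ?thesis by simp
qed

lemma tendsto_sqip_left:
  assumes "\<And>n. sqint M (f n)" "sqint M g" "sqint M h" "(\<lambda>n. sqnorm M (\<lambda>x. f n x - g x)) \<longlonglongrightarrow> 0"
  shows "(\<lambda>n. sqip M (f n) h) \<longlonglongrightarrow> sqip M g h"
proof -
  have "(\<lambda>n. sqip M (f n) h - sqip M g h) \<longlonglongrightarrow> 0"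
  proof (rule Lim_null_comparison)
    show "\<forall>\<^sub>F n in sequentially. norm (sqip M (f n) h - sqip M g h) \<le> sqnorm M (\<lambda>x. f n x - g x) * sqnorm M h"
      using sqip_Cauchy_Schwarz[OF sqint_diff[OF assms(1,2)] assms(3)]
      by (auto simp: sqip_diff_left[OF assms(1,2,3)])
    show "(\<lambda>n. sqnorm M (\<lambda>x. f n x - g x) * sqnorm M h) \<longlonglongrightarrow> 0"
      using tendsto_mult_right[OF assms(4), of "sqnorm M h"] by simp
  qed
  then show ?thesis by (simp add: LIM_zero_iff)
qed

lemma tendsto_sqnorm:
  assumes "\<And>n. sqint M (f n)" "sqint M g" "(\<lambda>n. sqnorm M (\<lambda>x. f n x - g x)) \<longlonglongrightarrow> 0"
  shows "(\<lambda>n. sqnorm M (f n)) \<longlonglongrightarrow> sqnorm M g"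
proof -
  have "(\<lambda>n. sqnorm M (f n) - sqnorm M g) \<longlonglongrightarrow> 0"
  proof (rule Lim_null_comparison[OF _ assms(3)])
    show "\<forall>\<^sub>F n in sequentially. norm (sqnorm M (f n) - sqnorm M g) \<le> sqnorm M (\<lambda>x. f n x - g x)"
      using sqnorm_le_add_diff[OF assms(1,2)] sqnorm_le_add_diff[OF assms(2,1)]
      by (auto simp: sqnorm_minus_commute[of M g] abs_le_iff algebra_simps)
  qed
  then show ?thesis by (simp add: LIM_zero_iff)
qed

text \<open>The error \<open>\<langle>f n, g n - g'\<rangle>\<close> is at most \<open>C\<close>
  times a norm tending to 0, so convergence against the single function \<open>g'\<close> decides
  the limit.\<close>

lemma tendsto_sqip_weak_strong:
  assumes f: "\<And>n. sqint M (f n)" "\<And>n. sqnorm M (f n) \<le> C"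
    and g: "\<And>n. sqint M (g n)" "sqint M g'" "(\<lambda>n. sqnorm M (\<lambda>x. g n x - g' x)) \<longlonglongrightarrow> 0"
    and w: "(\<lambda>n. sqip M (f n) g') \<longlonglongrightarrow> l"
  shows "(\<lambda>n. sqip M (f n) (g n)) \<longlonglongrightarrow> l"
proof -
  have "(\<lambda>n. sqip M (f n) (g n) - sqip M (f n) g') \<longlonglongrightarrow> 0"
  proof (rule Lim_null_comparison)
    show "\<forall>\<^sub>F n in sequentially. norm (sqip M (f n) (g n) - sqip M (f n) g') \<le> C * sqnorm M (\<lambda>x. g n x - g' x)"
    proof (intro always_eventually allI)
      fix n
      have "norm (sqip M (f n) (g n) - sqip M (f n) g') \<le> sqnorm M (f n) * sqnorm M (\<lambda>x. g n x - g' x)"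
        using sqip_Cauchy_Schwarz[OF f(1) sqint_diff[OF g(1,2)]]
        by (auto simp: sqip_diff_right[OF g(1,2) f(1)])
      also have "\<dots> \<le> C * sqnorm M (\<lambda>x. g n x - g' x)"
        by (intro mult_right_mono f) simp
      finally show "norm (sqip M (f n) (g n) - sqip M (f n) g') \<le> C * sqnorm M (\<lambda>x. g n x - g' x)" .
    qed
    show "(\<lambda>n. C * sqnorm M (\<lambda>x. g n x - g' x)) \<longlonglongrightarrow> 0"
      using tendsto_mult_left[OF g(3), of C] by simp
  qed
  from tendsto_add[OF this w] show ?thesis by simp
qed

section \<open>Completeness of L2 over a finite measure\<close>

text \<open>By Cauchy-Schwarz against the constant 1, the integrals of
  \<open>norm (f (Suc n) x - f n x)\<close> are dominated by a geometric series. The sum of the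
  increments is therefore finite almost everywhere, and there the telescoping series for
  \<open>f n x - f 0 x\<close> converges absolutely.\<close>

lemma sqint_fast_Cauchy_AE_convergent:
  fixes f :: "nat \<Rightarrow> 'a \<Rightarrow> 'b::euclidean_space"
  assumes "finite_measure M" and f: "\<And>n. sqint M (f n)"
    and fast: "\<And>n. sqnorm M (\<lambda>x. f (Suc n) x - f n x) \<le> (1/2)^n"
  shows "AE x in M. convergent (\<lambda>n. f n x)"
proof -
  have [measurable]: "f n \<in> borel_measurable M" for n using f by (rule sqint_measurable)
  define d where "d n x = norm (f (Suc n) x - f n x)" for n x
  have [measurable]: "d n \<in> borel_measurable M" for n unfolding d_def by measurable
  have sd: "sqint M (d n)" for n
    by (rule sqint_bound[OF _ sqint_diff[OF f f], of _ "Suc n" n]) (auto simp: d_def)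
  have one: "sqint M (\<lambda>x. 1::real)" by (rule sqint_const) fact
  define c where "c = sqnorm M (\<lambda>x. 1::real)"
  have id: "integrable M (d n)" for n
    using integrable_inner_sqint[OF sd one] by simp
  have bd: "(\<integral>x. d n x \<partial>M) \<le> c * (1/2)^n" for n
  proof -
    have "(\<integral>x. d n x \<partial>M) = sqip M (d n) (\<lambda>x. 1)" by (simp add: sqip_def)
    also have "\<dots> \<le> sqnorm M (d n) * c"
      unfolding c_def using sqip_Cauchy_Schwarz[OF sd one, of n] by linarith
    also have "sqnorm M (d n) = sqnorm M (\<lambda>x. f (Suc n) x - f n x)"
      by (simp add: sqnorm_def d_def)
    also have "\<dots> * c \<le> (1/2)^n * c"
      by (intro mult_right_mono fast) (simp add: c_def)
    finally show ?thesis by (simp add: mult.commute)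
  qed
  have c0: "0 \<le> c" by (simp add: c_def)
  have summ: "summable (\<lambda>n. c * (1/2)^n)" by (intro summable_mult) simp
  have "(\<integral>\<^sup>+x. (\<Sum>n. ennreal (d n x)) \<partial>M) = (\<Sum>n. \<integral>\<^sup>+x. ennreal (d n x) \<partial>M)"
    by (rule nn_integral_suminf) simp
  also have "\<dots> = (\<Sum>n. ennreal (\<integral>x. d n x \<partial>M))"
    by (intro suminf_cong nn_integral_eq_integral id) (auto simp: d_def)
  also have "\<dots> \<le> (\<Sum>n. ennreal (c * (1/2)^n))"
    by (intro suminf_le ennreal_leI bd) auto
  also have "\<dots> = ennreal (\<Sum>n. c * (1/2)^n)"
    by (rule suminf_ennreal2) (use c0 summ in auto)
  also have "\<dots> < \<infinity>" by simp
  finally have "(\<integral>\<^sup>+x. (\<Sum>n. ennreal (d n x)) \<partial>M) \<noteq> \<infinity>" by simp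
  then have "AE x in M. (\<Sum>n. ennreal (d n x)) \<noteq> \<infinity>"
    by (intro nn_integral_PInf_AE) auto
  then show ?thesis
  proof eventually_elim
    case (elim x)
    have "summable (\<lambda>n. norm (f (Suc n) x - f n x))"
      unfolding d_def[symmetric]
    proof (rule summable_suminf_not_top)
      show "(\<Sum>n. ennreal (d n x)) \<noteq> top" using elim unfolding infinity_ennreal_def .
    qed (simp add: d_def)
    then have "summable (\<lambda>n. f (Suc n) x - f n x)" by (rule summable_norm_cancel)
    then have "convergent (\<lambda>n. \<Sum>i<n. f (Suc i) x - f i x)"
      by (simp add: summable_iff_convergent)
    then have "convergent (\<lambda>n. f n x - f 0 x)" by (simp only: sum_lessThan_telescope[of "\<lambda>n. f n x"])
    then have "convergent (\<lambda>n. (f n x - f 0 x) + f 0 x)"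
      by (intro convergent_add convergent_const)
    then show ?case by simp
  qed
qed

text \<open>Riesz-Fischer: the almost everywhere limit of a rapidly converging subsequence is the
  candidate, and Fatou's lemma along that subsequence turns the Cauchy estimates for
  \<open>f n - f m\<close> into estimates for \<open>f n - g\<close>.\<close>

lemma sqint_complete:
  fixes f :: "nat \<Rightarrow> 'a \<Rightarrow> 'b::euclidean_space"
  assumes M: "finite_measure M" and f: "\<And>n. sqint M (f n)"
    and Cauchy: "\<And>e. e > 0 \<Longrightarrow> \<exists>N. \<forall>m\<ge>N. \<forall>n\<ge>N. sqnorm M (\<lambda>x. f m x - f n x) < e"
  shows "\<exists>g. sqint M g \<and> (\<lambda>n. sqnorm M (\<lambda>x. f n x - g x)) \<longlonglongrightarrow> 0"
proof -
  have [measurable]: "f n \<in> borel_measurable M" for n using f by (rule sqint_measurable)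
  have "\<forall>k. \<exists>N. \<forall>m\<ge>N. \<forall>n\<ge>N. sqnorm M (\<lambda>x. f m x - f n x) < (1/2)^k"
    using Cauchy by simp
  then obtain N where N: "\<And>k m n. m \<ge> N k \<Longrightarrow> n \<ge> N k \<Longrightarrow> sqnorm M (\<lambda>x. f m x - f n x) < (1/2)^k"
    by metis
  \<comment> \<open>Summing all earlier \<open>N i\<close> makes the indices monotone and at least
    \<open>N k\<close>; the extra \<open>k\<close> makes them strictly increasing.\<close>
  define r where "r k = (\<Sum>i\<le>k. N i) + k" for k
  have rN: "N k \<le> r k" for k
    unfolding r_def by (rule trans_le_add1[OF member_le_sum]) auto
  have rSuc: "r k < r (Suc k)" for k by (simp add: r_def)
  then have rmono: "strict_mono r" by (simp add: strict_mono_Suc_iff)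
  have "sqnorm M (\<lambda>x. f (r (Suc n)) x - f (r n) x) \<le> (1/2)^n" for n
    using N[of n "r (Suc n)" "r n"] rN[of n] rSuc[of n] by simp
  then have AEconv: "AE x in M. convergent (\<lambda>n. f (r n) x)"
    by (intro sqint_fast_Cauchy_AE_convergent M f)
  \<comment> \<open>Where the subsequence diverges, \<open>lim\<close> has an unspecified value;
    this happens only on a null set, and the total function is still measurable.\<close>
  define g where "g x = lim (\<lambda>n. f (r n) x)" for x
  have gm [measurable]: "g \<in> borel_measurable M" unfolding g_def by measurable
  have lim: "AE x in M. (\<lambda>n. f (r n) x) \<longlonglongrightarrow> g x"
    using AEconv by eventually_elim (auto simp: g_def convergent_LIMSEQ_iff)
  have fatou: "(\<integral>\<^sup>+x. ennreal ((norm (f n x - g x))\<^sup>2) \<partial>M) \<le> ennreal (e\<^sup>2)"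
    if "e > 0" and K: "\<And>m. m \<ge> K \<Longrightarrow> sqnorm M (\<lambda>x. f n x - f m x) < e" for n e K
  proof -
    have "AE x in M. ennreal ((norm (f n x - g x))\<^sup>2)
        = liminf (\<lambda>k. ennreal ((norm (f n x - f (r k) x))\<^sup>2))"
      using lim
    proof eventually_elim
      case (elim x)
      then have "(\<lambda>k. ennreal ((norm (f n x - f (r k) x))\<^sup>2)) \<longlonglongrightarrow> ennreal ((norm (f n x - g x))\<^sup>2)"
        by (intro tendsto_intros tendsto_ennrealI)
      then show ?case by (intro lim_imp_Liminf[OF sequentially_bot, symmetric])
    qed
    then have "(\<integral>\<^sup>+x. ennreal ((norm (f n x - g x))\<^sup>2) \<partial>M)
      = (\<integral>\<^sup>+x. liminf (\<lambda>k. ennreal ((norm (f n x - f (r k) x))\<^sup>2)) \<partial>M)"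
      by (rule nn_integral_cong_AE)
    also have "\<dots> \<le> liminf (\<lambda>k. \<integral>\<^sup>+x. ennreal ((norm (f n x - f (r k) x))\<^sup>2) \<partial>M)"
      by (rule nn_integral_liminf) simp
    also have "\<dots> \<le> ennreal (e\<^sup>2)"
    proof (rule Liminf_le)
      show "\<forall>\<^sub>F k in sequentially. (\<integral>\<^sup>+x. ennreal ((norm (f n x - f (r k) x))\<^sup>2) \<partial>M) \<le> ennreal (e\<^sup>2)"
        using eventually_ge_at_top[of K]
      proof eventually_elim
        case (elim k)
        have "sqint M (\<lambda>x. f n x - f (r k) x)" by (intro sqint_diff f)
        then have "(\<integral>\<^sup>+x. ennreal ((norm (f n x - f (r k) x))\<^sup>2) \<partial>M)
          = ennreal ((sqnorm M (\<lambda>x. f n x - f (r k) x))\<^sup>2)"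
          by (subst nn_integral_eq_integral) (auto simp: sqint_def sqnorm_def)
        also have "\<dots> \<le> ennreal (e\<^sup>2)"
        proof (intro ennreal_leI power_mono)
          show "sqnorm M (\<lambda>x. f n x - f (r k) x) \<le> e"
            using K[of "r k"] elim seq_suble[OF rmono, of k] by simp
        qed simp
        finally show ?case .
      qed
    qed simp
    finally show ?thesis .
  qed
  have close: "sqint M (\<lambda>x. f n x - g x)" "sqnorm M (\<lambda>x. f n x - g x) \<le> e"
    if "e > 0" and K: "\<And>m. m \<ge> K \<Longrightarrow> sqnorm M (\<lambda>x. f n x - f m x) < e" for n e K
  proof -
    have le: "(\<integral>\<^sup>+x. ennreal ((norm (f n x - g x))\<^sup>2) \<partial>M) \<le> ennreal (e\<^sup>2)" by (rule fatou) fact+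
    have int: "integrable M (\<lambda>x. (norm (f n x - g x))\<^sup>2)"
    proof (rule integrableI_bounded)
      have "(\<integral>\<^sup>+x. ennreal (norm ((norm (f n x - g x))\<^sup>2)) \<partial>M) \<le> ennreal (e\<^sup>2)" using le by simp
      also have "\<dots> < \<infinity>" by simp
      finally show "(\<integral>\<^sup>+x. ennreal (norm ((norm (f n x - g x))\<^sup>2)) \<partial>M) < \<infinity>" .
    qed simp
    then show "sqint M (\<lambda>x. f n x - g x)" by (simp add: sqint_def)
    have "(\<integral>x. (norm (f n x - g x))\<^sup>2 \<partial>M) \<le> e\<^sup>2"
      using le by (subst (asm) nn_integral_eq_integral[OF int]) auto
    then show "sqnorm M (\<lambda>x. f n x - g x) \<le> e"
      using that(1) by (simp add: sqnorm_def real_le_lsqrt)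
  qed
  obtain N1 where N1: "\<And>m. m \<ge> N1 \<Longrightarrow> sqnorm M (\<lambda>x. f N1 x - f m x) < 1"
    using Cauchy[of 1] by auto
  \<comment> \<open>Fatou only controls differences \<open>f n - g\<close>, so \<open>g\<close> is
    recovered as a difference of two square integrable functions.\<close>
  have "sqint M (\<lambda>x. f N1 x - (f N1 x - g x))"
    by (intro sqint_diff f close(1)[of 1 N1]) (use N1 in auto)
  then have "sqint M g" by simp
  moreover have "(\<lambda>n. sqnorm M (\<lambda>x. f n x - g x)) \<longlonglongrightarrow> 0"
  proof (rule LIMSEQ_I)
    fix e :: real assume "e > 0"
    then obtain K where K: "\<And>m n. m \<ge> K \<Longrightarrow> n \<ge> K \<Longrightarrow> sqnorm M (\<lambda>x. f n x - f m x) < e/2"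
      using Cauchy[of "e/2"] by auto
    have "sqnorm M (\<lambda>x. f n x - g x) \<le> e/2" if "n \<ge> K" for n
      using close(2)[of "e/2" K n] K that \<open>e > 0\<close> by auto
    then show "\<exists>N. \<forall>n\<ge>N. norm (sqnorm M (\<lambda>x. f n x - g x) - 0) < e"
      using \<open>e > 0\<close> by (intro exI[of _ K]) force
  qed
  ultimately show ?thesis by blast
qed

section \<open>Closed subspaces, Riesz representation and orthogonal projection\<close>

text \<open>Closedness applied to a constant sequence allows a member to be replaced by any square
  integrable function that agrees with it almost everywhere, so the set corresponds to a closed
  subspace of the quotient space L2.\<close>

definition sq_subspace :: "'a measure \<Rightarrow> ('a \<Rightarrow> 'b::euclidean_space) set \<Rightarrow> bool" where
  "sq_subspace M V \<longleftrightarrow> V \<noteq> {} \<and> (\<forall>f\<in>V. sqint M f)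
     \<and> (\<forall>f\<in>V. \<forall>g\<in>V. \<forall>a. (\<lambda>x. f x + a *\<^sub>R g x) \<in> V)
     \<and> (\<forall>f g. (\<forall>n. f n \<in> V) \<longrightarrow> sqint M g \<longrightarrow> (\<lambda>n::nat. sqnorm M (\<lambda>x. f n x - g x)) \<longlonglongrightarrow> 0 \<longrightarrow> g \<in> V)"

lemma sq_subspace_lin: "sq_subspace M V \<Longrightarrow> f \<in> V \<Longrightarrow> g \<in> V \<Longrightarrow> (\<lambda>x. f x + a *\<^sub>R g x) \<in> V"
  by (simp add: sq_subspace_def)

lemma sq_subspace_closed:
  "sq_subspace M V \<Longrightarrow> (\<And>n. f n \<in> V) \<Longrightarrow> sqint M g \<Longrightarrow> (\<lambda>n::nat. sqnorm M (\<lambda>x. f n x - g x)) \<longlonglongrightarrow> 0 \<Longrightarrow> g \<in> V"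
  unfolding sq_subspace_def by blast

lemma sq_subspace_UNIV: "sq_subspace M {f. sqint M f}"
  unfolding sq_subspace_def by (auto intro: sqint_add sqint_scaleR sqint_zero)

text \<open>The representing function minimises \<open>\<parallel>w\<parallel>\<^sup>2 - 2 L w\<close>; the parallelogram law makes
  minimising sequences Cauchy.\<close>

lemma sq_Riesz:
  fixes V :: "('a \<Rightarrow> 'b::euclidean_space) set"
  assumes M: "finite_measure M" and V: "sq_subspace M V"
    and L: "\<And>f g a. f \<in> V \<Longrightarrow> g \<in> V \<Longrightarrow> L (\<lambda>x. f x + a *\<^sub>R g x) = L f + a * L g"
    and C: "\<And>f. f \<in> V \<Longrightarrow> \<bar>L f\<bar> \<le> C * sqnorm M f"
  shows "\<exists>w\<in>V. \<forall>v\<in>V. sqip M w v = L v"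
proof -
  have Vs: "sqint M f" if "f \<in> V" for f using V that by (auto simp: sq_subspace_def)
  have Vl: "(\<lambda>x. f x + a *\<^sub>R g x) \<in> V" if "f \<in> V" "g \<in> V" for f g a
    using V that by (auto simp: sq_subspace_def)
  have Vc: "g \<in> V" if "\<And>n. f n \<in> V" "sqint M g" "(\<lambda>n::nat. sqnorm M (\<lambda>x. f n x - g x)) \<longlonglongrightarrow> 0" for f g
    using V that unfolding sq_subspace_def by blast
  define J where "J f = (sqnorm M f)\<^sup>2 - 2 * L f" for f
  \<comment> \<open>From \<open>J f \<ge> s\<^sup>2 - 2 * C * s\<close> with
    \<open>s = sqnorm M f\<close>, by completing the square.\<close>
  have J_ge: "- C\<^sup>2 \<le> J f" if "f \<in> V" for f
  proof -
    have "2 * L f \<le> 2 * C * sqnorm M f" using C[OF that] by simp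
    moreover have "0 \<le> (sqnorm M f - C)\<^sup>2" by simp
    ultimately show ?thesis unfolding J_def by (simp add: power2_eq_square algebra_simps)
  qed
  have bdd: "bdd_below (J ` V)" using J_ge by (auto intro!: bdd_belowI)
  have ne: "V \<noteq> {}" using V by (auto simp: sq_subspace_def)
  define d where "d = (INF f\<in>V. J f)"
  have d_le: "d \<le> J f" if "f \<in> V" for f unfolding d_def by (rule cINF_lower[OF bdd that])
  have "\<exists>f\<in>V. J f < d + inverse (real (Suc n))" for n
    using cINF_less_iff[OF ne bdd, of "d + inverse (real (Suc n))"] by (simp add: d_def)
  then obtain f where f: "\<And>n. f n \<in> V" "\<And>n. J (f n) < d + inverse (real (Suc n))" by metis
  have par: "(sqnorm M (\<lambda>x. p x - q x))\<^sup>2 \<le> 2 * (J p - d) + 2 * (J q - d)" if "p \<in> V" "q \<in> V" for p q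
  proof -
    have sp: "sqint M p" "sqint M q" using that Vs by auto
    \<comment> \<open>The midpoint of \<open>p\<close> and \<open>q\<close>, written with the one
      operation under which \<open>V\<close> is known to be closed.\<close>
    define m where "m = (\<lambda>x. p x + (1/2) *\<^sub>R (q x + (-1) *\<^sub>R p x))"
    have qp: "(\<lambda>x. q x + (-1) *\<^sub>R p x) \<in> V" using that Vl by blast
    have mV: "m \<in> V" unfolding m_def by (rule Vl[OF that(1) qp])
    have Lqp: "L (\<lambda>x. q x + (-1) *\<^sub>R p x) = L q - L p" using L[OF that(2,1), of "-1"] by simp
    have Lm: "L m = (L p + L q) / 2"
      unfolding m_def L[OF that(1) qp] Lqp by (simp add: field_simps)
    have s1: "(sqnorm M (\<lambda>x. q x + (-1) *\<^sub>R p x))\<^sup>2 = (sqnorm M p)\<^sup>2 - 2 * sqip M p q + (sqnorm M q)\<^sup>2"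
      using sqnorm_add_power2[OF sp(2,1), of "-1"] by (simp add: sqip_commute)
    have "sqip M p (\<lambda>x. q x + (-1) *\<^sub>R p x) = sqip M p q - (sqnorm M p)\<^sup>2"
      using sqip_diff_right[OF sp(2,1,1)] by (simp add: sqip_self)
    then have "(sqnorm M m)\<^sup>2 = (sqnorm M p)\<^sup>2 + (sqip M p q - (sqnorm M p)\<^sup>2)
        + (1/4) * (sqnorm M (\<lambda>x. q x + (-1) *\<^sub>R p x))\<^sup>2"
      unfolding m_def sqnorm_add_power2[OF sp(1) Vs[OF qp]] by (simp add: power2_eq_square)
    then have "4 * (sqnorm M m)\<^sup>2 = 2 * (sqnorm M p)\<^sup>2 + 2 * (sqnorm M q)\<^sup>2 - (sqnorm M (\<lambda>x. p x - q x))\<^sup>2"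
      unfolding sqnorm_minus_commute[of M p q] using s1 by (simp add: add_divide_distrib diff_divide_distrib)
    then have "(sqnorm M (\<lambda>x. p x - q x))\<^sup>2 = 2 * J p + 2 * J q - 4 * J m"
      unfolding J_def Lm by (simp add: field_simps)
    then show ?thesis using d_le[OF mV] by simp
  qed
  have "\<exists>g. sqint M g \<and> (\<lambda>n. sqnorm M (\<lambda>x. f n x - g x)) \<longlonglongrightarrow> 0"
  proof (rule sqint_complete[OF M Vs[OF f(1)]])
    fix e :: real assume "e > 0"
    then obtain N where N: "inverse (real (Suc N)) < e\<^sup>2 / 4"
      using reals_Archimedean[of "e\<^sup>2 / 4"] by auto
    have "sqnorm M (\<lambda>x. f m x - f n x) < e" if "m \<ge> N" "n \<ge> N" for m n
    proof -
      have "inverse (real (Suc m)) < e\<^sup>2 / 4" "inverse (real (Suc n)) < e\<^sup>2 / 4"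
        using N that by (smt (verit) le_imp_inverse_le of_nat_0_less_iff of_nat_mono Suc_le_mono zero_less_Suc)+
      then have "(sqnorm M (\<lambda>x. f m x - f n x))\<^sup>2 < e\<^sup>2"
        using par[OF f(1) f(1), of m n] f(2)[of m] f(2)[of n] by simp
      then show ?thesis using \<open>e > 0\<close> by (simp add: power_less_imp_less_base)
    qed
    then show "\<exists>N. \<forall>m\<ge>N. \<forall>n\<ge>N. sqnorm M (\<lambda>x. f m x - f n x) < e" by blast
  qed
  then obtain w where w: "sqint M w" "(\<lambda>n. sqnorm M (\<lambda>x. f n x - w x)) \<longlonglongrightarrow> 0" by blast
  have wV: "w \<in> V" by (rule Vc[OF f(1) w])
  have Ldiff: "L (\<lambda>x. p x - q x) = L p - L q" if "p \<in> V" "q \<in> V" for p q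
    using L[OF that, of "-1"] by simp
  have "(\<lambda>n. J (f n)) \<longlonglongrightarrow> J w"
  proof -
    have "(\<lambda>n. L (f n) - L w) \<longlonglongrightarrow> 0"
    proof (rule Lim_null_comparison)
      show "\<forall>\<^sub>F n in sequentially. norm (L (f n) - L w) \<le> C * sqnorm M (\<lambda>x. f n x - w x)"
        using C[OF Vl[OF f(1) wV, of _ "-1"]] by (simp add: Ldiff[OF f(1) wV])
      show "(\<lambda>n. C * sqnorm M (\<lambda>x. f n x - w x)) \<longlonglongrightarrow> 0"
        using tendsto_mult_left[OF w(2), of C] by simp
    qed
    then have "(\<lambda>n. L (f n)) \<longlonglongrightarrow> L w" by (simp add: LIM_zero_iff)
    with tendsto_sqnorm[OF Vs[OF f(1)] w] show ?thesis
      unfolding J_def by (intro tendsto_intros)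
  qed
  moreover have "(\<lambda>n. d + inverse (real (Suc n))) \<longlonglongrightarrow> d + 0"
    by (intro tendsto_intros LIMSEQ_inverse_real_of_nat)
  ultimately have "J w \<le> d + 0"
    by (rule LIMSEQ_le) (use f(2) less_imp_le in blast)
  have "sqip M w v = L v" if v: "v \<in> V" for v
  proof -
    \<comment> \<open>As \<open>w\<close> minimises \<open>J\<close>, the difference
      \<open>J (w + t v) - J w\<close> is this nonnegative quadratic in \<open>t\<close> without
      constant term, which forces its linear coefficient to vanish.\<close>
    have "0 \<le> 0 + 2 * t * (sqip M w v - L v) + t\<^sup>2 * (sqnorm M v)\<^sup>2" for t
    proof -
      have "J w \<le> J (\<lambda>x. w x + t *\<^sub>R v x)"
        using \<open>J w \<le> d + 0\<close> d_le[OF Vl[OF wV v, of t]] by simp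
      then show ?thesis
        unfolding J_def sqnorm_add_power2[OF Vs[OF wV] Vs[OF v]] L[OF wV v] by (simp add: algebra_simps)
    qed
    then have "(sqip M w v - L v)\<^sup>2 \<le> 0 * (sqnorm M v)\<^sup>2"
      by (rule quadratic_nonneg_imp_le) simp
    then show ?thesis by simp
  qed
  with wV show ?thesis by blast
qed

text \<open>The projection is the element of \<open>V\<close> that represents the functional
  \<open>\<langle>f, v\<rangle>\<close> on \<open>V\<close>.\<close>

lemma sq_projection:
  fixes V :: "('a \<Rightarrow> 'b::euclidean_space) set"
  assumes "finite_measure M" "sq_subspace M V" "sqint M f"
  shows "\<exists>p\<in>V. \<forall>v\<in>V. sqip M (\<lambda>x. f x - p x) v = 0"
proof -
  have Vs: "sqint M f" if "f \<in> V" for f using assms(2) that by (auto simp: sq_subspace_def)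
  have "\<exists>w\<in>V. \<forall>v\<in>V. sqip M w v = sqip M f v"
    using assms(1,2)
  proof (rule sq_Riesz)
    show "sqip M f (\<lambda>x. g x + a *\<^sub>R h x) = sqip M f g + a * sqip M f h" if "g \<in> V" "h \<in> V" for g h a
      using Vs that assms(3) by (simp add: sqip_add_right sqip_scaleR_right sqint_scaleR)
    show "\<bar>sqip M f g\<bar> \<le> sqnorm M f * sqnorm M g" if "g \<in> V" for g
      using sqip_Cauchy_Schwarz Vs that assms(3) by blast
  qed
  then obtain w where w: "w \<in> V" "\<And>v. v \<in> V \<Longrightarrow> sqip M w v = sqip M f v" by blast
  then show ?thesis using Vs assms(3) by (intro bexI[of _ w]) (auto simp: sqip_diff_left)
qed

section \<open>Weak sequential compactness of bounded sequences\<close>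

text \<open>Bolzano-Weierstrass for each fixed \<open>k\<close>, then a diagonal subsequence to
  treat all \<open>k\<close> at once.\<close>

lemma bounded_real_array_subseq:
  fixes a :: "nat \<Rightarrow> nat \<Rightarrow> real"
  assumes "\<And>m k. \<bar>a m k\<bar> \<le> B k"
  shows "\<exists>r. strict_mono r \<and> (\<forall>k. convergent (\<lambda>m. a (r m) k))"
proof -
  interpret subseqs "\<lambda>k s. convergent (\<lambda>m. a (s m) k)"
  proof
    fix k :: nat and s :: "nat \<Rightarrow> nat"
    have "bounded (range (\<lambda>m. a (s m) k))"
      using assms[of _ k] by (intro boundedI[of _ "B k"]) auto
    then obtain l r where "strict_mono (r::nat\<Rightarrow>nat)" "((\<lambda>m. a (s m) k) \<circ> r) \<longlonglongrightarrow> l"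
      using bounded_imp_convergent_subsequence by blast
    then show "\<exists>r. strict_mono (r::nat \<Rightarrow> nat) \<and> convergent (\<lambda>m. a ((s \<circ> r) m) k)"
      by (auto simp: convergent_def o_def)
  qed
  \<comment> \<open>From index \<open>Suc k\<close> on, the diagonal sequence is a subsequence of
    the one chosen for \<open>k\<close>; the finitely many earlier terms do not affect
    convergence.\<close>
  have "convergent (\<lambda>m. a ((diagseq \<circ> (+) (Suc k)) m) k)" for k
  proof (rule diagseq_holds)
    fix r s :: "nat \<Rightarrow> nat" and n
    assume "strict_mono r" "convergent (\<lambda>m. a (s m) n)"
    then show "convergent (\<lambda>m. a ((s \<circ> r) m) n)"
      using convergent_subseq_convergent[of "\<lambda>m. a (s m) n" r] by (simp add: o_def)
  qed
  then have "convergent (\<lambda>m. a (diagseq (m + Suc k)) k)" for k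
    unfolding o_def by (subst add.commute)
  then have "convergent (\<lambda>m. a (diagseq m) k)" for k
    using convergent_ignore_initial_segment[of "\<lambda>m. a (diagseq m) k" "Suc k"] by blast
  then show ?thesis using subseq_diagseq by blast
qed

text \<open>The test functions \<open>w\<close> for which \<open>\<langle>s n, w\<rangle>\<close> converges form a closed subspace; when it contains
  every \<open>s n\<close>, its orthogonal complement is also contained in it.\<close>

lemma sq_weakly_compact:
  fixes h :: "nat \<Rightarrow> 'a \<Rightarrow> 'b::euclidean_space"
  assumes M: "finite_measure M" and h: "\<And>n. sqint M (h n)" "\<And>n. sqnorm M (h n) \<le> C"
  shows "\<exists>r g. strict_mono r \<and> sqint M g
     \<and> (\<forall>w. sqint M w \<longrightarrow> (\<lambda>n. sqip M (h (r n)) w) \<longlonglongrightarrow> sqip M g w)"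
proof -
  have C0: "0 \<le> C" using order_trans[OF sqnorm_nonneg h(2)] .
  have hb: "\<bar>sqip M (h n) w\<bar> \<le> C * sqnorm M w" if "sqint M w" for n w
    using sqip_Cauchy_Schwarz[OF h(1) that] mult_right_mono[OF h(2) sqnorm_nonneg, of n M w] by (rule order_trans)
  \<comment> \<open>Only countably many pairings are made convergent here, those against the members
    of the sequence itself.\<close>
  obtain r where r: "strict_mono r" "\<And>k. convergent (\<lambda>m. sqip M (h (r m)) (h k))"
    using bounded_real_array_subseq[of "\<lambda>m k. sqip M (h m) (h k)" "\<lambda>k. C * sqnorm M (h k)"] hb[OF h(1)]
    by blast
  define s where "s n = h (r n)" for n
  have s: "sqint M (s n)" "sqnorm M (s n) \<le> C" for n using h by (auto simp: s_def)
  have sb: "\<bar>sqip M (s n) w\<bar> \<le> C * sqnorm M w" if "sqint M w" for n w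
    using hb[OF that] by (simp add: s_def)
  define V where "V = {w. sqint M w \<and> convergent (\<lambda>n. sqip M (s n) w)}"
  have V: "sq_subspace M V"
    unfolding sq_subspace_def
  proof (intro conjI ballI allI impI)
    show "V \<noteq> {}" using r(2) h(1) by (auto simp: V_def s_def)
    show "sqint M f" if "f \<in> V" for f using that by (simp add: V_def)
    show "(\<lambda>x. f x + a *\<^sub>R g x) \<in> V" if fg: "f \<in> V" "g \<in> V" for f g a
    proof -
      have "convergent (\<lambda>n. sqip M (s n) f + a * sqip M (s n) g)"
        using fg by (intro convergent_add convergent_mult convergent_const) (auto simp: V_def)
      moreover have "sqip M (s n) (\<lambda>x. f x + a *\<^sub>R g x) = sqip M (s n) f + a * sqip M (s n) g" for n
        using fg s(1) by (simp add: V_def sqip_add_right sqip_scaleR_right sqint_scaleR)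
      ultimately show ?thesis using fg by (simp add: V_def sqint_add sqint_scaleR)
    qed
    fix f :: "nat \<Rightarrow> 'a \<Rightarrow> 'b" and g
    assume f: "\<forall>n. f n \<in> V" and g: "sqint M g" "(\<lambda>n. sqnorm M (\<lambda>x. f n x - g x)) \<longlonglongrightarrow> 0"
    have fs: "sqint M (f n)" for n using f by (simp add: V_def)
    have "Cauchy (\<lambda>n. sqip M (s n) g)"
    proof (rule metric_CauchyI)
      fix e :: real assume e: "e > 0"
      \<comment> \<open>One third of \<open>e\<close> for each of the two replacements of
        \<open>g\<close> by \<open>f k\<close> and one for the Cauchy estimate; \<open>C + 1\<close>
        keeps the denominator positive when \<open>C = 0\<close>.\<close>
      define e' where "e' = e / (3 * (C + 1))"
      have e': "e' > 0" "C * e' < e / 3"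
        using e C0 by (auto simp: e'_def field_simps)
      obtain k where k: "sqnorm M (\<lambda>x. f k x - g x) < e'"
        using LIMSEQ_D[OF g(2) e'(1)] by auto
      have close: "\<bar>sqip M (s n) (f k) - sqip M (s n) g\<bar> < e / 3" for n
      proof -
        have "\<bar>sqip M (s n) (f k) - sqip M (s n) g\<bar> \<le> C * sqnorm M (\<lambda>x. f k x - g x)"
          using sb[OF sqint_diff[OF fs g(1)], of n k] by (simp add: sqip_diff_right[OF fs g(1) s(1)])
        also have "\<dots> \<le> C * e'" using k C0 by (intro mult_left_mono) auto
        finally show ?thesis using e'(2) by simp
      qed
      have "Cauchy (\<lambda>n. sqip M (s n) (f k))"
        using f by (auto simp: V_def intro: convergent_Cauchy)
      then obtain N where N: "\<And>m n. m \<ge> N \<Longrightarrow> n \<ge> N \<Longrightarrow> dist (sqip M (s m) (f k)) (sqip M (s n) (f k)) < e / 3"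
        using metric_CauchyD[of _ "e / 3"] e by (metis divide_pos_pos zero_less_numeral)
      have "dist (sqip M (s m) g) (sqip M (s n) g) < e" if "m \<ge> N" "n \<ge> N" for m n
        using N[OF that] close[of m] close[of n] unfolding dist_real_def abs_less_iff by linarith
      then show "\<exists>N. \<forall>m\<ge>N. \<forall>n\<ge>N. dist (sqip M (s m) g) (sqip M (s n) g) < e" by blast
    qed
    then show "g \<in> V" using g(1) by (simp add: V_def Cauchy_convergent)
  qed
  have conv: "convergent (\<lambda>n. sqip M (s n) w)" if w: "sqint M w" for w
  proof -
    obtain p where p: "p \<in> V" "\<And>v. v \<in> V \<Longrightarrow> sqip M (\<lambda>x. w x - p x) v = 0"
      using sq_projection[OF M V w] by blast
    have ps: "sqint M p" using p by (simp add: V_def)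
    have "s n \<in> V" for n using r(2) h(1) by (simp add: V_def s_def)
    then have "sqip M (s n) w = sqip M (s n) p" for n
      using p(2)[of "s n"] sqip_diff_left[OF w ps s(1), of n] by (simp add: sqip_commute)
    then show ?thesis using p(1) by (simp add: V_def)
  qed
  define L where "L w = lim (\<lambda>n. sqip M (s n) w)" for w
  have lim: "(\<lambda>n. sqip M (s n) w) \<longlonglongrightarrow> L w" if "sqint M w" for w
    using conv[OF that] by (simp add: L_def convergent_LIMSEQ_iff)
  have "\<exists>g\<in>{f. sqint M f}. \<forall>v\<in>{f. sqint M f}. sqip M g v = L v"
    using M sq_subspace_UNIV
  proof (rule sq_Riesz)
    show "L (\<lambda>x. f x + a *\<^sub>R g x) = L f + a * L g" if "f \<in> {f. sqint M f}" "g \<in> {f. sqint M f}" for f g a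
    proof (rule LIMSEQ_unique)
      have fg: "sqint M f" "sqint M g" "sqint M (\<lambda>x. a *\<^sub>R g x)" using that by (auto intro: sqint_scaleR)
      show "(\<lambda>n. sqip M (s n) (\<lambda>x. f x + a *\<^sub>R g x)) \<longlonglongrightarrow> L (\<lambda>x. f x + a *\<^sub>R g x)"
        by (intro lim sqint_add fg)
      show "(\<lambda>n. sqip M (s n) (\<lambda>x. f x + a *\<^sub>R g x)) \<longlonglongrightarrow> L f + a * L g"
        unfolding sqip_add_right[OF fg(1,3) s(1)] sqip_scaleR_right
        by (intro tendsto_intros lim fg)
    qed
    show "\<bar>L f\<bar> \<le> C * sqnorm M f" if "f \<in> {f. sqint M f}" for f
    proof (rule LIMSEQ_le_const2)
      show "(\<lambda>n. \<bar>sqip M (s n) f\<bar>) \<longlonglongrightarrow> \<bar>L f\<bar>"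
        using that by (intro tendsto_rabs lim) simp
    qed (use that sb in auto)
  qed
  then obtain g where "sqint M g" "\<And>v. sqint M v \<Longrightarrow> sqip M g v = L v" by auto
  with lim r(1) show ?thesis unfolding s_def by metis
qed

section \<open>Smooth bump functions\<close>

text \<open>For \<open>k = 0\<close> this is the classical smooth function vanishing on the negative
  axis. Differentiation produces powers of \<open>1 / t\<close>, so the index \<open>k\<close> makes
  the family stable under it up to linear combinations. The parameter \<open>e\<close> will tend to
  0, which pushes the function with \<open>k = 0\<close> towards the indicator of the positive
  axis.\<close>

definition flat :: "real \<Rightarrow> nat \<Rightarrow> real \<Rightarrow> real" where
  "flat e k t = (if t > 0 then exp (- e / t) / t ^ k else 0)"

text \<open>This is the difference quotient of \<open>flat e k\<close> at 0. With
  \<open>s = e / t\<close>, the growth of \<open>exp s\<close> beats the power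
  \<open>s ^ Suc k\<close> as \<open>t\<close> decreases to 0.\<close>

lemma flat_div_tendsto_0:
  assumes "e > 0"
  shows "((\<lambda>t. flat e k t / t) \<longlongrightarrow> 0) (at 0)"
proof -
  have "filterlim (\<lambda>t::real. e * inverse t) at_top (at_right 0)"
    by (rule filterlim_tendsto_pos_mult_at_top[OF tendsto_const assms filterlim_inverse_at_top_right])
  then have "((\<lambda>t. (e * inverse t) ^ (Suc k) / exp (e * inverse t)) \<longlongrightarrow> 0) (at_right 0)"
    by (rule filterlim_compose[OF tendsto_power_div_exp_0])
  then have "((\<lambda>t. (1 / e ^ Suc k) * ((e * inverse t) ^ (Suc k) / exp (e * inverse t))) \<longlongrightarrow> (1 / e ^ Suc k) * 0) (at_right 0)"
    by (intro tendsto_intros)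
  moreover have "\<forall>\<^sub>F t in at_right 0. (1 / e ^ Suc k) * ((e * inverse t) ^ (Suc k) / exp (e * inverse t)) = flat e k t / t"
    using eventually_at_right_less[of "0::real"]
    by eventually_elim (use assms in \<open>simp add: flat_def exp_minus field_simps\<close>)
  ultimately have right: "((\<lambda>t. flat e k t / t) \<longlongrightarrow> 0) (at_right 0)"
    by (simp add: tendsto_cong)
  have "\<forall>\<^sub>F t in at_left 0. flat e k t / t = 0"
    by (auto simp: flat_def eventually_at_filter)
  then have "((\<lambda>t. flat e k t / t) \<longlongrightarrow> 0) (at_left 0)"
    by (rule tendsto_eventually)
  then show ?thesis using right by (simp add: filterlim_split_at)
qed

lemma flat_has_derivative:
  assumes "e > 0"
  shows "(flat e k has_real_derivative (e * flat e (k + 2) t - real k * flat e (k + 1) t)) (at t)"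
proof -
  consider "t > 0" | "t < 0" | "t = 0" by linarith
  then show ?thesis
  proof cases
    case 1
    have "((\<lambda>t. exp (- e / t) / t ^ k) has_real_derivative (e * flat e (k + 2) t - real k * flat e (k + 1) t)) (at t)"
      using 1 by (auto intro!: derivative_eq_intros simp: flat_def divide_simps power2_eq_square)
        (cases k; simp add: algebra_simps)
    moreover have "\<forall>\<^sub>F s in nhds t. exp (- e / s) / s ^ k = flat e k s"
      using eventually_nhds_in_open[of "{0<..}" t] 1
      by (auto elim!: eventually_mono simp: flat_def)
    ultimately show ?thesis by (subst DERIV_cong_ev[OF refl _ refl, symmetric])
  next
    case 2
    have "\<forall>\<^sub>F s in nhds t. 0 = flat e k s"
      using eventually_nhds_in_open[of "{..<0}" t] 2
      by (auto elim!: eventually_mono simp: flat_def)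
    moreover have "((\<lambda>t. 0::real) has_real_derivative (e * flat e (k + 2) t - real k * flat e (k + 1) t)) (at t)"
      using 2 by (simp add: flat_def)
    ultimately show ?thesis by (subst DERIV_cong_ev[OF refl _ refl, symmetric])
  next
    case 3
    show ?thesis using flat_div_tendsto_0[OF assms, of k] 3
      by (simp add: has_field_derivative_iff flat_def)
  qed
qed

text \<open>Smoothness is stated through iterated partial derivatives; as this algebra is closed under partial
  derivatives, its members are smooth by induction.\<close>

inductive smooth_alg :: "(real^'n::finite \<Rightarrow> real) \<Rightarrow> bool" where
  const: "smooth_alg (\<lambda>x. c)"
| base: "e > 0 \<Longrightarrow> smooth_alg (\<lambda>x. flat e k (a * x $ i + c))"
| add: "smooth_alg f \<Longrightarrow> smooth_alg g \<Longrightarrow> smooth_alg (\<lambda>x. f x + g x)"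
| mult: "smooth_alg f \<Longrightarrow> smooth_alg g \<Longrightarrow> smooth_alg (\<lambda>x. f x * g x)"

lemma partial_eqI: "(f has_derivative f') (at x) \<Longrightarrow> partial i f x = f' (axis i 1)"
  by (simp add: partial_def flip: frechet_derivative_at)

lemma has_derivative_frechet: "f differentiable (at x) \<Longrightarrow> (f has_derivative frechet_derivative f (at x)) (at x)"
  by (simp add: frechet_derivative_works)

lemma smooth_alg_diff_partial:
  "smooth_alg f \<Longrightarrow> (\<forall>x. f differentiable (at x)) \<and> (\<forall>j. smooth_alg (partial j f))"
proof (induction rule: smooth_alg.induct)
  case (const c)
  have "partial j (\<lambda>x. c) = (\<lambda>x. 0)" for j :: 'a
    by (rule ext, subst partial_eqI[OF has_derivative_const]) simp
  then show ?case by (simp add: smooth_alg.const)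
next
  case (base e k a i c)
  define D where "D t = e * flat e (k + 2) t - real k * flat e (k + 1) t" for t
  have der: "((\<lambda>x. flat e k (a * x $ i + c)) has_derivative (\<lambda>h. D (a * x $ i + c) * (a * h $ i))) (at x)"
    for x :: "real^'a"
  proof -
    have 1: "((\<lambda>x::real^'a. a * x $ i + c) has_derivative (\<lambda>h. a * h $ i)) (at x)"
      by (auto intro!: derivative_eq_intros bounded_linear_imp_has_derivative bounded_linear_vec_nth)
    have 2: "(flat e k has_derivative (\<lambda>h. D (a * x $ i + c) * h)) (at (a * x $ i + c))"
      using flat_has_derivative[OF base, of k "a * x $ i + c"]
      unfolding has_field_derivative_def D_def .
    show ?thesis by (rule has_derivative_compose[OF 1 2])
  qed
  have "partial j (\<lambda>x. flat e k (a * x $ i + c))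
      = (\<lambda>x. (a * axis j 1 $ i) * (e * flat e (k + 2) (a * x $ i + c) + (- real k) * flat e (k + 1) (a * x $ i + c)))" for j
    by (rule ext, subst partial_eqI[OF der]) (simp add: D_def)
  moreover have "smooth_alg (\<lambda>x. (a * axis j 1 $ i) * (e * flat e (k + 2) (a * x $ i + c) + (- real k) * flat e (k + 1) (a * x $ i + c)))" for j
    by (intro smooth_alg.intros base)
  ultimately show ?case using der by (auto simp: differentiable_def)
next
  case (add f g)
  have "partial j (\<lambda>x. f x + g x) = (\<lambda>x. partial j f x + partial j g x)" for j
    using add.IH by (intro ext, subst partial_eqI[OF has_derivative_add[OF has_derivative_frechet has_derivative_frechet]])
      (auto simp: partial_def)
  then show ?case using add.IH by (simp add: smooth_alg.add differentiable_add)
next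
  case (mult f g)
  have "partial j (\<lambda>x. f x * g x) = (\<lambda>x. f x * partial j g x + partial j f x * g x)" for j
    using mult.IH by (intro ext, subst partial_eqI[OF has_derivative_mult[OF has_derivative_frechet has_derivative_frechet]])
      (auto simp: partial_def)
  then show ?case using mult by (simp add: smooth_alg.add smooth_alg.mult)
qed

lemma smooth_alg_imp_smooth_fun:
  assumes "smooth_alg f"
  shows "smooth_fun f"
proof -
  have "smooth_alg (iter_partial is f)" for "is"
    by (induction "is") (use assms smooth_alg_diff_partial in auto)
  then show ?thesis using smooth_alg_diff_partial by (auto simp: smooth_fun_def)
qed

lemma smooth_alg_prod: "finite I \<Longrightarrow> (\<And>i. i \<in> I \<Longrightarrow> smooth_alg (f i)) \<Longrightarrow> smooth_alg (\<lambda>x. \<Prod>i\<in>I. f i x)"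
  by (induction I rule: finite_induct) (simp_all add: smooth_alg.const smooth_alg.mult)

section \<open>Bumps on boxes and smooth approximation of indicators of open sets\<close>

text \<open>For \<open>e > 0\<close> this is positive exactly on the open box and bounded by 1; it
  increases to the indicator of the box as \<open>e\<close> decreases to 0.\<close>

definition bump :: "real \<Rightarrow> real^'n::finite \<Rightarrow> real^'n \<Rightarrow> real^'n \<Rightarrow> real" where
  "bump e a b x = (\<Prod>i\<in>UNIV. flat e 0 (x $ i - a $ i) * flat e 0 (b $ i - x $ i))"

lemma smooth_alg_bump:
  assumes "e > 0"
  shows "smooth_alg (bump e a b)"
proof -
  have "smooth_alg (\<lambda>x. flat e 0 (1 * x $ i + (- a $ i)) * flat e 0 ((-1) * x $ i + b $ i))" for i
    by (intro smooth_alg.intros assms)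
  then have "smooth_alg (\<lambda>x. \<Prod>i\<in>UNIV. flat e 0 (1 * x $ i + (- a $ i)) * flat e 0 ((-1) * x $ i + b $ i))"
    by (intro smooth_alg_prod) auto
  then show ?thesis by (simp add: bump_def[abs_def])
qed

lemma flat_0_range: "e > 0 \<Longrightarrow> 0 \<le> flat e 0 t \<and> flat e 0 t \<le> 1"
  by (simp add: flat_def)

lemma bump_range: "e > 0 \<Longrightarrow> 0 \<le> bump e a b x \<and> bump e a b x \<le> 1"
  unfolding bump_def using flat_0_range[of e]
  by (simp add: prod_nonneg prod_le_1 mult_le_one)

lemma bump_nonzero:
  assumes "bump e a b x \<noteq> 0"
  shows "x \<in> box a b"
  unfolding mem_box_cart
proof
  fix i
  have "flat e 0 (x $ i - a $ i) \<noteq> 0 \<and> flat e 0 (b $ i - x $ i) \<noteq> 0"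
    using assms by (simp add: bump_def)
  then show "a $ i < x $ i \<and> x $ i < b $ i"
    unfolding flat_def by (metis diff_gt_0_iff_gt)
qed

lemma bump_tendsto_1:
  assumes "x \<in> box a b"
  shows "(\<lambda>n. bump (inverse (real (Suc n))) a b x) \<longlonglongrightarrow> 1"
proof -
  have "(\<lambda>n. flat (inverse (real (Suc n))) 0 t) \<longlonglongrightarrow> 1" if "t > 0" for t
  proof -
    have "(\<lambda>n. exp (- inverse (real (Suc n)) / t)) \<longlonglongrightarrow> exp (- 0 / t)"
      using that by (intro tendsto_intros LIMSEQ_inverse_real_of_nat) auto
    then show ?thesis using that by (simp add: flat_def)
  qed
  then have "(\<lambda>n. bump (inverse (real (Suc n))) a b x) \<longlonglongrightarrow> (\<Prod>i\<in>(UNIV::'a set). 1 * 1)"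
    unfolding bump_def using assms by (intro tendsto_intros) (auto simp: mem_box_cart)
  then show ?thesis by simp
qed

text \<open>Boxes whose closure lies in \<open>U\<close> cover \<open>U\<close>, and Lindelof's
  theorem extracts countably many of them. Control of the closures is what later keeps the supports
  of finite combinations compactly inside \<open>U\<close>.\<close>

lemma open_countable_boxes:
  fixes U :: "(real^'n) set"
  assumes "open U"
  shows "\<exists>a b :: nat \<Rightarrow> real^'n. (\<forall>n. closure (box (a n) (b n)) \<subseteq> U) \<and> (\<Union>n. box (a n) (b n)) = U"
proof -
  define \<F> where "\<F> = (\<lambda>(a, b). box a b) ` {(a, b). closure (box a b) \<subseteq> U}"
  have op: "open S" if "S \<in> \<F>" for S using that by (auto simp: \<F>_def open_box)
  have un: "\<Union>\<F> = U"
  proof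
    show "\<Union>\<F> \<subseteq> U" using closure_subset by (fastforce simp: \<F>_def)
    show "U \<subseteq> \<Union>\<F>"
    proof
      fix x assume "x \<in> U"
      then obtain e where e: "e > 0" "cball x e \<subseteq> U" using assms open_contains_cball by blast
      obtain a b where ab: "x \<in> box a b" "box a b \<subseteq> ball x e"
        using rational_boxes[OF e(1), of x] by blast
      have "closure (box a b) \<subseteq> cball x e"
        using ab(2) by (intro closure_minimal) (auto simp: subset_iff)
      then have "closure (box a b) \<subseteq> U" using e(2) by (rule order_trans)
      then show "x \<in> \<Union>\<F>" using ab(1) by (auto simp: \<F>_def)
    qed
  qed
  obtain \<G> where \<G>: "\<G> \<subseteq> \<F>" "countable \<G>" "\<Union>\<G> = \<Union>\<F>" using Lindelof[OF op] by blast
  have em: "{} \<in> \<F>" unfolding \<F>_def by (rule image_eqI[of _ _ "(0, 0)"]) auto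
  \<comment> \<open>The empty box makes the family nonempty, as the enumeration by
    \<open>from_nat_into\<close> requires.\<close>
  define \<H> where "\<H> = insert {} \<G>"
  have \<H>: "countable \<H>" "\<H> \<noteq> {}" "\<H> \<subseteq> \<F>" "\<Union>\<H> = U"
    using \<G> em un by (auto simp: \<H>_def)
  have "\<exists>a b. from_nat_into \<H> n = box a b \<and> closure (box a b) \<subseteq> U" for n
  proof -
    have "from_nat_into \<H> n \<in> \<F>" using from_nat_into[OF \<H>(2), of n] \<H>(3) by (rule subsetD[rotated])
    then show ?thesis by (auto simp: \<F>_def)
  qed
  then obtain a b where ab: "\<And>n. from_nat_into \<H> n = box (a n) (b n)" "\<And>n. closure (box (a n) (b n)) \<subseteq> U"
    by metis
  have "(\<Union>n. box (a n) (b n)) = U"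
    using range_from_nat_into[OF \<H>(2,1)] \<H>(4) by (simp flip: ab(1))
  with ab(2) show ?thesis by blast
qed

lemma Cc_inf_approx_indicator:
  fixes U :: "(real^'n) set"
  assumes "open U"
  shows "\<exists>\<rho>::nat \<Rightarrow> real^'n \<Rightarrow> real. (\<forall>k. Cc_inf U (\<rho> k)) \<and> (\<forall>k x. 0 \<le> \<rho> k x \<and> \<rho> k x \<le> 1)
     \<and> (\<forall>x. (\<lambda>k. \<rho> k x) \<longlonglongrightarrow> indicator U x)"
proof -
  obtain a b :: "nat \<Rightarrow> real^'n" where ab: "\<And>n. closure (box (a n) (b n)) \<subseteq> U" "(\<Union>n. box (a n) (b n)) = U"
    using open_countable_boxes[OF assms] by blast
  define e where "e k = inverse (real (Suc k))" for k
  have e: "e k > 0" for k by (simp add: e_def)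
  \<comment> \<open>A smooth union of the first \<open>k\<close> boxes: \<open>1 - \<rho> k\<close>
    is the product of the complements \<open>1 - bump\<close>, so \<open>\<rho> k\<close> vanishes
    off these boxes. The index \<open>k\<close> also sharpens the bumps through \<open>e k\<close>.
    The form \<open>1 + (-1) * _\<close> matches the sums and products of
    \<open>smooth_alg\<close>.\<close>
  define \<rho> where "\<rho> k x = 1 + (-1) * (\<Prod>j<k. 1 + (-1) * bump (e k) (a j) (b j) x)" for k x
  have fac: "0 \<le> 1 + (-1) * bump (e k) (a j) (b j) x \<and> 1 + (-1) * bump (e k) (a j) (b j) x \<le> 1" for k j x
    using bump_range[OF e[of k], of "a j" "b j" x] by simp
  have P: "0 \<le> (\<Prod>j<k. 1 + (-1) * bump (e k) (a j) (b j) x)" "(\<Prod>j<k. 1 + (-1) * bump (e k) (a j) (b j) x) \<le> 1" for k x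
    by (intro prod_nonneg prod_le_1 conjunct1[OF fac] fac)+
  have supp: "{x. \<rho> k x \<noteq> 0} \<subseteq> (\<Union>j<k. box (a j) (b j))" for k
  proof
    fix x assume "x \<in> {x. \<rho> k x \<noteq> 0}"
    then have "(\<Prod>j<k. 1 + (-1) * bump (e k) (a j) (b j) x) \<noteq> 1" by (simp add: \<rho>_def)
    then obtain j where "j < k" "bump (e k) (a j) (b j) x \<noteq> 0" using prod.neutral[of "{..<k}" "\<lambda>j. 1 + (-1) * bump (e k) (a j) (b j) x"] by fastforce
    then show "x \<in> (\<Union>j<k. box (a j) (b j))" using bump_nonzero by blast
  qed
  have "Cc_inf U (\<rho> k)" for k
    unfolding Cc_inf_def
  proof (intro conjI)
    have "smooth_alg (\<rho> k)"
      unfolding \<rho>_def by (intro smooth_alg.intros smooth_alg_prod smooth_alg_bump e) auto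
    then show "smooth_fun (\<rho> k)" by (rule smooth_alg_imp_smooth_fun)
    have "bounded (\<Union>j<k. box (a j) (b j))" by (intro bounded_UN) auto
    then have "bounded {x. \<rho> k x \<noteq> 0}" using supp bounded_subset by blast
    then show "compact (closure {x. \<rho> k x \<noteq> 0})" by (simp add: compact_closure)
    have "closure {x. \<rho> k x \<noteq> 0} \<subseteq> (\<Union>j<k. closure (box (a j) (b j)))"
    proof (rule closure_minimal)
      have "(\<Union>j<k. box (a j) (b j)) \<subseteq> (\<Union>j<k. closure (box (a j) (b j)))"
        by (intro UN_mono closure_subset order_refl)
      with supp show "{x. \<rho> k x \<noteq> 0} \<subseteq> (\<Union>j<k. closure (box (a j) (b j)))"
        by (rule order_trans)
    qed (intro closed_UN ballI closed_closure finite_lessThan)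
    also have "\<dots> \<subseteq> U" by (intro UN_least ab(1))
    finally show "closure {x. \<rho> k x \<noteq> 0} \<subseteq> U" .
  qed
  moreover have "0 \<le> \<rho> k x \<and> \<rho> k x \<le> 1" for k x
    using P[of k x] by (simp add: \<rho>_def)
  moreover have "(\<lambda>k. \<rho> k x) \<longlonglongrightarrow> indicator U x" for x
  proof (cases "x \<in> U")
    case False
    then have "x \<notin> (\<Union>n. box (a n) (b n))" by (subst ab(2))
    then have "\<rho> k x = 0" for k using supp[of k] by blast
    then show ?thesis using False by simp
  next
    case True
    then have "x \<in> (\<Union>n. box (a n) (b n))" by (simp only: ab(2))
    then obtain i where i: "x \<in> box (a i) (b i)" by blast
    \<comment> \<open>As soon as \<open>i < k\<close>, the product is at most its factor for the box
      containing \<open>x\<close>, and that factor tends to 0.\<close>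
    have "(\<lambda>k. \<Prod>j<k. 1 + (-1) * bump (e k) (a j) (b j) x) \<longlonglongrightarrow> 0"
    proof (rule Lim_null_comparison)
      show "\<forall>\<^sub>F k in sequentially. norm (\<Prod>j<k. 1 + (-1) * bump (e k) (a j) (b j) x) \<le> 1 + (-1) * bump (e k) (a i) (b i) x"
        using eventually_gt_at_top[of i]
      proof eventually_elim
        case (elim k)
        have "(\<Prod>j<k. 1 + (-1) * bump (e k) (a j) (b j) x)
          = (1 + (-1) * bump (e k) (a i) (b i) x) * (\<Prod>j\<in>{..<k} - {i}. 1 + (-1) * bump (e k) (a j) (b j) x)"
          using elim by (intro prod.remove) auto
        also have "\<dots> \<le> (1 + (-1) * bump (e k) (a i) (b i) x) * 1"
          by (intro mult_left_mono prod_le_1 conjunct1[OF fac] fac)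
        finally show ?case using P(1)[of k x] by simp
      qed
      have "(\<lambda>k. 1 + (-1) * bump (e k) (a i) (b i) x) \<longlonglongrightarrow> 1 + (-1) * 1"
        unfolding e_def by (intro tendsto_intros bump_tendsto_1 i)
      then show "(\<lambda>k. 1 + (-1) * bump (e k) (a i) (b i) x) \<longlonglongrightarrow> 0" by simp
    qed
    then have "(\<lambda>k. \<rho> k x) \<longlonglongrightarrow> 1 + (-1) * 0"
      unfolding \<rho>_def by (intro tendsto_intros)
    then show ?thesis using True by simp
  qed
  ultimately show ?thesis by blast
qed

section \<open>Bounded open sets and the fundamental lemma of the calculus of variations\<close>

lemma L2_iff_sqint: "L2 \<Omega> g \<longleftrightarrow> sqint (lebesgue_on \<Omega>) g"
  by (simp add: L2_def sqint_def)

lemma L2v_iff_sqint: "L2v \<Omega> G \<longleftrightarrow> sqint (lebesgue_on \<Omega>) G"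
  by (simp add: L2v_def sqint_def)

lemma L2norm_eq: "L2norm \<Omega> g = sqnorm (lebesgue_on \<Omega>) g"
  by (simp add: L2norm_def sqnorm_def)

lemma L2vnorm_eq: "L2vnorm \<Omega> G = sqnorm (lebesgue_on \<Omega>) G"
  by (simp add: L2vnorm_def sqnorm_def)

lemma finite_measure_lebesgue_on_bounded:
  fixes \<Omega> :: "'a::euclidean_space set"
  assumes "open \<Omega>" "bounded \<Omega>"
  shows "finite_measure (lebesgue_on \<Omega>)"
  using assms by (intro finite_measure_lebesgue_on) (simp add: lmeasurable_open)

lemma sqnorm_indicator:
  assumes "A \<in> sets M" "finite_measure M"
  shows "sqint M (indicator A :: _ \<Rightarrow> real)" "sqnorm M (indicator A :: _ \<Rightarrow> real) = sqrt (measure M A)"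
proof -
  interpret finite_measure M by fact
  have eq: "(\<lambda>x. (norm (indicator A x :: real))\<^sup>2) = indicator A"
    by (auto simp: indicator_def)
  show "sqint M (indicator A :: _ \<Rightarrow> real)" using assms(1) unfolding sqint_def eq
    by (auto simp: emeasure_eq_measure)
  show "sqnorm M (indicator A :: _ \<Rightarrow> real) = sqrt (measure M A)"
    using assms(1) sets.sets_into_space[OF assms(1)] unfolding sqnorm_def eq by (simp add: Int_absorb2)
qed

text \<open>Orthogonality spreads from test functions to indicators of open subsets by dominated
  convergence, and from these to the indicator of the set where \<open>g\<close> is positive by
  outer regularity. The integral of \<open>g\<close> over that set is then 0, so the set is
  null.\<close>

lemma sqip_Cc_inf_zero_imp_AE_le:
  fixes g :: "real^'n \<Rightarrow> real"
  assumes \<Omega>: "open \<Omega>" "bounded \<Omega>" and g: "sqint (lebesgue_on \<Omega>) g"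
    and ort: "\<And>\<phi>. Cc_inf \<Omega> \<phi> \<Longrightarrow> sqip (lebesgue_on \<Omega>) g \<phi> = 0"
  shows "AE x in lebesgue_on \<Omega>. g x \<le> 0"
proof -
  define M where "M = lebesgue_on \<Omega>"
  have fM: "finite_measure M" unfolding M_def by (rule finite_measure_lebesgue_on_bounded[OF \<Omega>])
  interpret finite_measure M by (rule fM)
  have \<Omega>s: "\<Omega> \<in> sets lebesgue" using \<Omega> by auto
  have gM: "sqint M g" using g by (simp add: M_def)
  have gm [measurable]: "g \<in> borel_measurable M" using gM by (rule sqint_measurable)
  have gint: "integrable M g"
    using integrable_inner_sqint[OF gM sqint_const[OF fM, of 1]] by simp
  have opn: "sqip M g (indicator U) = 0" if U: "open U" "U \<subseteq> \<Omega>" for U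
  proof -
    obtain \<rho> :: "nat \<Rightarrow> real^'n \<Rightarrow> real" where \<rho>: "\<And>k. Cc_inf U (\<rho> k)" "\<And>k x. 0 \<le> \<rho> k x \<and> \<rho> k x \<le> 1"
      "\<And>x. (\<lambda>k. \<rho> k x) \<longlonglongrightarrow> indicator U x"
      using Cc_inf_approx_indicator[OF U(1)] by blast
    have C\<Omega>: "Cc_inf \<Omega> (\<rho> k)" for k using \<rho>(1)[of k] U(2) by (auto simp: Cc_inf_def)
    have [measurable]: "\<rho> k \<in> borel_measurable M" for k
    proof -
      have "\<rho> k differentiable (at x)" for x
        using \<rho>(1)[of k] by (auto simp: Cc_inf_def smooth_fun_def dest: spec[of _ "[]"])
      then have "continuous_on UNIV (\<rho> k)"
        by (simp add: continuous_at_imp_continuous_on differentiable_imp_continuous_within)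
      then have "\<rho> k \<in> borel_measurable borel" by (rule borel_measurable_continuous_onI)
      then show ?thesis unfolding M_def by (intro measurable_restrict_space1 measurable_completion) simp
    qed
    have [measurable]: "U \<in> sets M"
      unfolding M_def using U \<Omega>s by (auto simp: sets_restrict_space_iff)
    have "(\<lambda>k. \<integral>x. g x * \<rho> k x \<partial>M) \<longlonglongrightarrow> (\<integral>x. g x * indicator U x \<partial>M)"
    proof (rule integral_dominated_convergence[where w = "\<lambda>x. norm (g x)"])
      show "integrable M (\<lambda>x. norm (g x))" using gint by (rule integrable_norm)
      show "AE x in M. (\<lambda>k. g x * \<rho> k x) \<longlonglongrightarrow> g x * indicator U x"
        by (intro AE_I2 tendsto_intros \<rho>(3))
      show "AE x in M. norm (g x * \<rho> k x) \<le> norm (g x)" for k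
        using \<rho>(2)[of k] by (auto simp: abs_mult mult_left_le)
    qed measurable
    moreover have "(\<integral>x. g x * \<rho> k x \<partial>M) = 0" for k
      using ort[OF C\<Omega>, of k] by (simp add: sqip_def M_def)
    ultimately show ?thesis by (simp add: sqip_def LIMSEQ_const_iff)
  qed
  define E where "E = {x \<in> space M. 0 < g x}"
  have Es [measurable]: "E \<in> sets M" unfolding E_def by measurable
  have E\<Omega>: "E \<subseteq> \<Omega>" by (auto simp: E_def M_def)
  have El: "E \<in> sets lebesgue"
    using Es \<Omega>s unfolding M_def by (auto simp: sets_restrict_space_iff)
  \<comment> \<open>\<open>E\<close> is enclosed in an open \<open>U\<close> with
    \<open>measure M (U - E) \<le> e\<close>; as the pairing with the indicator of \<open>U\<close>
    vanishes, only the excess \<open>U - E\<close> counts.\<close>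
  have "\<bar>sqip M g (indicator E)\<bar> \<le> sqnorm M g * sqrt e" if e: "e > 0" for e
  proof -
    obtain T where T: "open T" "E \<subseteq> T" "(T - E) \<in> lmeasurable" "emeasure lebesgue (T - E) < ennreal e"
      using sets_lebesgue_outer_open[OF El e] by blast
    define U where "U = T \<inter> \<Omega>"
    have U: "open U" "U \<subseteq> \<Omega>" "E \<subseteq> U" using T \<Omega> E\<Omega> by (auto simp: U_def)
    have Us: "U \<in> sets M"
      unfolding M_def using U \<Omega>s by (auto simp: sets_restrict_space_iff)
    then have UE: "U - E \<in> sets M" by auto
    have "emeasure M (U - E) = emeasure lebesgue (U - E)"
      unfolding M_def using U \<Omega>s by (intro emeasure_restrict_space) auto
    also have "\<dots> \<le> emeasure lebesgue (T - E)"
      using T by (intro emeasure_mono) (auto simp: U_def)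
    finally have "emeasure M (U - E) < ennreal e" using T(4) by simp
    then have me: "measure M (U - E) \<le> e"
      using e by (simp add: emeasure_eq_measure ennreal_less_iff)
    have "sqip M g (indicator U) = sqip M g (\<lambda>x. indicator E x + indicator (U - E) x)"
      unfolding sqip_def using U(3) by (intro Bochner_Integration.integral_cong) (auto simp: indicator_def)
    also have "\<dots> = sqip M g (indicator E) + sqip M g (indicator (U - E))"
      by (intro sqip_add_right sqnorm_indicator Es UE gM fM)
    finally have "\<bar>sqip M g (indicator E)\<bar> = \<bar>sqip M g (indicator (U - E))\<bar>" using opn[OF U(1,2)] by simp
    also have "\<dots> \<le> sqnorm M g * sqnorm M (indicator (U - E) :: _ \<Rightarrow> real)"
      by (intro sqip_Cauchy_Schwarz gM sqnorm_indicator UE fM)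
    also have "\<dots> \<le> sqnorm M g * sqrt e"
      using me unfolding sqnorm_indicator(2)[OF UE fM] by (intro mult_left_mono real_sqrt_le_mono) auto
    finally show ?thesis .
  qed
  note bd = this
  have "\<bar>sqip M g (indicator E)\<bar> \<le> sqnorm M g * sqrt 0"
  proof (rule LIMSEQ_le_const)
    show "(\<lambda>n. sqnorm M g * sqrt (inverse (real (Suc n)))) \<longlonglongrightarrow> sqnorm M g * sqrt 0"
      by (intro tendsto_intros LIMSEQ_inverse_real_of_nat)
    show "\<exists>N. \<forall>n\<ge>N. \<bar>sqip M g (indicator E)\<bar> \<le> sqnorm M g * sqrt (inverse (real (Suc n)))"
      using bd by simp
  qed
  then have 0: "(\<integral>x. g x * indicator E x \<partial>M) = 0" by (simp add: sqip_def)
  have "AE x in M. g x * indicator E x = 0"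
  proof (subst integral_nonneg_eq_0_iff_AE[symmetric])
    show "integrable M (\<lambda>x. g x * indicator E x)"
      using integrable_inner_sqint[OF gM sqnorm_indicator(1)[OF Es fM]] by simp
  qed (use 0 in \<open>auto simp: E_def indicator_def\<close>)
  then show ?thesis unfolding M_def[symmetric]
    by (rule AE_mp) (auto simp: E_def indicator_def intro!: AE_I2)
qed

lemma sqip_Cc_inf_zero_imp_AE:
  fixes g :: "real^'n \<Rightarrow> real"
  assumes \<Omega>: "open \<Omega>" "bounded \<Omega>" and g: "sqint (lebesgue_on \<Omega>) g"
    and ort: "\<And>\<phi>. Cc_inf \<Omega> \<phi> \<Longrightarrow> sqip (lebesgue_on \<Omega>) g \<phi> = 0"
  shows "AE x in lebesgue_on \<Omega>. g x = 0"
proof -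
  have "AE x in lebesgue_on \<Omega>. g x \<le> 0"
    by (rule sqip_Cc_inf_zero_imp_AE_le) fact+
  moreover have "AE x in lebesgue_on \<Omega>. - g x \<le> 0"
    using sqint_scaleR[OF g, of "-1"] ort
    by (intro sqip_Cc_inf_zero_imp_AE_le \<Omega>) (auto simp: sqip_def)
  ultimately show ?thesis by eventually_elim simp
qed

section \<open>The space H10\<close>

lemma sqint_Pair_iff:
  fixes f :: "'a \<Rightarrow> 'b::euclidean_space" and g :: "'a \<Rightarrow> 'c::euclidean_space"
  shows
  "sqint M (\<lambda>x. (f x, g x)) \<longleftrightarrow> sqint M f \<and> sqint M g" (is "?l \<longleftrightarrow> _")
proof safe
  assume l: ?l
  then have m: "(\<lambda>x. (f x, g x)) \<in> borel_measurable M" by (rule sqint_measurable)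
  have "(fst :: 'b \<times> 'c \<Rightarrow> _) \<in> borel_measurable borel" "(snd :: 'b \<times> 'c \<Rightarrow> _) \<in> borel_measurable borel"
    by (intro borel_measurable_continuous_onI continuous_intros)+
  from this[THEN measurable_compose[OF m]]
  have "f \<in> borel_measurable M" "g \<in> borel_measurable M" by simp_all
  then show "sqint M f" "sqint M g"
    by (auto intro!: sqint_bound[OF _ l] simp: norm_Pair real_le_rsqrt)
next
  assume fg: "sqint M f" "sqint M g"
  show ?l
    by (rule sqintI_bound[where h = "\<lambda>x. (norm (f x))\<^sup>2 + (norm (g x))\<^sup>2"])
      (use fg in \<open>auto simp: sqint_def norm_Pair intro: borel_measurable_Pair\<close>)
qed

lemma sqip_Pair:
  assumes "sqint M f" "sqint M g" "sqint M f'" "sqint M g'"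
  shows "sqip M (\<lambda>x. (f x, g x)) (\<lambda>x. (f' x, g' x)) = sqip M f f' + sqip M g g'"
  unfolding sqip_def inner_Pair
  by (intro Bochner_Integration.integral_add integrable_inner_sqint assms)

lemma sqnorm_Pair:
  assumes "sqint M f" "sqint M g"
  shows "(sqnorm M (\<lambda>x. (f x, g x)))\<^sup>2 = (sqnorm M f)\<^sup>2 + (sqnorm M g)\<^sup>2"
  using sqip_Pair[OF assms assms] by (simp add: sqip_self)

lemma sqnorm_le_sqnorm_Pair:
  assumes "sqint M f" "sqint M g"
  shows "sqnorm M f \<le> sqnorm M (\<lambda>x. (f x, g x))" "sqnorm M g \<le> sqnorm M (\<lambda>x. (f x, g x))"
  by (rule power2_le_imp_le; simp add: sqnorm_Pair[OF assms])+

lemma sqnorm_Pair_le: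
  assumes "sqint M f" "sqint M g"
  shows "sqnorm M (\<lambda>x. (f x, g x)) \<le> sqnorm M f + sqnorm M g"
  by (rule power2_le_imp_le) (simp_all add: sqnorm_Pair[OF assms] power2_sum)

section \<open>Linear combinations and square integrability of test functions\<close>

lemma partial_add_scale:
  assumes "f differentiable (at x)" "g differentiable (at x)"
  shows "partial i (\<lambda>x. f x + a * g x) x = partial i f x + a * partial i g x"
  by (subst partial_eqI[OF has_derivative_add[OF has_derivative_frechet[OF assms(1)]
      has_derivative_mult_right[OF has_derivative_frechet[OF assms(2)]]]])
    (simp add: partial_def)

lemma iter_partial_add_scale:
  assumes "smooth_fun f" "smooth_fun g"
  shows "iter_partial is (\<lambda>x. f x + a * g x) = (\<lambda>x. iter_partial is f x + a * iter_partial is g x)"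
proof (induction "is")
  case (Cons i "is")
  then show ?case
    using assms by (auto simp: smooth_fun_def partial_add_scale)
qed simp

lemma smooth_fun_add_scale:
  assumes "smooth_fun f" "smooth_fun g"
  shows "smooth_fun (\<lambda>x. f x + a * g x)"
  using assms unfolding smooth_fun_def iter_partial_add_scale[OF assms]
  by (auto intro!: differentiable_add differentiable_mult)

lemma smooth_fun_differentiable: "smooth_fun f \<Longrightarrow> f differentiable (at x)"
  unfolding smooth_fun_def by (drule spec[of _ "[]"]) simp

lemma smooth_fun_partial_differentiable: "smooth_fun f \<Longrightarrow> partial i f differentiable (at x)"
  unfolding smooth_fun_def by (drule spec[of _ "[i]"]) simp

lemma grad_add_scale:
  assumes "smooth_fun f" "smooth_fun g"
  shows "grad (\<lambda>x. f x + a * g x) = (\<lambda>x. grad f x + a *\<^sub>R grad g x)"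
  using assms by (auto simp: grad_def fun_eq_iff vec_eq_iff smooth_fun_differentiable partial_add_scale)

lemma Cc_inf_add_scale:
  assumes "Cc_inf \<Omega> f" "Cc_inf \<Omega> g"
  shows "Cc_inf \<Omega> (\<lambda>x. f x + a * g x)"
proof -
  have "{x. f x + a * g x \<noteq> 0} \<subseteq> {x. f x \<noteq> 0} \<union> {x. g x \<noteq> 0}" by auto
  then have sub: "closure {x. f x + a * g x \<noteq> 0} \<subseteq> closure {x. f x \<noteq> 0} \<union> closure {x. g x \<noteq> 0}"
    unfolding closure_Un[symmetric] by (rule closure_mono)
  have "compact (closure {x. f x \<noteq> 0} \<union> closure {x. g x \<noteq> 0})"
    using assms by (intro compact_Un) (auto simp: Cc_inf_def)
  from compact_Int_closed[OF this closed_closure, of "{x. f x + a * g x \<noteq> 0}"] sub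
  have "compact (closure {x. f x + a * g x \<noteq> 0})" by (simp only: Int_absorb1)
  then show ?thesis using sub assms by (auto simp: Cc_inf_def smooth_fun_add_scale)
qed

lemma continuous_imp_sqint_lebesgue_on:
  fixes h :: "'a::euclidean_space \<Rightarrow> 'b::euclidean_space"
  assumes \<Omega>: "open \<Omega>" "bounded \<Omega>" and h: "continuous_on UNIV h"
  shows "sqint (lebesgue_on \<Omega>) h"
proof -
  have "compact (h ` closure \<Omega>)"
    using \<Omega>(2) by (intro compact_continuous_image continuous_on_subset[OF h]) (auto simp: compact_closure)
  then have "bounded (h ` closure \<Omega>)" by (rule compact_imp_bounded)
  then obtain B where B: "\<And>x. x \<in> closure \<Omega> \<Longrightarrow> norm (h x) \<le> B" by (auto simp: bounded_iff)
  show ?thesis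
  proof (rule sqintI_bound)
    show "h \<in> borel_measurable (lebesgue_on \<Omega>)"
      using borel_measurable_continuous_onI[OF h] by (intro measurable_restrict_space1 measurable_completion) simp
    show "integrable (lebesgue_on \<Omega>) (\<lambda>x. B\<^sup>2)"
      using finite_measure.integrable_const finite_measure_lebesgue_on_bounded[OF \<Omega>] by blast
    show "(norm (h x))\<^sup>2 \<le> B\<^sup>2" if "x \<in> space (lebesgue_on \<Omega>)" for x
      using B[of x] that closure_subset[of \<Omega>] by (intro power_mono) auto
  qed
qed

lemma Cc_inf_imp_sqint:
  assumes \<Omega>: "open \<Omega>" "bounded \<Omega>" and f: "Cc_inf \<Omega> f"
  shows "sqint (lebesgue_on \<Omega>) f" "sqint (lebesgue_on \<Omega>) (grad f)"
proof -
  have s: "smooth_fun f" using f by (simp add: Cc_inf_def)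
  show "sqint (lebesgue_on \<Omega>) f"
    by (intro continuous_imp_sqint_lebesgue_on \<Omega> continuous_at_imp_continuous_on ballI
        differentiable_imp_continuous_within smooth_fun_differentiable s)
  have "continuous_on UNIV (\<lambda>x. \<chi> i. partial i f x)"
    by (intro continuous_on_vec_lambda continuous_at_imp_continuous_on ballI
        differentiable_imp_continuous_within smooth_fun_partial_differentiable s)
  then show "sqint (lebesgue_on \<Omega>) (grad f)"
    by (intro continuous_imp_sqint_lebesgue_on \<Omega>) (simp add: grad_def[abs_def])
qed

section \<open>The graph of the gradient as a closed subspace\<close>

definition H10_graph :: "(real^'n::finite) set \<Rightarrow> (real^'n \<Rightarrow> real \<times> (real^'n)) set" where
  "H10_graph \<Omega> = {p. H10 \<Omega> (\<lambda>x. fst (p x)) (\<lambda>x. snd (p x))}"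

lemma H10_iff_graph: "H10 \<Omega> u G \<longleftrightarrow> (\<lambda>x. (u x, G x)) \<in> H10_graph \<Omega>"
  by (simp add: H10_graph_def)

text \<open>\<open>H10\<close> asks for one sequence of test functions that converges in two norms.
  The norm of a pair lies between each of the two norms and their sum, which yields the epsilon
  description of a closure in a single space; closedness then follows without diagonal
  sequences.\<close>

lemma H10_graph_iff:
  fixes p :: "real^'n \<Rightarrow> real \<times> (real^'n)"
  assumes \<Omega>: "open \<Omega>" "bounded \<Omega>"
  shows "p \<in> H10_graph \<Omega> \<longleftrightarrow> sqint (lebesgue_on \<Omega>) p \<and> (\<forall>e>0. \<exists>\<phi>. Cc_inf \<Omega> \<phi> \<and>
     sqnorm (lebesgue_on \<Omega>) (\<lambda>x. (\<phi> x, grad \<phi> x) - p x) < e)" (is "?l \<longleftrightarrow> ?r")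
proof -
  define M where "M = lebesgue_on \<Omega>"
  define f where "f x = fst (p x)" for x
  define G where "G x = snd (p x)" for x
  have p: "p = (\<lambda>x. (f x, G x))" by (simp add: f_def G_def)
  have sq: "sqint M \<phi>" "sqint M (grad \<phi>)" if "Cc_inf \<Omega> \<phi>" for \<phi>
    using Cc_inf_imp_sqint[OF \<Omega> that] by (simp_all add: M_def)
  have H: "?l \<longleftrightarrow> sqint M f \<and> sqint M G \<and>
     (\<exists>\<phi>::nat \<Rightarrow> real^'n \<Rightarrow> real. (\<forall>k. Cc_inf \<Omega> (\<phi> k))
        \<and> (\<lambda>k. sqnorm M (\<lambda>x. \<phi> k x - f x)) \<longlonglongrightarrow> 0
        \<and> (\<lambda>k. sqnorm M (\<lambda>x. grad (\<phi> k) x - G x)) \<longlonglongrightarrow> 0)"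
    by (simp add: H10_graph_def H10_def L2_iff_sqint L2v_iff_sqint L2norm_eq L2vnorm_eq M_def f_def[abs_def] G_def[abs_def])
  have R: "?r \<longleftrightarrow> sqint M f \<and> sqint M G \<and> (\<forall>e>0. \<exists>\<phi>. Cc_inf \<Omega> \<phi> \<and>
     sqnorm M (\<lambda>x. (\<phi> x - f x, grad \<phi> x - G x)) < e)"
    by (simp add: p M_def[symmetric] sqint_Pair_iff)
  show ?thesis
    unfolding H R
  proof (intro conj_cong refl iffI)
    assume f: "sqint M f" and G: "sqint M G"
    assume "\<exists>\<phi>::nat \<Rightarrow> real^'n \<Rightarrow> real. (\<forall>k. Cc_inf \<Omega> (\<phi> k))
        \<and> (\<lambda>k. sqnorm M (\<lambda>x. \<phi> k x - f x)) \<longlonglongrightarrow> 0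
        \<and> (\<lambda>k. sqnorm M (\<lambda>x. grad (\<phi> k) x - G x)) \<longlonglongrightarrow> 0"
    then obtain \<phi> :: "nat \<Rightarrow> real^'n \<Rightarrow> real" where \<phi>: "\<And>k. Cc_inf \<Omega> (\<phi> k)"
        "(\<lambda>k. sqnorm M (\<lambda>x. \<phi> k x - f x)) \<longlonglongrightarrow> 0"
        "(\<lambda>k. sqnorm M (\<lambda>x. grad (\<phi> k) x - G x)) \<longlonglongrightarrow> 0" by blast
    show "\<forall>e>0. \<exists>\<phi>. Cc_inf \<Omega> \<phi> \<and> sqnorm M (\<lambda>x. (\<phi> x - f x, grad \<phi> x - G x)) < e"
    proof (intro allI impI)
      fix e :: real assume "e > 0"
      have "(\<lambda>k. sqnorm M (\<lambda>x. \<phi> k x - f x) + sqnorm M (\<lambda>x. grad (\<phi> k) x - G x)) \<longlonglongrightarrow> 0"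
        using tendsto_add[OF \<phi>(2,3)] by simp
      from LIMSEQ_D[OF this \<open>e > 0\<close>] obtain k where
        "sqnorm M (\<lambda>x. \<phi> k x - f x) + sqnorm M (\<lambda>x. grad (\<phi> k) x - G x) < e" by auto
      then have "sqnorm M (\<lambda>x. (\<phi> k x - f x, grad (\<phi> k) x - G x)) < e"
        using sqnorm_Pair_le[OF sqint_diff[OF sq(1)[OF \<phi>(1)] f] sqint_diff[OF sq(2)[OF \<phi>(1)] G], of k k]
        by linarith
      then show "\<exists>\<phi>. Cc_inf \<Omega> \<phi> \<and> sqnorm M (\<lambda>x. (\<phi> x - f x, grad \<phi> x - G x)) < e"
        using \<phi>(1) by blast
    qed
  next
    assume f: "sqint M f" and G: "sqint M G"
    assume r: "\<forall>e>0. \<exists>\<phi>. Cc_inf \<Omega> \<phi> \<and> sqnorm M (\<lambda>x. (\<phi> x - f x, grad \<phi> x - G x)) < e"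
    have "\<exists>\<phi>. Cc_inf \<Omega> \<phi> \<and> sqnorm M (\<lambda>x. (\<phi> x - f x, grad \<phi> x - G x)) < inverse (real (Suc k))" for k
      using r[rule_format, of "inverse (real (Suc k))"] by simp
    then have "\<exists>\<phi>. \<forall>k. Cc_inf \<Omega> (\<phi> k) \<and> sqnorm M (\<lambda>x. (\<phi> k x - f x, grad (\<phi> k) x - G x)) < inverse (real (Suc k))"
      by (intro choice allI)
    then obtain \<phi> where \<phi>: "\<And>k. Cc_inf \<Omega> (\<phi> k)"
      "\<And>k. sqnorm M (\<lambda>x. (\<phi> k x - f x, grad (\<phi> k) x - G x)) < inverse (real (Suc k))" by blast
    have le: "sqnorm M (\<lambda>x. \<phi> k x - f x) \<le> inverse (real (Suc k))"
      "sqnorm M (\<lambda>x. grad (\<phi> k) x - G x) \<le> inverse (real (Suc k))" for k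
      using sqnorm_le_sqnorm_Pair[OF sqint_diff[OF sq(1)[OF \<phi>(1)] f] sqint_diff[OF sq(2)[OF \<phi>(1)] G], of k k]
        \<phi>(2)[of k] by linarith+
    have "(\<lambda>k. sqnorm M (\<lambda>x. \<phi> k x - f x)) \<longlonglongrightarrow> 0" "(\<lambda>k. sqnorm M (\<lambda>x. grad (\<phi> k) x - G x)) \<longlonglongrightarrow> 0"
      by (rule Lim_null_comparison[OF always_eventually LIMSEQ_inverse_real_of_nat], simp add: le del: of_nat_Suc)+
    then show "\<exists>\<phi>::nat \<Rightarrow> real^'n \<Rightarrow> real. (\<forall>k. Cc_inf \<Omega> (\<phi> k))
        \<and> (\<lambda>k. sqnorm M (\<lambda>x. \<phi> k x - f x)) \<longlonglongrightarrow> 0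
        \<and> (\<lambda>k. sqnorm M (\<lambda>x. grad (\<phi> k) x - G x)) \<longlonglongrightarrow> 0" using \<phi>(1) by blast
  qed
qed

lemma Cc_inf_imp_H10:
  assumes \<Omega>: "open \<Omega>" "bounded \<Omega>" and \<phi>: "Cc_inf \<Omega> \<phi>"
  shows "H10 \<Omega> \<phi> (grad \<phi>)"
  unfolding H10_iff_graph H10_graph_iff[OF \<Omega>]
proof (intro conjI allI impI exI[of _ \<phi>] \<phi>)
  show "sqint (lebesgue_on \<Omega>) (\<lambda>x. (\<phi> x, grad \<phi> x))"
    using Cc_inf_imp_sqint[OF \<Omega> \<phi>] by (simp add: sqint_Pair_iff)
qed (simp add: sqnorm_def)

lemma sq_subspace_H10_graph:
  fixes \<Omega> :: "(real^'n) set"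
  assumes \<Omega>: "open \<Omega>" "bounded \<Omega>"
  shows "sq_subspace (lebesgue_on \<Omega>) (H10_graph \<Omega>)"
  unfolding sq_subspace_def
proof (intro conjI ballI allI impI)
  define M where "M = lebesgue_on \<Omega>"
  have gr: "sqint M (\<lambda>x. (\<phi> x, grad \<phi> x))" if "Cc_inf \<Omega> \<phi>" for \<phi>
    using Cc_inf_imp_sqint[OF \<Omega> that] by (simp add: sqint_Pair_iff M_def)
  have "Cc_inf \<Omega> (\<lambda>x. 0)"
    using smooth_alg_imp_smooth_fun[OF smooth_alg.const[of 0]] by (simp add: Cc_inf_def)
  then show "H10_graph \<Omega> \<noteq> {}" using Cc_inf_imp_H10[OF \<Omega>] unfolding H10_iff_graph by blast
  show "sqint (lebesgue_on \<Omega>) f" if "f \<in> H10_graph \<Omega>" for f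
    using that by (simp add: H10_graph_iff[OF \<Omega>])
  show "(\<lambda>x. p x + a *\<^sub>R q x) \<in> H10_graph \<Omega>" if pq: "p \<in> H10_graph \<Omega>" "q \<in> H10_graph \<Omega>" for p q a
    unfolding H10_graph_iff[OF \<Omega>] M_def[symmetric]
  proof (intro conjI allI impI)
    have p: "sqint M p" and q: "sqint M q" using pq by (simp_all add: H10_graph_iff[OF \<Omega>] M_def)
    then show "sqint M (\<lambda>x. p x + a *\<^sub>R q x)" by (intro sqint_add sqint_scaleR)
    fix e :: real assume e: "e > 0"
    \<comment> \<open>Two errors below \<open>d\<close> combine to at most
      \<open>(1 + \<bar>a\<bar>) * d\<close>; the denominator \<open>2 + \<bar>a\<bar>\<close> makes
      this strictly less than \<open>e\<close>.\<close>
    define d where "d = e / (2 + \<bar>a\<bar>)"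
    have d: "d > 0" "(1 + \<bar>a\<bar>) * d < e" using e by (auto simp: d_def divide_simps algebra_simps)
    obtain \<phi> \<psi> where \<phi>: "Cc_inf \<Omega> \<phi>" "sqnorm M (\<lambda>x. (\<phi> x, grad \<phi> x) - p x) < d"
      and \<psi>: "Cc_inf \<Omega> \<psi>" "sqnorm M (\<lambda>x. (\<psi> x, grad \<psi> x) - q x) < d"
      using pq d(1) unfolding H10_graph_iff[OF \<Omega>] M_def by blast
    define \<theta> where "\<theta> x = \<phi> x + a * \<psi> x" for x
    have \<theta>: "Cc_inf \<Omega> \<theta>" unfolding \<theta>_def by (rule Cc_inf_add_scale) fact+
    have "grad \<theta> = (\<lambda>x. grad \<phi> x + a *\<^sub>R grad \<psi> x)"
      unfolding \<theta>_def using \<phi>(1) \<psi>(1) by (intro grad_add_scale) (auto simp: Cc_inf_def)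
    then have "sqnorm M (\<lambda>x. (\<theta> x, grad \<theta> x) - (p x + a *\<^sub>R q x))
      = sqnorm M (\<lambda>x. ((\<phi> x, grad \<phi> x) - p x) + a *\<^sub>R ((\<psi> x, grad \<psi> x) - q x))"
      by (intro arg_cong[where f = "sqnorm M"] ext) (simp add: \<theta>_def prod_eq_iff algebra_simps)
    also have "\<dots> \<le> sqnorm M (\<lambda>x. (\<phi> x, grad \<phi> x) - p x) + sqnorm M (\<lambda>x. a *\<^sub>R ((\<psi> x, grad \<psi> x) - q x))"
      by (intro sqnorm_triangle sqint_scaleR sqint_diff gr \<phi> \<psi> p q)
    also have "\<dots> \<le> d + \<bar>a\<bar> * d"
      unfolding sqnorm_scaleR using \<phi>(2) \<psi>(2) by (intro add_mono mult_left_mono) auto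
    also have "\<dots> < e" using d(2) by (simp add: algebra_simps)
    finally show "\<exists>\<phi>. Cc_inf \<Omega> \<phi> \<and> sqnorm M (\<lambda>x. (\<phi> x, grad \<phi> x) - (p x + a *\<^sub>R q x)) < e"
      using \<theta> by blast
  qed
  show "g \<in> H10_graph \<Omega>" if f: "\<forall>n. f n \<in> H10_graph \<Omega>" and g: "sqint (lebesgue_on \<Omega>) g"
    and lim: "(\<lambda>n. sqnorm (lebesgue_on \<Omega>) (\<lambda>x. f n x - g x)) \<longlonglongrightarrow> 0"
    for f :: "nat \<Rightarrow> real^'n \<Rightarrow> real \<times> (real^'n)" and g
    unfolding H10_graph_iff[OF \<Omega>]
  proof (intro conjI allI impI g)
    fix e :: real assume e: "e > 0"
    obtain n where n: "sqnorm M (\<lambda>x. f n x - g x) < e / 2"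
      using LIMSEQ_D[OF lim, of "e/2"] e unfolding M_def by auto
    have fn: "sqint M (f n)" using f by (simp add: H10_graph_iff[OF \<Omega>] M_def)
    obtain \<phi> where \<phi>: "Cc_inf \<Omega> \<phi>" "sqnorm M (\<lambda>x. (\<phi> x, grad \<phi> x) - f n x) < e / 2"
      using f e unfolding H10_graph_iff[OF \<Omega>] M_def by (meson half_gt_zero)
    have "sqnorm M (\<lambda>x. (\<phi> x, grad \<phi> x) - g x) < e"
      using sqnorm_triangle_diff[OF gr[OF \<phi>(1)] fn g[folded M_def]] n \<phi>(2) by linarith
    then show "\<exists>\<phi>. Cc_inf \<Omega> \<phi> \<and> sqnorm (lebesgue_on \<Omega>) (\<lambda>x. (\<phi> x, grad \<phi> x) - g x) < e"
      using \<phi>(1) unfolding M_def by blast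
  qed
qed

lemma H10_diff:
  assumes \<Omega>: "open \<Omega>" "bounded \<Omega>" and "H10 \<Omega> u G" "H10 \<Omega> u' G'"
  shows "H10 \<Omega> (\<lambda>x. u x - u' x) (\<lambda>x. G x - G' x)"
proof -
  have "(\<lambda>x. (u x, G x) + (-1) *\<^sub>R (u' x, G' x)) \<in> H10_graph \<Omega>"
    by (rule sq_subspace_lin[OF sq_subspace_H10_graph[OF \<Omega>] assms(3,4)[unfolded H10_iff_graph]])
  then show ?thesis unfolding H10_iff_graph by simp
qed

text \<open>By definition of \<open>Hdiv\<close>, its elements \<open>(div \<psi>, \<psi>)\<close> are exactly the orthogonal complement of the
  graph of the gradient on \<open>Cc_inf\<close>, whose closure is \<open>H10\<close>; so this is the double orthogonal theorem.\<close>

lemma orthogonal_Hdiv_imp_H10: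
  fixes \<Omega> :: "(real^'n) set"
  assumes \<Omega>: "open \<Omega>" "bounded \<Omega>" and f: "sqint (lebesgue_on \<Omega>) f" and G: "sqint (lebesgue_on \<Omega>) G"
    and ort: "\<And>\<psi> d. Hdiv \<Omega> \<psi> d \<Longrightarrow> sqip (lebesgue_on \<Omega>) f d + sqip (lebesgue_on \<Omega>) G \<psi> = 0"
  shows "H10 \<Omega> f G"
proof -
  define M where "M = lebesgue_on \<Omega>"
  have fM: "finite_measure M" unfolding M_def by (rule finite_measure_lebesgue_on_bounded[OF \<Omega>])
  have V: "sq_subspace M (H10_graph \<Omega>)" unfolding M_def by (rule sq_subspace_H10_graph[OF \<Omega>])
  have sp: "sqint M (\<lambda>x. (f x, G x))" using f G by (simp add: sqint_Pair_iff M_def)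
  obtain p where p: "p \<in> H10_graph \<Omega>" "\<And>v. v \<in> H10_graph \<Omega> \<Longrightarrow> sqip M (\<lambda>x. (f x, G x) - p x) v = 0"
    using sq_projection[OF fM V sp] by blast
  have ps: "sqint M p" using p(1) V by (auto simp: sq_subspace_def)
  \<comment> \<open>\<open>(d, \<psi>)\<close> is the residual of projecting \<open>(f, G)\<close>.
    Being orthogonal to every \<open>(\<phi>, grad \<phi>)\<close>, it consists of a field
    \<open>\<psi>\<close> and its divergence \<open>d\<close>.\<close>
  define d where "d x = f x - fst (p x)" for x
  define \<psi> where "\<psi> x = G x - snd (p x)" for x
  have eq: "(\<lambda>x. (f x, G x) - p x) = (\<lambda>x. (d x, \<psi> x))"
    by (simp add: fun_eq_iff d_def \<psi>_def prod_eq_iff)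
  have sd: "sqint M d" "sqint M \<psi>"
    using sqint_diff[OF sp ps] unfolding eq by (simp_all add: sqint_Pair_iff)
  have "Hdiv \<Omega> \<psi> d"
    unfolding Hdiv_def L2_iff_sqint L2v_iff_sqint M_def[symmetric]
  proof (intro conjI allI impI sd)
    fix \<phi> assume \<phi>: "Cc_inf \<Omega> \<phi>"
    have "sqip M (\<lambda>x. (d x, \<psi> x)) (\<lambda>x. (\<phi> x, grad \<phi> x)) = 0"
      using p(2) Cc_inf_imp_H10[OF \<Omega> \<phi>] unfolding H10_iff_graph eq by blast
    then show "(\<integral>x. \<psi> x \<bullet> grad \<phi> x + d x * \<phi> x \<partial>M) = 0"
      by (simp add: sqip_def add.commute)
  qed
  then have "sqip M (\<lambda>x. (f x, G x)) (\<lambda>x. (d x, \<psi> x)) = 0"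
    using ort[of \<psi> d] f G sd by (subst sqip_Pair) (auto simp: M_def)
  moreover have "sqip M p (\<lambda>x. (d x, \<psi> x)) = 0"
    using p(2)[OF p(1)] unfolding eq by (simp add: sqip_commute)
  \<comment> \<open>The residual is orthogonal to \<open>(f, G)\<close> by hypothesis and to
    \<open>p\<close> by projection, hence to itself.\<close>
  ultimately have "sqip M (\<lambda>x. (f x, G x) - p x) (\<lambda>x. (d x, \<psi> x)) = 0"
    using sd by (subst sqip_diff_left[OF sp ps]) (auto simp: sqint_Pair_iff)
  then have "sqnorm M (\<lambda>x. (f x, G x) - p x) = 0" unfolding eq sqip_self by simp
  \<comment> \<open>Distance 0 from \<open>p\<close> is not yet membership: the constant sequence
    \<open>p\<close> converges to \<open>(f, G)\<close>, and closedness concludes.\<close>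
  then have "(\<lambda>n::nat. sqnorm M (\<lambda>x. p x - (f x, G x))) \<longlonglongrightarrow> 0"
    by (subst sqnorm_minus_commute) simp
  then have "(\<lambda>x. (f x, G x)) \<in> H10_graph \<Omega>"
    by (rule sq_subspace_closed[OF V p(1) sp])
  then show ?thesis unfolding H10_iff_graph .
qed

section \<open>Symmetric matrices and gradient discretisations\<close>

lemma symmetric_matrix_inner:
  fixes A :: "real^'n^'n"
  assumes "transpose A = A"
  shows "(A *v x) \<bullet> y = x \<bullet> (A *v y)"
  using dot_lmul_matrix[of x A y] assms by (simp add: transpose_matrix_vector flip: vector_transpose_matrix)

lemma symmetric_matrix_quadratic:
  fixes A :: "real^'n^'n"
  assumes "transpose A = A"
  shows "(A *v (x + t *\<^sub>R y)) \<bullet> (x + t *\<^sub>R y)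
    = (A *v x) \<bullet> x + 2 * t * ((A *v x) \<bullet> y) + t\<^sup>2 * ((A *v y) \<bullet> y)"
  using symmetric_matrix_inner[OF assms, of y x]
  by (simp add: matrix_vector_right_distrib matrix_vector_mult_scaleR inner_add_left inner_add_right
      power2_eq_square inner_commute algebra_simps)

text \<open>A minimiser of the Rayleigh quotient is an eigenvector.\<close>

lemma symmetric_matrix_min_eigenvalue:
  fixes A :: "real^'n^'n"
  assumes A: "transpose A = A"
  shows "\<exists>c v. v \<noteq> 0 \<and> A *v v = c *\<^sub>R v \<and> (\<forall>x. c * (norm x)\<^sup>2 \<le> (A *v x) \<bullet> x)"
proof -
  have "continuous_on (sphere 0 1) (\<lambda>x. (A *v x) \<bullet> x)"
    by (intro continuous_intros matrix_vector_mult_linear_continuous_on)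
  moreover have "sphere 0 1 \<noteq> ({} :: (real^'n) set)" by simp
  ultimately obtain v where v: "v \<in> sphere 0 1" "\<And>x. x \<in> sphere 0 1 \<Longrightarrow> (A *v v) \<bullet> v \<le> (A *v x) \<bullet> x"
    using continuous_attains_inf[OF compact_sphere] by meson
  define c where "c = (A *v v) \<bullet> v"
  have nv: "norm v = 1" using v(1) by simp
  have ge: "c * (norm x)\<^sup>2 \<le> (A *v x) \<bullet> x" for x
  proof (cases "x = 0")
    case False
    have "c \<le> (A *v (inverse (norm x) *\<^sub>R x)) \<bullet> (inverse (norm x) *\<^sub>R x)"
      unfolding c_def using False by (intro v(2)) simp
    also have "\<dots> = ((A *v x) \<bullet> x) / (norm x)\<^sup>2"
      by (simp add: matrix_vector_mult_scaleR power2_eq_square divide_inverse)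
    finally show ?thesis using False by (simp add: field_simps)
  qed simp
  \<comment> \<open>The form of \<open>A\<close> minus \<open>c\<close> times the squared norm is
    nonnegative and vanishes at \<open>v\<close>. In the direction \<open>y\<close> its linear
    coefficient at \<open>v\<close> is the squared norm of \<open>y\<close>, so nonnegativity forces
    \<open>y = 0\<close>.\<close>
  define y where "y = A *v v - c *\<^sub>R v"
  have "((A *v v - c *\<^sub>R v) \<bullet> y)\<^sup>2 \<le> 0 * ((A *v y) \<bullet> y - c * (norm y)\<^sup>2)"
  proof (rule quadratic_nonneg_imp_le)
    fix t
    have n: "(norm (v + t *\<^sub>R y))\<^sup>2 = 1 + 2 * t * (v \<bullet> y) + t\<^sup>2 * (norm y)\<^sup>2"
      unfolding power2_norm_eq_inner using nv
      by (simp add: inner_add_left inner_add_right inner_commute power2_eq_square algebra_simps norm_eq_1)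
    have "0 \<le> (A *v (v + t *\<^sub>R y)) \<bullet> (v + t *\<^sub>R y) - c * (norm (v + t *\<^sub>R y))\<^sup>2"
      using ge by simp
    then show "0 \<le> 0 + 2 * t * ((A *v v - c *\<^sub>R v) \<bullet> y) + t\<^sup>2 * ((A *v y) \<bullet> y - c * (norm y)\<^sup>2)"
      unfolding symmetric_matrix_quadratic[OF A] n c_def[symmetric]
      by (simp add: inner_diff_left algebra_simps)
  qed (use ge in simp)
  then have "y = 0" by (simp add: y_def)
  then show ?thesis using nv ge by (intro exI[of _ c] exI[of _ v]) (auto simp: y_def)
qed

text \<open>The lower bound is the smallest eigenvalue, and the upper bound of the form comes from
  the smallest eigenvalue of \<open>- A\<close>. The form is thus an inner product, and its
  Cauchy-Schwarz inequality for \<open>x\<close> and \<open>A *v x\<close> bounds the norm of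
  \<open>A *v x\<close>.\<close>

lemma symmetric_matrix_bounds:
  fixes A :: "real^'n^'n"
  assumes A: "transpose A = A" and ev: "\<And>c x. x \<noteq> 0 \<Longrightarrow> A *v x = c *\<^sub>R x \<Longrightarrow> lo \<le> c \<and> c \<le> hi"
    and lo: "0 < lo"
  shows "lo * (norm x)\<^sup>2 \<le> (A *v x) \<bullet> x" "norm (A *v x) \<le> hi * norm x"
proof -
  have l: "lo * (norm x)\<^sup>2 \<le> (A *v x) \<bullet> x" for x
  proof -
    obtain c v where "v \<noteq> 0" "A *v v = c *\<^sub>R v" "c * (norm x)\<^sup>2 \<le> (A *v x) \<bullet> x"
      using symmetric_matrix_min_eigenvalue[OF A] by blast
    moreover from this ev have "lo \<le> c" by blast
    ultimately show ?thesis by (meson mult_right_mono order_trans zero_le_power2)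
  qed
  then show "lo * (norm x)\<^sup>2 \<le> (A *v x) \<bullet> x" .
  have mA: "(- A) *v y = - (A *v y)" for y
    using matrix_vector_mult_diff_rdistrib[of 0 A y] by simp
  have h: "(A *v x) \<bullet> x \<le> hi * (norm x)\<^sup>2" for x
  proof -
    have "transpose (- A) = - A" using A by (simp add: transpose_def vec_eq_iff)
    then obtain c v where v: "v \<noteq> 0" "(- A) *v v = c *\<^sub>R v" "c * (norm x)\<^sup>2 \<le> ((- A) *v x) \<bullet> x"
      using symmetric_matrix_min_eigenvalue by blast
    from v(2) have "A *v v = (- c) *\<^sub>R v" unfolding mA by (simp add: equation_minus_iff[of "A *v v"] eq_commute)
    with v(1) ev have "- c \<le> hi" by blast
    then have "(- c) * (norm x)\<^sup>2 \<le> hi * (norm x)\<^sup>2" by (intro mult_right_mono) auto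
    with v(3) show ?thesis unfolding mA by simp
  qed
  define y where "y = A *v x"
  have pos: "0 \<le> (A *v z) \<bullet> z" for z using l[of z] lo by (smt (verit) mult_nonneg_nonneg zero_le_power2)
  \<comment> \<open>The left side is the fourth power of \<open>norm y\<close>, while both factors
    on the right are at most \<open>hi\<close> times a squared norm, so one factor
    \<open>(norm y)\<^sup>2\<close> can be cancelled.\<close>
  have "((A *v x) \<bullet> y)\<^sup>2 \<le> ((A *v x) \<bullet> x) * ((A *v y) \<bullet> y)"
    by (rule quadratic_nonneg_imp_le) (simp_all add: pos flip: symmetric_matrix_quadratic[OF A])
  also have "\<dots> \<le> (hi * (norm x)\<^sup>2) * (hi * (norm y)\<^sup>2)"
    by (intro mult_mono h pos order_trans[OF pos h])
  finally have le: "((norm y)\<^sup>2)\<^sup>2 \<le> (hi * norm x)\<^sup>2 * (norm y)\<^sup>2"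
    unfolding y_def[symmetric] power2_norm_eq_inner[of y, symmetric]
    by (simp add: power2_eq_square algebra_simps)
  have hi: "0 \<le> hi"
  proof -
    obtain c v where "v \<noteq> 0" "A *v v = c *\<^sub>R v" using symmetric_matrix_min_eigenvalue[OF A] by blast
    with ev[of v c] lo show ?thesis by auto
  qed
  have "(norm y)\<^sup>2 \<le> (hi * norm x)\<^sup>2"
  proof (cases "y = 0")
    case False
    have "(norm y)\<^sup>2 * (norm y)\<^sup>2 \<le> (hi * norm x)\<^sup>2 * (norm y)\<^sup>2"
      using le by (simp only: power2_eq_square[of "(norm y)\<^sup>2"])
    then show ?thesis by (rule mult_right_le_imp_le) (use False in simp)
  qed simp
  then show "norm (A *v x) \<le> hi * norm x"
    unfolding y_def using hi by (rule power2_le_imp_le[OF _ mult_nonneg_nonneg[OF _ norm_ge_zero]])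
qed

section \<open>Piecewise constant reconstructions and finite-dimensional estimates\<close>

text \<open>The cells partition \<open>\<Omega>\<close>, so evaluating at \<open>x\<close> reads off
  the unknown of the one cell containing \<open>x\<close>, the same for all \<open>v\<close>. This
  is what lets the reconstruction commute with nonlinear functions.\<close>

lemma gd_Pi_value:
  assumes "is_pc_GD \<Omega> D" "x \<in> \<Omega>"
  shows "\<exists>i\<in>gd_I D. \<forall>v. gd_Pi D v x = v i"
proof -
  have fin: "finite (gd_I D)" and dis: "\<And>i j. i \<in> gd_I D \<Longrightarrow> j \<in> gd_I D \<Longrightarrow> i \<noteq> j \<Longrightarrow> gd_U D i \<inter> gd_U D j = {}"
    and un: "(\<Union>i\<in>gd_I D. gd_U D i) = \<Omega>"
    using assms(1) by (auto simp: is_pc_GD_def)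
  obtain i where i: "i \<in> gd_I D" "x \<in> gd_U D i" using un assms(2) by blast
  have "gd_Pi D v x = v i" for v
  proof -
    have "gd_Pi D v x = (\<Sum>j\<in>gd_I D. if j = i then v i else 0)"
      unfolding gd_Pi_def using dis i by (intro sum.cong) (auto simp: indicator_def)
    then show ?thesis using fin i by simp
  qed
  with i show ?thesis by blast
qed

lemma gd_Pi_comp:
  assumes "is_pc_GD \<Omega> D" "x \<in> \<Omega>"
  shows "gd_Pi D (\<lambda>i. g (v i)) x = g (gd_Pi D v x)"
proof -
  obtain i where "\<And>v. gd_Pi D v x = v i" using gd_Pi_value[OF assms] by blast
  then show ?thesis by simp
qed

lemma sqint_gd_Pi:
  assumes "finite_measure (lebesgue_on \<Omega>)" "\<Omega> \<in> sets lebesgue" "is_pc_GD \<Omega> D"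
  shows "sqint (lebesgue_on \<Omega>) (gd_Pi D v)"
proof -
  have "sqint (lebesgue_on \<Omega>) (\<lambda>x. \<Sum>i\<in>gd_I D. v i *\<^sub>R (indicator (gd_U D i) x :: real))"
    using assms by (intro sqint_sum sqint_scaleR sqnorm_indicator)
      (auto simp: is_pc_GD_def sets_restrict_space_iff)
  then show ?thesis by (simp add: gd_Pi_def[abs_def])
qed

lemma sqint_gd_grad: "is_pc_GD \<Omega> D \<Longrightarrow> v \<in> gd_X D \<Longrightarrow> sqint (lebesgue_on \<Omega>) (gd_grad D v)"
  by (auto simp: is_pc_GD_def L2v_iff_sqint)

lemma gd_grad_lin:
  assumes "is_pc_GD \<Omega> D" "v \<in> gd_X D" "w \<in> gd_X D"
  shows "gd_grad D (\<lambda>i. a * v i + b * w i) = (\<lambda>x. a *\<^sub>R gd_grad D v x + b *\<^sub>R gd_grad D w x)"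
  using assms by (auto simp: is_pc_GD_def)

lemma gd_grad_0:
  assumes "is_pc_GD \<Omega> D"
  shows "gd_grad D (\<lambda>i. 0) = (\<lambda>x. 0)"
proof -
  have "(\<lambda>i. 0) \<in> gd_X D" by (simp add: gd_X_def)
  from gd_grad_lin[OF assms this this, of 0 0] show ?thesis by simp
qed

text \<open>Linearity is available for combinations of two vectors; induction over the free unknowns
  yields the expansion in unit vectors, which makes the squared gradient norm a polynomial in the
  coordinates.\<close>

lemma gd_grad_expand:
  assumes D: "is_pc_GD \<Omega> D" and v: "v \<in> gd_X D"
  shows "gd_grad D v = (\<lambda>x. \<Sum>i\<in>gd_I D - gd_Ibd D. v i *\<^sub>R gd_grad D (\<lambda>j. of_bool (j = i)) x)"
proof -
  define J where "J = gd_I D - gd_Ibd D"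
  have fin: "finite J" using D by (auto simp: is_pc_GD_def J_def)
  have "gd_grad D (\<lambda>j. if j \<in> K then v j else 0) = (\<lambda>x. \<Sum>i\<in>K. v i *\<^sub>R gd_grad D (\<lambda>j. of_bool (j = i)) x)"
    if "finite K" "K \<subseteq> J" for K
    using that
  proof (induction K rule: finite_induct)
    case empty
    then show ?case using gd_grad_0[OF D] by simp
  next
    case (insert k K)
    have X: "(\<lambda>j. of_bool (j = k)) \<in> gd_X D" "(\<lambda>j. if j \<in> K then v j else 0) \<in> gd_X D"
      using insert by (auto simp: gd_X_def J_def)
    have "(\<lambda>j. if j \<in> insert k K then v j else 0) = (\<lambda>j. v k * of_bool (j = k) + 1 * (if j \<in> K then v j else 0))"
      using insert by auto
    then show ?case using insert by (simp only: gd_grad_lin[OF D X]) simp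
  qed
  from this[OF fin] have "gd_grad D (\<lambda>j. if j \<in> J then v j else 0) = (\<lambda>x. \<Sum>i\<in>J. v i *\<^sub>R gd_grad D (\<lambda>j. of_bool (j = i)) x)"
    by simp
  moreover have "(\<lambda>j. if j \<in> J then v j else 0) = v" using v by (auto simp: gd_X_def J_def)
  ultimately show ?thesis by (simp add: J_def)
qed

lemma sqip_sum_left:
  assumes "\<And>i. i \<in> I \<Longrightarrow> sqint M (f i)" "sqint M g"
  shows "sqip M (\<lambda>x. \<Sum>i\<in>I. f i x) g = (\<Sum>i\<in>I. sqip M (f i) g)"
  using assms(1)
proof (induction I rule: infinite_finite_induct)
  case (insert i I)
  then show ?case using assms(2) by (simp add: sqip_add_left sqint_sum)
qed (simp_all add: sqip_def)

text \<open>Vectors of unknowns are functions on all of \<open>nat\<close> with the product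
  topology. The sphere is a closed subset of the cube with sides \<open>{-1..1}\<close>, which is
  compact by Tychonoff's theorem.\<close>

lemma gd_unit_sphere_compact:
  assumes "finite J"
  shows "compact {v::nat \<Rightarrow> real. (\<forall>i. i \<notin> J \<longrightarrow> v i = 0) \<and> (\<Sum>i\<in>J. (v i)\<^sup>2) = 1}" (is "compact ?S")
proof -
  have "compactin (product_topology (\<lambda>i::nat. euclidean) UNIV) (PiE UNIV (\<lambda>i. {-1..1::real}))"
    by (subst compactin_PiE) auto
  then have "compact (PiE UNIV (\<lambda>i::nat. {-1..1::real}))"
    by (simp flip: compactin_euclidean_iff euclidean_product_topology)
  moreover have clS: "closed ?S"
  proof -
    have eq: "?S = (\<Inter>i\<in>-J. {v. v i = 0}) \<inter> {v. (\<Sum>i\<in>J. (v i)\<^sup>2) = 1}" by auto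
    show ?thesis unfolding eq
      by (intro closed_Int closed_INT ballI closed_Collect_eq continuous_intros
          continuous_on_product_coordinates)
  qed
  moreover have "?S \<subseteq> PiE UNIV (\<lambda>i::nat. {-1..1::real})"
  proof
    fix v assume v: "v \<in> ?S"
    have "\<bar>v i\<bar> \<le> 1" for i
    proof (cases "i \<in> J")
      case True
      have "(v i)\<^sup>2 \<le> (\<Sum>i\<in>J. (v i)\<^sup>2)" by (rule member_le_sum) (use True assms in auto)
      then show ?thesis using v by (simp add: abs_square_le_1)
    qed (use v in auto)
    then show "v \<in> PiE UNIV (\<lambda>i::nat. {-1..1::real})" by (auto simp: abs_le_iff minus_le_iff)
  qed
  ultimately show ?thesis
    using compact_Int_closed[OF _ clS, of "PiE UNIV (\<lambda>i::nat. {-1..1::real})"] by (simp only: Int_absorb1)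
qed

text \<open>A continuous positive function on the compact unit sphere has a positive minimum. The
  constant depends on \<open>D\<close> and only serves to show that the suprema in
  \<open>gd_C\<close> and \<open>gd_W\<close> are taken over bounded sets; estimates uniform in the
  discretisation come from those suprema.\<close>

lemma gd_norm_equivalence:
  assumes M: "finite_measure (lebesgue_on \<Omega>)" "\<Omega> \<in> sets lebesgue" and D: "is_pc_GD \<Omega> D"
  shows "\<exists>C. \<forall>v\<in>gd_X D. sqnorm (lebesgue_on \<Omega>) (gd_Pi D v) \<le> C * sqnorm (lebesgue_on \<Omega>) (gd_grad D v)"
proof -
  define M where "M = lebesgue_on \<Omega>"
  interpret finite_measure M using assms(1) by (simp add: M_def)
  define J where "J = gd_I D - gd_Ibd D"
  have fin: "finite J" using D by (auto simp: is_pc_GD_def J_def)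
  have X: "v \<in> gd_X D \<longleftrightarrow> (\<forall>i. i \<notin> J \<longrightarrow> v i = 0)" for v by (auto simp: gd_X_def J_def)
  define S where "S = {v::nat \<Rightarrow> real. (\<forall>i. i \<notin> J \<longrightarrow> v i = 0) \<and> (\<Sum>i\<in>J. (v i)\<^sup>2) = 1}"
  have cS: "compact S" unfolding S_def by (rule gd_unit_sphere_compact[OF fin])
  have SX: "v \<in> gd_X D" if "v \<in> S" for v using that by (auto simp: S_def X)
  define b where "b i = gd_grad D (\<lambda>j. of_bool (j = i))" for i
  have sb: "sqint M (b i)" if "i \<in> J" for i
    unfolding M_def b_def using that by (intro sqint_gd_grad[OF D]) (auto simp: X)
  have exp: "gd_grad D v = (\<lambda>x. \<Sum>i\<in>J. v i *\<^sub>R b i x)" if "v \<in> gd_X D" for v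
    using gd_grad_expand[OF D that] by (simp add: J_def b_def)
  \<comment> \<open>The Gram form of the basis gradients: it equals the squared gradient norm on
    \<open>gd_X D\<close> and is visibly continuous in the coordinates.\<close>
  define N where "N v = (\<Sum>i\<in>J. \<Sum>j\<in>J. v i * (v j * sqip M (b i) (b j)))" for v
  have N: "(sqnorm M (gd_grad D v))\<^sup>2 = N v" if "v \<in> gd_X D" for v
  proof -
    have s: "sqint M (\<lambda>x. \<Sum>i\<in>J. v i *\<^sub>R b i x)" by (intro sqint_sum sqint_scaleR sb)
    have "sqip M (b i) (\<lambda>x. \<Sum>j\<in>J. v j *\<^sub>R b j x) = (\<Sum>j\<in>J. v j * sqip M (b i) (b j))" if "i \<in> J" for i
      using that unfolding sqip_commute[of M "b i"]
      by (subst sqip_sum_left) (auto intro: sqint_scaleR sb simp: sqip_scaleR_left)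
    then show ?thesis
      unfolding sqip_self[symmetric] exp[OF that] N_def
      by (subst sqip_sum_left) (auto intro: sqint_scaleR sb s simp: sqip_scaleR_left sum_distrib_left)
  qed
  have "\<exists>c>0. \<forall>v\<in>S. c \<le> N v"
  \<comment> \<open>\<open>S\<close> is empty exactly when there is no free unknown, and then every
    positive \<open>c\<close> will do.\<close>
  proof (cases "S = {}")
    case False
    have "continuous_on S N" unfolding N_def
      by (intro continuous_intros continuous_on_subset[OF continuous_on_product_coordinates]) auto
    then obtain w where w: "w \<in> S" "\<And>v. v \<in> S \<Longrightarrow> N w \<le> N v"
      using continuous_attains_inf[OF cS False] by meson
    have "N w \<noteq> 0"
    proof
      assume "N w = 0"
      then have "sqnorm M (gd_grad D w) = 0" using N[OF SX[OF w(1)]] by simp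
      then have "w = (\<lambda>i. 0)"
        using D SX[OF w(1)] by (auto simp: is_pc_GD_def L2vnorm_eq M_def)
      then show False using w(1) by (simp add: S_def)
    qed
    then have "N w > 0" using N[OF SX[OF w(1)]] zero_le_power2[of "sqnorm M (gd_grad D w)"] by linarith
    then show ?thesis using w(2) by blast
  qed (auto intro: exI[of _ 1])
  then obtain c where c: "c > 0" "\<And>v. v \<in> S \<Longrightarrow> c \<le> N v" by blast
  \<comment> \<open>The reconstruction is pointwise at most the Euclidean norm \<open>s\<close> of
    the unknowns, so its squared norm is at most \<open>measure M (space M) * s\<^sup>2\<close>, and
    homogeneity gives \<open>s\<^sup>2 * c \<le> N v\<close>.\<close>
  define K where "K = measure M (space M) / c"
  have "sqnorm M (gd_Pi D v) \<le> sqrt K * sqnorm M (gd_grad D v)" if v: "v \<in> gd_X D" for v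
  proof -
    define s where "s = sqrt (\<Sum>i\<in>J. (v i)\<^sup>2)"
    have s2: "s\<^sup>2 = (\<Sum>i\<in>J. (v i)\<^sup>2)" by (simp add: s_def sum_nonneg)
    have le: "(v i)\<^sup>2 \<le> s\<^sup>2" for i
    proof (cases "i \<in> J")
      case True
      then show ?thesis unfolding s2 by (intro member_le_sum) (use fin in auto)
    qed (use v in \<open>auto simp: X\<close>)
    have "s\<^sup>2 * c \<le> N v"
    proof (cases "s = 0")
      case True
      then show ?thesis using N[OF v] zero_le_power2[of "sqnorm M (gd_grad D v)"] by simp
    next
      case False
      have "(\<lambda>i. v i / s) \<in> S" using v False unfolding S_def X
        by (auto simp: power_divide sum_divide_distrib[symmetric] s2[symmetric])
      then have "c \<le> N (\<lambda>i. v i / s)" by (rule c(2))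
      also have "N (\<lambda>i. v i / s) = N v / s\<^sup>2"
        by (simp add: N_def sum_divide_distrib power2_eq_square)
      finally show ?thesis using False by (simp add: field_simps)
    qed
    have Pi: "sqint M (gd_Pi D v)" unfolding M_def by (rule sqint_gd_Pi[OF assms])
    have "(\<integral>x. (norm (gd_Pi D v x))\<^sup>2 \<partial>M) \<le> (\<integral>x. s\<^sup>2 \<partial>M)"
    proof (rule integral_mono)
      show "integrable M (\<lambda>x. (norm (gd_Pi D v x))\<^sup>2)" using Pi by (simp add: sqint_def)
      fix x assume "x \<in> space M"
      then have "x \<in> \<Omega>" by (simp add: M_def)
      then obtain i where "gd_Pi D v x = v i" using gd_Pi_value[OF D] by blast
      then show "(norm (gd_Pi D v x))\<^sup>2 \<le> s\<^sup>2" using le by simp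
    qed simp
    then have "(sqnorm M (gd_Pi D v))\<^sup>2 \<le> measure M (space M) * s\<^sup>2"
      by (simp add: sqnorm_def)
    also have "\<dots> \<le> K * N v"
      using mult_left_mono[OF \<open>s\<^sup>2 * c \<le> N v\<close>, of K] c(1) by (simp add: K_def field_simps)
    also have "\<dots> = (sqrt K * sqnorm M (gd_grad D v))\<^sup>2"
      using c(1) by (simp add: power_mult_distrib N[OF v] K_def)
    finally show ?thesis
      by (rule power2_le_imp_le) (use c(1) in \<open>simp add: K_def\<close>)
  qed
  then show ?thesis unfolding M_def by blast
qed

lemma gd_grad_norm_pos:
  assumes "is_pc_GD \<Omega> D" "v \<in> gd_X D" "v \<noteq> (\<lambda>i. 0)"
  shows "0 < sqnorm (lebesgue_on \<Omega>) (gd_grad D v)"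
proof -
  have "sqnorm (lebesgue_on \<Omega>) (gd_grad D v) \<noteq> 0"
    using assms by (auto simp: is_pc_GD_def L2vnorm_eq)
  then show ?thesis using sqnorm_nonneg[of "lebesgue_on \<Omega>" "gd_grad D v"] by linarith
qed

text \<open>The absolute value gives a nonnegative factor in all cases, including a trivial
  \<open>gd_X D\<close>, where \<open>gd_C\<close> is a \<open>SUP\<close> over the empty
  set.\<close>

lemma gd_C_bound:
  assumes M: "finite_measure (lebesgue_on \<Omega>)" "\<Omega> \<in> sets lebesgue" and D: "is_pc_GD \<Omega> D" and v: "v \<in> gd_X D"
  shows "sqnorm (lebesgue_on \<Omega>) (gd_Pi D v) \<le> \<bar>gd_C \<Omega> D\<bar> * sqnorm (lebesgue_on \<Omega>) (gd_grad D v)"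
proof (cases "v = (\<lambda>i. 0)")
  case True
  then show ?thesis by (simp add: gd_Pi_def[abs_def] sqnorm_def)
next
  case False
  define M where "M = lebesgue_on \<Omega>"
  obtain C where C: "\<And>v. v \<in> gd_X D \<Longrightarrow> sqnorm M (gd_Pi D v) \<le> C * sqnorm M (gd_grad D v)"
    using gd_norm_equivalence[OF M D] unfolding M_def by blast
  have "sqnorm M (gd_Pi D v) / sqnorm M (gd_grad D v) \<le> gd_C \<Omega> D"
    unfolding gd_C_def L2norm_eq L2vnorm_eq M_def[symmetric]
  proof (rule cSUP_upper)
    show "bdd_above ((\<lambda>v. sqnorm M (gd_Pi D v) / sqnorm M (gd_grad D v)) ` {v \<in> gd_X D. v \<noteq> (\<lambda>i. 0)})"
      using C gd_grad_norm_pos[OF D, folded M_def] by (intro bdd_aboveI[of _ C]) (auto simp: field_simps)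
  qed (use v False in auto)
  also have "\<dots> \<le> \<bar>gd_C \<Omega> D\<bar>" by simp
  finally show ?thesis
    using gd_grad_norm_pos[OF D v False] by (simp add: field_simps M_def)
qed

text \<open>Cauchy-Schwarz and the norm equivalence bound the quotients above, so the supremum
  dominates each of them.\<close>

lemma gd_W_bound:
  assumes M: "finite_measure (lebesgue_on \<Omega>)" "\<Omega> \<in> sets lebesgue" and D: "is_pc_GD \<Omega> D"
    and v: "v \<in> gd_X D" and \<psi>: "sqint (lebesgue_on \<Omega>) \<psi>" and d: "sqint (lebesgue_on \<Omega>) d"
  shows "\<bar>sqip (lebesgue_on \<Omega>) (gd_grad D v) \<psi> + sqip (lebesgue_on \<Omega>) (gd_Pi D v) d\<bar>
    \<le> \<bar>gd_W \<Omega> D \<psi> d\<bar> * sqnorm (lebesgue_on \<Omega>) (gd_grad D v)"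
proof (cases "v = (\<lambda>i. 0)")
  case True
  then show ?thesis by (simp add: gd_Pi_def[abs_def] gd_grad_0[OF D] sqnorm_def sqip_def)
next
  case False
  define M where "M = lebesgue_on \<Omega>"
  obtain C where C: "\<And>v. v \<in> gd_X D \<Longrightarrow> sqnorm M (gd_Pi D v) \<le> C * sqnorm M (gd_grad D v)"
    using gd_norm_equivalence[OF M D] unfolding M_def by blast
  have sP: "sqint M (gd_Pi D v)" for v unfolding M_def by (rule sqint_gd_Pi[OF M D])
  have sG: "sqint M (gd_grad D v)" if "v \<in> gd_X D" for v unfolding M_def by (rule sqint_gd_grad[OF D that])
  have s: "sqint M \<psi>" "sqint M d" using \<psi> d by (simp_all add: M_def)
  have split: "(\<integral>x. gd_grad D v x \<bullet> \<psi> x + gd_Pi D v x * d x \<partial>M)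
      = sqip M (gd_grad D v) \<psi> + sqip M (gd_Pi D v) d" if "v \<in> gd_X D" for v
    using Bochner_Integration.integral_add[OF integrable_inner_sqint[OF sG[OF that] s(1)] integrable_inner_sqint[OF sP s(2), of v]]
    by (simp add: sqip_def)
  have "\<bar>sqip M (gd_grad D v) \<psi> + sqip M (gd_Pi D v) d\<bar> / sqnorm M (gd_grad D v)
    = \<bar>\<integral>x. gd_grad D v x \<bullet> \<psi> x + gd_Pi D v x * d x \<partial>M\<bar> / sqnorm M (gd_grad D v)"
    by (simp only: split[OF v])
  also have "\<dots> \<le> gd_W \<Omega> D \<psi> d"
    unfolding gd_W_def L2norm_eq L2vnorm_eq M_def[symmetric]
  proof (rule cSUP_upper)
    show "bdd_above ((\<lambda>v. \<bar>\<integral>x. gd_grad D v x \<bullet> \<psi> x + gd_Pi D v x * d x \<partial>M\<bar> / sqnorm M (gd_grad D v)) ` {v \<in> gd_X D. v \<noteq> (\<lambda>i. 0)})"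
    proof (intro bdd_aboveI[of _ "sqnorm M \<psi> + C * sqnorm M d"])
      fix y assume "y \<in> (\<lambda>v. \<bar>\<integral>x. gd_grad D v x \<bullet> \<psi> x + gd_Pi D v x * d x \<partial>M\<bar> / sqnorm M (gd_grad D v)) ` {v \<in> gd_X D. v \<noteq> (\<lambda>i. 0)}"
      then obtain w where w: "w \<in> gd_X D" "w \<noteq> (\<lambda>i. 0)"
        and y: "y = \<bar>sqip M (gd_grad D w) \<psi> + sqip M (gd_Pi D w) d\<bar> / sqnorm M (gd_grad D w)"
        using split by auto
      have "\<bar>sqip M (gd_grad D w) \<psi>\<bar> \<le> sqnorm M (gd_grad D w) * sqnorm M \<psi>"
        by (rule sqip_Cauchy_Schwarz[OF sG[OF w(1)] s(1)])
      moreover have "\<bar>sqip M (gd_Pi D w) d\<bar> \<le> (C * sqnorm M (gd_grad D w)) * sqnorm M d"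
        using sqip_Cauchy_Schwarz[OF sP s(2), of w] mult_right_mono[OF C[OF w(1)], of "sqnorm M d"] by simp
      ultimately have "\<bar>sqip M (gd_grad D w) \<psi> + sqip M (gd_Pi D w) d\<bar>
          \<le> (sqnorm M \<psi> + C * sqnorm M d) * sqnorm M (gd_grad D w)"
        by (simp add: algebra_simps)
      then show "y \<le> sqnorm M \<psi> + C * sqnorm M d"
        unfolding y using gd_grad_norm_pos[OF D w, folded M_def] by (simp add: pos_divide_le_eq)
    qed
  qed (use v False in auto)
  also have "\<dots> \<le> \<bar>gd_W \<Omega> D \<psi> d\<bar>" by simp
  finally show ?thesis
    using gd_grad_norm_pos[OF D v False] by (simp add: pos_divide_le_eq M_def)
qed

lemma gd_S_approx:
  assumes "gd_S \<Omega> D \<phi> G < e"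
  shows "\<exists>v\<in>gd_X D. sqnorm (lebesgue_on \<Omega>) (\<lambda>x. gd_grad D v x - G x) + sqnorm (lebesgue_on \<Omega>) (\<lambda>x. gd_Pi D v x - \<phi> x) < e"
proof -
  have "gd_X D \<noteq> {}" by (auto simp: gd_X_def)
  moreover have "bdd_below ((\<lambda>v. sqnorm (lebesgue_on \<Omega>) (\<lambda>x. gd_grad D v x - G x) + sqnorm (lebesgue_on \<Omega>) (\<lambda>x. gd_Pi D v x - \<phi> x)) ` gd_X D)"
    by (intro bdd_belowI[of _ 0]) auto
  ultimately show ?thesis
    using assms unfolding gd_S_def L2norm_eq L2vnorm_eq by (subst (asm) cINF_less_iff)
qed

section \<open>The elliptic problem\<close>

text \<open>Otherwise infinitely many indices keep \<open>a\<close> at distance at least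
  \<open>e\<close> from \<open>L\<close>, and enumerating them gives a subsequence none of whose
  subsequences tends to \<open>L\<close>. This upgrades compactness with a unique limit to
  convergence of the whole sequence.\<close>

lemma LIMSEQ_subsubsequence:
  fixes a :: "nat \<Rightarrow> real"
  assumes "\<And>k::nat \<Rightarrow> nat. strict_mono k \<Longrightarrow> \<exists>r. strict_mono r \<and> (\<lambda>j::nat. a (k (r j))) \<longlonglongrightarrow> L"
  shows "a \<longlonglongrightarrow> L"
proof (rule ccontr)
  assume "\<not> a \<longlonglongrightarrow> L"
  then obtain e where e: "e > 0" "\<And>N. \<exists>n\<ge>N. \<not> norm (a n - L) < e"
    unfolding LIMSEQ_iff by blast
  then have "infinite {n. \<not> norm (a n - L) < e}"
    unfolding infinite_nat_iff_unbounded_le by blast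
  then obtain k :: "nat \<Rightarrow> nat" where k: "strict_mono k" "\<And>n. k n \<in> {n. \<not> norm (a n - L) < e}"
    using infinite_enumerate by blast
  obtain r where "(\<lambda>j::nat. a (k (r j))) \<longlonglongrightarrow> L" using assms[OF k(1)] by blast
  from LIMSEQ_D[OF this e(1)] k(2) show False by auto
qed

lemma sqip_cong_AE_left:
  assumes "f \<in> borel_measurable M" "g \<in> borel_measurable M" "h \<in> borel_measurable M" "AE x in M. f x = g x"
  shows "sqip M f h = sqip M g h"
  unfolding sqip_def
  by (rule integral_cong_AE) (use assms in \<open>auto elim: eventually_mono\<close>)

lemma borel_measurable_matrix_vector_mult:
  fixes A :: "'a \<Rightarrow> real^'n^'m"
  assumes "A \<in> borel_measurable M" "G \<in> borel_measurable M"
  shows "(\<lambda>x. A x *v G x) \<in> borel_measurable M"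
proof (rule borel_measurable_continuous_Pair[OF assms])
  show "continuous_on UNIV (\<lambda>x::(real^'n^'m) \<times> (real^'n). fst x *v snd x)"
    unfolding matrix_vector_mult_def by (intro continuous_intros)
qed

locale elliptic_problem =
  fixes \<Omega> :: "(real^'n) set"
    and \<zeta> \<beta> :: "real \<Rightarrow> real"
    and \<Lambda> :: "real^'n \<Rightarrow> real^'n^'n"
    and f :: "real^'n \<Rightarrow> real" and F :: "real^'n \<Rightarrow> real^'n"
    and M0 M1 K0 K1 lam_lo lam_hi :: real
  assumes \<Omega>: "open \<Omega>" "bounded \<Omega>"
    and \<zeta>: "continuous_on UNIV \<zeta>" "mono \<zeta>" "\<zeta> 0 = 0" "M0 > 0" "M1 > 0"
           "\<And>s. \<bar>\<zeta> s\<bar> \<ge> M0 * \<bar>s\<bar> - M1"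
    and \<beta>: "continuous_on UNIV \<beta>" "mono \<beta>" "\<beta> 0 = 0" "K0 > 0" "K1 > 0"
           "\<And>s. \<bar>\<beta> s\<bar> \<le> K0 * \<bar>s\<bar> + K1"
    and \<beta>\<zeta>: "strict_mono (\<lambda>s. \<beta> s + \<zeta> s)"
    and \<Lambda>: "\<Lambda> \<in> borel_measurable (lebesgue_on \<Omega>)" "lam_lo > 0"
           "AE x in lebesgue_on \<Omega>. transpose (\<Lambda> x) = \<Lambda> x \<and>
               (\<forall>c. (\<exists>\<xi>. \<xi> \<noteq> 0 \<and> \<Lambda> x *v \<xi> = c *\<^sub>R \<xi>) \<longrightarrow> lam_lo \<le> c \<and> c \<le> lam_hi)"
    and fF: "L2 \<Omega> f" "L2v \<Omega> F"
begin

abbreviation "M \<equiv> lebesgue_on \<Omega>"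

lemma fM: "finite_measure M"
  by (rule finite_measure_lebesgue_on_bounded[OF \<Omega>])

lemma \<Omega>_sets: "\<Omega> \<in> sets lebesgue"
  using \<Omega> by auto

lemma f_sqint: "sqint M f" and F_sqint: "sqint M F"
  using fF by (simp_all add: L2_iff_sqint L2v_iff_sqint)

text \<open>The eigenvalue hypothesis acts only through these bounds, valid for all vectors
  simultaneously outside one null set.\<close>

lemma \<Lambda>_AE:
  "AE x in M. transpose (\<Lambda> x) = \<Lambda> x \<and>
     (\<forall>y. lam_lo * (norm y)\<^sup>2 \<le> (\<Lambda> x *v y) \<bullet> y \<and> norm (\<Lambda> x *v y) \<le> lam_hi * norm y)"
  using \<Lambda>(3)
proof eventually_elim
  case (elim x)
  then have "lam_lo * (norm y)\<^sup>2 \<le> (\<Lambda> x *v y) \<bullet> y" "norm (\<Lambda> x *v y) \<le> lam_hi * norm y" for y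
    using symmetric_matrix_bounds[of "\<Lambda> x" lam_lo lam_hi y] \<Lambda>(2) by blast+
  with elim show ?case by blast
qed

lemma \<Lambda>_measurable: "sqint M G \<Longrightarrow> (\<lambda>x. \<Lambda> x *v G x) \<in> borel_measurable M"
  by (intro borel_measurable_matrix_vector_mult \<Lambda>(1) sqint_measurable)

lemma \<Lambda>_power2_AE:
  "AE x in M. (norm (\<Lambda> x *v G x))\<^sup>2 \<le> lam_hi\<^sup>2 * (norm (G x))\<^sup>2"
  using \<Lambda>_AE
proof eventually_elim
  case (elim x)
  then have "norm (\<Lambda> x *v G x) \<le> lam_hi * norm (G x)" by blast
  then have "(norm (\<Lambda> x *v G x))\<^sup>2 \<le> (lam_hi * norm (G x))\<^sup>2" by (rule power_mono) simp
  then show ?case by (simp only: power_mult_distrib)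
qed

lemma \<Lambda>_sqint:
  assumes "sqint M G"
  shows "sqint M (\<lambda>x. \<Lambda> x *v G x)"
  unfolding sqint_def
proof
  show m: "(\<lambda>x. \<Lambda> x *v G x) \<in> borel_measurable M" by (rule \<Lambda>_measurable[OF assms])
  show "integrable M (\<lambda>x. (norm (\<Lambda> x *v G x))\<^sup>2)"
  proof (rule Bochner_Integration.integrable_bound)
    show "integrable M (\<lambda>x. lam_hi\<^sup>2 * (norm (G x))\<^sup>2)" using assms by (simp add: sqint_def)
    show "(\<lambda>x. (norm (\<Lambda> x *v G x))\<^sup>2) \<in> borel_measurable M" using m by measurable
    show "AE x in M. norm ((norm (\<Lambda> x *v G x))\<^sup>2) \<le> norm (lam_hi\<^sup>2 * (norm (G x))\<^sup>2)"
      using \<Lambda>_power2_AE[of G] by eventually_elim simp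
  qed
qed

lemma \<Lambda>_sqnorm:
  assumes "sqint M G"
  shows "sqnorm M (\<lambda>x. \<Lambda> x *v G x) \<le> \<bar>lam_hi\<bar> * sqnorm M G"
proof (rule power2_le_imp_le)
  have "(\<integral>x. (norm (\<Lambda> x *v G x))\<^sup>2 \<partial>M) \<le> (\<integral>x. lam_hi\<^sup>2 * (norm (G x))\<^sup>2 \<partial>M)"
    using \<Lambda>_sqint[OF assms] assms \<Lambda>_power2_AE[of G] by (intro integral_mono_AE) (auto simp: sqint_def)
  then show "(sqnorm M (\<lambda>x. \<Lambda> x *v G x))\<^sup>2 \<le> (\<bar>lam_hi\<bar> * sqnorm M G)\<^sup>2"
    by (simp add: sqnorm_def power_mult_distrib)
qed simp

lemma \<Lambda>_sym:
  assumes "sqint M G" "sqint M H"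
  shows "sqip M (\<lambda>x. \<Lambda> x *v G x) H = sqip M G (\<lambda>x. \<Lambda> x *v H x)"
  unfolding sqip_def
proof (rule integral_cong_AE)
  show "AE x in M. (\<Lambda> x *v G x) \<bullet> H x = G x \<bullet> (\<Lambda> x *v H x)"
    using \<Lambda>_AE by eventually_elim (simp add: symmetric_matrix_inner)
  show "(\<lambda>x. (\<Lambda> x *v G x) \<bullet> H x) \<in> borel_measurable M" "(\<lambda>x. G x \<bullet> (\<Lambda> x *v H x)) \<in> borel_measurable M"
    using assms by (intro borel_measurable_integrable integrable_inner_sqint \<Lambda>_sqint; simp)+
qed

lemma \<Lambda>_coercive:
  assumes "sqint M G"
  shows "lam_lo * (sqnorm M G)\<^sup>2 \<le> sqip M (\<lambda>x. \<Lambda> x *v G x) G"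
proof -
  have "(\<integral>x. lam_lo * (norm (G x))\<^sup>2 \<partial>M) \<le> (\<integral>x. (\<Lambda> x *v G x) \<bullet> G x \<partial>M)"
  proof (rule integral_mono_AE)
    show "integrable M (\<lambda>x. lam_lo * (norm (G x))\<^sup>2)" using assms by (simp add: sqint_def)
    show "integrable M (\<lambda>x. (\<Lambda> x *v G x) \<bullet> G x)" by (intro integrable_inner_sqint \<Lambda>_sqint assms)
    show "AE x in M. lam_lo * (norm (G x))\<^sup>2 \<le> (\<Lambda> x *v G x) \<bullet> G x"
      using \<Lambda>_AE by eventually_elim blast
  qed
  then show ?thesis by (simp add: sqip_def sqnorm_def)
qed

lemma \<Lambda>_diff: "\<Lambda> x *v (y - z) = \<Lambda> x *v y - \<Lambda> x *v z"
  by (rule matrix_vector_mult_diff_distrib)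

section \<open>Pointwise properties of the two nonlinearities\<close>

text \<open>The increments of \<open>\<zeta>\<close> and \<open>\<beta>\<close> have the same sign,
  so their product is nonnegative; adding the square of the \<open>\<zeta>\<close> increment gives
  the claim. Unlike plain monotonicity of \<open>\<zeta>\<close>, this controls a square and so
  yields norm convergence.\<close>

lemma firmly_monotone: "(\<zeta> a - \<zeta> b)\<^sup>2 \<le> (\<zeta> a - \<zeta> b) * ((\<beta> a + \<zeta> a) - (\<beta> b + \<zeta> b))"
proof -
  have "0 \<le> (\<zeta> a - \<zeta> b) * (\<beta> a - \<beta> b)"
    using monoD[OF \<zeta>(2), of a b] monoD[OF \<zeta>(2), of b a] monoD[OF \<beta>(2), of a b] monoD[OF \<beta>(2), of b a]
    by (cases "a \<le> b") (auto intro: mult_nonpos_nonpos)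
  then show ?thesis by (simp add: power2_eq_square algebra_simps)
qed

lemma \<beta>_\<zeta>_nonneg: "0 \<le> \<beta> s * \<zeta> s"
  using monoD[OF \<zeta>(2), of 0 s] monoD[OF \<zeta>(2), of s 0] monoD[OF \<beta>(2), of 0 s] monoD[OF \<beta>(2), of s 0]
    \<zeta>(3) \<beta>(3) by (cases "0 \<le> s") (auto intro: mult_nonpos_nonpos)

text \<open>Firm monotonicity between \<open>s\<close> and 0, divided by
  \<open>\<bar>\<zeta> s\<bar>\<close>.\<close>

lemma abs_\<zeta>_le: "\<bar>\<zeta> s\<bar> \<le> \<bar>\<beta> s + \<zeta> s\<bar>"
proof (cases "\<zeta> s = 0")
  case False
  have "\<bar>\<zeta> s\<bar> * \<bar>\<zeta> s\<bar> \<le> \<bar>\<zeta> s\<bar> * \<bar>\<beta> s + \<zeta> s\<bar>"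
    using firmly_monotone[of s 0] \<zeta>(3) \<beta>(3) abs_ge_self[of "\<zeta> s * (\<beta> s + \<zeta> s)"]
    by (simp add: power2_eq_square abs_mult)
  then show ?thesis by (rule mult_left_le_imp_le) (use False in simp)
qed simp

lemma \<beta>\<zeta>_surj: "\<exists>s. \<beta> s + \<zeta> s = y"
proof -
  \<comment> \<open>Chosen so that \<open>M0 * s - M1 = \<bar>y\<bar>\<close>: the growth of
    \<open>\<zeta>\<close> puts \<open>\<zeta> s\<close> above and \<open>\<zeta> (- s)\<close>
    below \<open>y\<close>, and the signs of \<open>\<beta>\<close> preserve this for the
    sum.\<close>
  define s where "s = (\<bar>y\<bar> + M1) / M0"
  have s: "0 \<le> s" "M0 * s - M1 = \<bar>y\<bar>" using \<zeta>(4,5) by (auto simp: s_def)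
  have "\<bar>y\<bar> \<le> \<bar>\<zeta> s\<bar>" "\<bar>y\<bar> \<le> \<bar>\<zeta> (- s)\<bar>" using \<zeta>(6)[of s] \<zeta>(6)[of "- s"] s by auto
  moreover have "0 \<le> \<zeta> s" "\<zeta> (- s) \<le> 0" "0 \<le> \<beta> s" "\<beta> (- s) \<le> 0"
    using monoD[OF \<zeta>(2), of 0 s] monoD[OF \<zeta>(2), of "- s" 0] monoD[OF \<beta>(2), of 0 s]
      monoD[OF \<beta>(2), of "- s" 0] \<zeta>(3) \<beta>(3) s(1) by auto
  ultimately have "\<beta> (- s) + \<zeta> (- s) \<le> y" "y \<le> \<beta> s + \<zeta> s" by linarith+
  moreover have "continuous_on {- s..s} (\<lambda>s. \<beta> s + \<zeta> s)"
    by (intro continuous_on_add continuous_on_subset[OF \<beta>(1)] continuous_on_subset[OF \<zeta>(1)]) auto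
  ultimately obtain t where "\<beta> t + \<zeta> t = y"
    using IVT'[of "\<lambda>s. \<beta> s + \<zeta> s" "- s" y s] s(1) by auto
  then show ?thesis ..
qed

text \<open>The inverse of \<open>\<beta> + \<zeta>\<close>: the growth of \<open>\<zeta>\<close>
  gives existence and strict monotonicity gives uniqueness, so \<open>SOME\<close> makes no real
  choice.\<close>

definition \<mu>inv :: "real \<Rightarrow> real" where "\<mu>inv y = (SOME s. \<beta> s + \<zeta> s = y)"

lemma \<mu>inv: "\<beta> (\<mu>inv y) + \<zeta> (\<mu>inv y) = y"
  unfolding \<mu>inv_def by (rule someI_ex[OF \<beta>\<zeta>_surj])

lemma \<mu>inv_measurable: "\<mu>inv \<in> borel_measurable borel"
proof (rule borel_measurable_mono)
  show "mono \<mu>inv"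
  proof (rule monoI, rule ccontr)
    fix x y :: real assume "x \<le> y" "\<not> \<mu>inv x \<le> \<mu>inv y"
    then show False using strict_monoD[OF \<beta>\<zeta>, of "\<mu>inv y" "\<mu>inv x"] \<mu>inv by simp
  qed
qed

lemma comp_measurable:
  assumes "v \<in> borel_measurable M"
  shows "(\<lambda>x. \<zeta> (v x)) \<in> borel_measurable M" "(\<lambda>x. \<beta> (v x)) \<in> borel_measurable M"
  by (rule measurable_compose[OF assms borel_measurable_continuous_onI[OF \<zeta>(1)]],
      rule measurable_compose[OF assms borel_measurable_continuous_onI[OF \<beta>(1)]])

lemma abs_le_abs_\<zeta>: "\<bar>s\<bar> \<le> inverse M0 * (\<bar>\<zeta> s\<bar> + M1)"
  using \<zeta>(6)[of s] \<zeta>(4) by (simp add: field_simps)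

lemma abs_\<beta>_le_abs_\<zeta>: "\<bar>\<beta> s\<bar> \<le> K0 * (inverse M0 * (\<bar>\<zeta> s\<bar> + M1)) + K1"
  using \<beta>(6)[of s] mult_left_mono[OF abs_le_abs_\<zeta>[of s], of K0] \<beta>(4) by linarith

text \<open>Coercivity of \<open>\<zeta>\<close> bounds \<open>\<bar>s\<bar>\<close> affinely by
  \<open>\<bar>\<zeta> s\<bar>\<close>, and linear growth of \<open>\<beta>\<close> passes this on
  to \<open>\<bar>\<beta> s\<bar>\<close>. Control of \<open>v\<close> and of
  \<open>\<beta> (v x)\<close> is thereby reduced to control of
  \<open>\<zeta> (v x)\<close>.\<close>

lemma sqint_of_\<zeta>:
  assumes v: "v \<in> borel_measurable M" and z: "sqint M (\<lambda>x. \<zeta> (v x))"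
  shows "sqint M v" "sqint M (\<lambda>x. \<beta> (v x))"
    and "sqnorm M (\<lambda>x. \<beta> (v x)) \<le> K0 * inverse M0 * sqnorm M (\<lambda>x. \<zeta> (v x)) + (K0 * inverse M0 * M1 + K1) * sqnorm M (\<lambda>x. 1::real)"
proof -
  have za: "sqint M (\<lambda>x. \<bar>\<zeta> (v x)\<bar>)"
    by (rule sqint_bound[OF _ z]) (use sqint_measurable[OF z] in auto)
  have one: "sqint M (\<lambda>x. c::real)" for c by (rule sqint_const[OF fM])
  define a where "a = K0 * inverse M0"
  define c where "c = K0 * inverse M0 * M1 + K1"
  have ac: "0 \<le> a" "0 \<le> c" using \<zeta> \<beta> by (auto simp: a_def c_def)
  have "sqint M (\<lambda>x. inverse M0 *\<^sub>R (\<bar>\<zeta> (v x)\<bar> + M1))"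
    by (intro sqint_scaleR sqint_add za one)
  then show "sqint M v"
    by (rule sqint_bound[OF v]) (use abs_le_abs_\<zeta> in \<open>auto intro: order_trans[OF _ abs_ge_self]\<close>)
  have g: "sqint M (\<lambda>x. a *\<^sub>R \<bar>\<zeta> (v x)\<bar> + c *\<^sub>R (1::real))"
    by (intro sqint_scaleR sqint_add za one)
  have le: "\<bar>\<beta> (v x)\<bar> \<le> a *\<^sub>R \<bar>\<zeta> (v x)\<bar> + c *\<^sub>R 1" for x
    using abs_\<beta>_le_abs_\<zeta>[of "v x"] by (simp add: a_def c_def algebra_simps)
  have le': "norm (\<beta> (v x)) \<le> norm (a *\<^sub>R \<bar>\<zeta> (v x)\<bar> + c *\<^sub>R 1)" for x
    using le[of x] unfolding real_norm_def by linarith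
  show b: "sqint M (\<lambda>x. \<beta> (v x))"
    by (rule sqint_bound[OF comp_measurable(2)[OF v] g le'])
  have "sqnorm M (\<lambda>x. \<beta> (v x)) \<le> sqnorm M (\<lambda>x. a *\<^sub>R \<bar>\<zeta> (v x)\<bar> + c *\<^sub>R (1::real))"
    unfolding sqnorm_def
    using b g by (intro real_sqrt_le_mono integral_mono power_mono le') (auto simp: sqint_def)
  also have "\<dots> \<le> sqnorm M (\<lambda>x. a *\<^sub>R \<bar>\<zeta> (v x)\<bar>) + sqnorm M (\<lambda>x. c *\<^sub>R (1::real))"
    by (intro sqnorm_triangle sqint_scaleR za one)
  also have "\<dots> = a * sqnorm M (\<lambda>x. \<zeta> (v x)) + c * sqnorm M (\<lambda>x. 1::real)"
    unfolding sqnorm_scaleR using ac by (simp add: sqnorm_def)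
  finally show "sqnorm M (\<lambda>x. \<beta> (v x)) \<le> K0 * inverse M0 * sqnorm M (\<lambda>x. \<zeta> (v x)) + (K0 * inverse M0 * M1 + K1) * sqnorm M (\<lambda>x. 1::real)"
    by (simp add: a_def c_def)
qed

lemma solves_W_iff:
  "solves_W \<Omega> \<zeta> \<beta> \<Lambda> f F v G \<longleftrightarrow> sqint M v \<and> H10 \<Omega> (\<lambda>x. \<zeta> (v x)) G \<and>
     (\<forall>w Gw. H10 \<Omega> w Gw \<longrightarrow> sqip M (\<lambda>x. \<beta> (v x)) w + sqip M (\<lambda>x. \<Lambda> x *v G x) Gw = sqip M f w - sqip M F Gw)"
  by (simp add: solves_W_def sqip_def L2_iff_sqint)

lemma H10_sqint:
  assumes "H10 \<Omega> w Gw"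
  shows "sqint M w" "sqint M Gw"
  using assms by (simp_all add: H10_def L2_iff_sqint L2v_iff_sqint)

lemma sqip_monotone_nonneg:
  "0 \<le> sqip M (\<lambda>x. \<beta> (v x) - \<beta> (w x)) (\<lambda>x. \<zeta> (v x) - \<zeta> (w x))"
  unfolding sqip_def
proof (rule integral_nonneg_AE, rule AE_I2)
  fix x
  show "0 \<le> (\<beta> (v x) - \<beta> (w x)) \<bullet> (\<zeta> (v x) - \<zeta> (w x))"
    using firmly_monotone[of "v x" "w x"] by (simp add: power2_eq_square algebra_simps)
qed

end

section \<open>Gradient schemes\<close>

locale gradient_scheme_sequence = elliptic_problem \<Omega> \<zeta> \<beta> \<Lambda> f F M0 M1 K0 K1 lam_lo lam_hi
  for \<Omega> :: "(real^'n) set" and \<zeta> \<beta> :: "real \<Rightarrow> real" and \<Lambda> :: "real^'n \<Rightarrow> real^'n^'n"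
    and f :: "real^'n \<Rightarrow> real" and F :: "real^'n \<Rightarrow> real^'n"
    and M0 M1 K0 K1 lam_lo lam_hi :: real +
  fixes D :: "nat \<Rightarrow> 'n gd" and u :: "nat \<Rightarrow> nat \<Rightarrow> real"
  assumes GD: "\<And>m. is_pc_GD \<Omega> (D m)"
    and coercive: "bounded (range (\<lambda>m. gd_C \<Omega> (D m)))"
    and consistent: "\<And>\<phi> G\<phi>. H10 \<Omega> \<phi> G\<phi> \<Longrightarrow> (\<lambda>m. gd_S \<Omega> (D m) \<phi> G\<phi>) \<longlonglongrightarrow> 0"
       "(\<lambda>m. L2norm \<Omega> (\<lambda>x. gd_Q (D m) f x - f x)) \<longlonglongrightarrow> 0"
    and limit_conform: "\<And>\<psi> div\<psi>. Hdiv \<Omega> \<psi> div\<psi> \<Longrightarrow> (\<lambda>m. gd_W \<Omega> (D m) \<psi> div\<psi>) \<longlonglongrightarrow> 0"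
    and compact: "\<And>v. (\<forall>m. v m \<in> gd_X (D m)) \<Longrightarrow>
        bounded (range (\<lambda>m. L2vnorm \<Omega> (gd_grad (D m) (v m)))) \<Longrightarrow>
        (\<forall>k::nat \<Rightarrow> nat. \<exists>r g. strict_mono r \<and> L2 \<Omega> g \<and>
            (\<lambda>j. L2norm \<Omega> (\<lambda>x. gd_Pi (D (k (r j))) (v (k (r j))) x - g x)) \<longlonglongrightarrow> 0)"
    and sol: "\<And>m. solves_GS \<Omega> \<zeta> \<beta> \<Lambda> f F (D m) (u m)"
begin

text \<open>\<open>z\<close>, \<open>g\<close> and \<open>b\<close> are the discrete counterparts of
  \<open>\<zeta>\<close> of the solution, its gradient, and \<open>\<beta>\<close> of the solution.
  Limits are taken of these and never of the reconstruction of \<open>u m\<close> itself.\<close>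

definition "z m = gd_Pi (D m) (\<lambda>i. \<zeta> (u m i))"
definition "g m = gd_grad (D m) (\<lambda>i. \<zeta> (u m i))"
definition "b m = gd_Pi (D m) (\<lambda>i. \<beta> (u m i))"
definition "q m = gd_Q (D m) f"

text \<open>Since \<open>\<zeta> 0 = 0\<close> preserves zero entries, \<open>\<zeta> (u m)\<close>
  is itself an admissible test vector; the energy bound and the energy limit both rest on
  this.\<close>

lemma \<zeta>u_X: "(\<lambda>i. \<zeta> (u m i)) \<in> gd_X (D m)"
  using sol[of m] \<zeta>(3) by (simp add: solves_GS_def gd_X_def)

lemma Pi_sqint: "sqint M (gd_Pi (D m) v)"
  by (rule sqint_gd_Pi[OF fM \<Omega>_sets GD])

lemma z_sqint: "sqint M (z m)" and b_sqint: "sqint M (b m)" and g_sqint: "sqint M (g m)"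
  by (auto simp: z_def b_def g_def intro: Pi_sqint sqint_gd_grad[OF GD \<zeta>u_X])

lemma q_sqint: "sqint M (q m)"
  using GD[of m] fF(1) by (simp add: is_pc_GD_def q_def L2_iff_sqint)

lemma q_tendsto: "(\<lambda>m. sqnorm M (\<lambda>x. q m x - f x)) \<longlonglongrightarrow> 0"
  using consistent(2) by (simp add: q_def L2norm_eq)

lemma z_eq: "x \<in> \<Omega> \<Longrightarrow> z m x = \<zeta> (gd_Pi (D m) (u m) x)"
  and b_eq: "x \<in> \<Omega> \<Longrightarrow> b m x = \<beta> (gd_Pi (D m) (u m) x)"
  by (simp_all add: z_def b_def gd_Pi_comp[OF GD])

lemma scheme:
  assumes "v \<in> gd_X (D m)"
  shows "sqip M (b m) (gd_Pi (D m) v) + sqip M (\<lambda>x. \<Lambda> x *v g m x) (gd_grad (D m) v)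
    = sqip M (q m) (gd_Pi (D m) v) - sqip M F (gd_grad (D m) v)"
proof -
  have "(\<integral>x. \<beta> (gd_Pi (D m) (u m) x) * gd_Pi (D m) v x \<partial>M) = sqip M (b m) (gd_Pi (D m) v)"
    unfolding sqip_def by (rule Bochner_Integration.integral_cong) (simp_all add: b_eq)
  then show ?thesis
    using sol[of m, unfolded solves_GS_def, THEN conjunct2, rule_format, OF assms]
    by (simp add: sqip_def g_def q_def)
qed

lemma coercivity_constant:
  obtains K where "K \<ge> 0" "\<And>m v. v \<in> gd_X (D m) \<Longrightarrow> sqnorm M (gd_Pi (D m) v) \<le> K * sqnorm M (gd_grad (D m) v)"
proof -
  obtain K where K: "\<And>m. \<bar>gd_C \<Omega> (D m)\<bar> \<le> K"
    using coercive by (auto simp: bounded_iff)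
  have "sqnorm M (gd_Pi (D m) v) \<le> K * sqnorm M (gd_grad (D m) v)" if "v \<in> gd_X (D m)" for m v
    using gd_C_bound[OF fM \<Omega>_sets GD that] mult_right_mono[OF K[of m] sqnorm_nonneg[of M "gd_grad (D m) v"]]
    by (rule order_trans)
  moreover have "K \<ge> 0" using K[of 0] by linarith
  ultimately show ?thesis using that by blast
qed

lemma H10_approx:
  assumes H: "H10 \<Omega> \<phi> G"
  obtains v where "\<And>m. v m \<in> gd_X (D m)" "(\<lambda>m. sqnorm M (\<lambda>x. gd_grad (D m) (v m) x - G x)) \<longlonglongrightarrow> 0"
    "(\<lambda>m. sqnorm M (\<lambda>x. gd_Pi (D m) (v m) x - \<phi> x)) \<longlonglongrightarrow> 0"
proof -
  \<comment> \<open>The positive summand leaves room for a near-minimiser of the infimum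
    \<open>gd_S\<close> and tends to 0.\<close>
  define e where "e m = gd_S \<Omega> (D m) \<phi> G + inverse (real (Suc m))" for m
  have e0: "e \<longlonglongrightarrow> 0"
    unfolding e_def using tendsto_add[OF consistent(1)[OF H] LIMSEQ_inverse_real_of_nat] by simp
  have "\<forall>m. \<exists>v. v \<in> gd_X (D m) \<and> sqnorm M (\<lambda>x. gd_grad (D m) v x - G x) + sqnorm M (\<lambda>x. gd_Pi (D m) v x - \<phi> x) < e m"
    using gd_S_approx[of \<Omega> "D m" \<phi> G "e m" for m] by (auto simp: e_def)
  then obtain v where v: "\<And>m. v m \<in> gd_X (D m)"
    "\<And>m. sqnorm M (\<lambda>x. gd_grad (D m) (v m) x - G x) + sqnorm M (\<lambda>x. gd_Pi (D m) (v m) x - \<phi> x) < e m"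
    using choice[of "\<lambda>m v. v \<in> gd_X (D m) \<and> sqnorm M (\<lambda>x. gd_grad (D m) v x - G x) + sqnorm M (\<lambda>x. gd_Pi (D m) v x - \<phi> x) < e m"]
    by blast
  have le: "sqnorm M (\<lambda>x. gd_grad (D m) (v m) x - G x) \<le> e m" "sqnorm M (\<lambda>x. gd_Pi (D m) (v m) x - \<phi> x) \<le> e m" for m
    using v(2)[of m] sqnorm_nonneg[of M "\<lambda>x. gd_grad (D m) (v m) x - G x"]
      sqnorm_nonneg[of M "\<lambda>x. gd_Pi (D m) (v m) x - \<phi> x"] by linarith+
  show ?thesis
  proof (rule that[OF v(1)])
    show "(\<lambda>m. sqnorm M (\<lambda>x. gd_grad (D m) (v m) x - G x)) \<longlonglongrightarrow> 0"
      by (rule Lim_null_comparison[OF always_eventually e0]) (simp add: le)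
    show "(\<lambda>m. sqnorm M (\<lambda>x. gd_Pi (D m) (v m) x - \<phi> x)) \<longlonglongrightarrow> 0"
      by (rule Lim_null_comparison[OF always_eventually e0]) (simp add: le)
  qed
qed

text \<open>The Poincare inequality on \<open>H10\<close> is inherited from the coercivity and consistency of the discretisations.\<close>

lemma H10_grad_zero:
  assumes H: "H10 \<Omega> \<phi> G" and G0: "sqnorm M G = 0"
  shows "sqnorm M \<phi> = 0"
proof -
  obtain K where K: "K \<ge> 0" "\<And>m v. v \<in> gd_X (D m) \<Longrightarrow> sqnorm M (gd_Pi (D m) v) \<le> K * sqnorm M (gd_grad (D m) v)"
    using coercivity_constant by blast
  obtain v where v: "\<And>m. v m \<in> gd_X (D m)" "(\<lambda>m. sqnorm M (\<lambda>x. gd_grad (D m) (v m) x - G x)) \<longlonglongrightarrow> 0"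
    "(\<lambda>m. sqnorm M (\<lambda>x. gd_Pi (D m) (v m) x - \<phi> x)) \<longlonglongrightarrow> 0"
    using H10_approx[OF H] by blast
  have "(\<lambda>m. sqnorm M (gd_Pi (D m) (v m))) \<longlonglongrightarrow> sqnorm M \<phi>"
    by (rule tendsto_sqnorm[OF Pi_sqint H10_sqint(1)[OF H] v(3)])
  moreover have "(\<lambda>m. K * sqnorm M (gd_grad (D m) (v m))) \<longlonglongrightarrow> K * sqnorm M G"
    by (intro tendsto_mult_left tendsto_sqnorm[OF sqint_gd_grad[OF GD v(1)] H10_sqint(2)[OF H] v(2)])
  ultimately have "sqnorm M \<phi> \<le> K * sqnorm M G"
    by (rule LIMSEQ_le) (use K(2) v(1) in blast)
  then show ?thesis using G0 sqnorm_nonneg[of M \<phi>] by simp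
qed

section \<open>Uniqueness for the weak problem and a priori bounds\<close>

lemma solves_W_sqint:
  assumes "solves_W \<Omega> \<zeta> \<beta> \<Lambda> f F v G"
  shows "sqint M v" "sqint M (\<lambda>x. \<zeta> (v x))" "sqint M (\<lambda>x. \<beta> (v x))" "sqint M G" "H10 \<Omega> (\<lambda>x. \<zeta> (v x)) G"
proof -
  show v: "sqint M v" and H: "H10 \<Omega> (\<lambda>x. \<zeta> (v x)) G" using assms by (simp_all add: solves_W_iff)
  show "sqint M (\<lambda>x. \<zeta> (v x))" "sqint M G" by (rule H10_sqint[OF H])+
  then show "sqint M (\<lambda>x. \<beta> (v x))" using sqint_of_\<zeta>(2)[OF sqint_measurable[OF v]] by blast
qed

text \<open>Tested with the difference of the \<open>\<zeta>\<close> parts, the equations leave two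
  nonnegative terms with sum 0, so the gradients agree by coercivity of \<open>\<Lambda>\<close>,
  and then the \<open>\<zeta>\<close> parts by the Poincare inequality. What remains makes the
  difference of the \<open>\<beta>\<close> parts orthogonal to every test function. Equality of
  pairings is the form in which weak limits are compared.\<close>

lemma solves_W_unique:
  assumes W: "solves_W \<Omega> \<zeta> \<beta> \<Lambda> f F v G" and W': "solves_W \<Omega> \<zeta> \<beta> \<Lambda> f F v' G'"
  shows "sqnorm M (\<lambda>x. \<zeta> (v x) - \<zeta> (v' x)) = 0" "sqnorm M (\<lambda>x. G x - G' x) = 0"
    "\<And>h. sqint M h \<Longrightarrow> sqip M (\<lambda>x. \<beta> (v x)) h = sqip M (\<lambda>x. \<beta> (v' x)) h"
proof -
  note s = solves_W_sqint[OF W] and s' = solves_W_sqint[OF W']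
  have sd: "sqint M (\<lambda>x. \<beta> (v x) - \<beta> (v' x))" "sqint M (\<lambda>x. G x - G' x)" using s s' by (auto intro: sqint_diff)
  have eq: "sqip M (\<lambda>x. \<beta> (v x) - \<beta> (v' x)) w + sqip M (\<lambda>x. \<Lambda> x *v (G x - G' x)) Gw = 0"
    if H: "H10 \<Omega> w Gw" for w Gw
  proof -
    note h = H10_sqint[OF H]
    have "sqip M (\<lambda>x. \<beta> (v x)) w + sqip M (\<lambda>x. \<Lambda> x *v G x) Gw
        = sqip M (\<lambda>x. \<beta> (v' x)) w + sqip M (\<lambda>x. \<Lambda> x *v G' x) Gw"
      using W W' H by (simp add: solves_W_iff)
    then show ?thesis
      unfolding \<Lambda>_diff sqip_diff_left[OF s(3) s'(3) h(1)] sqip_diff_left[OF \<Lambda>_sqint[OF s(4)] \<Lambda>_sqint[OF s'(4)] h(2)]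
      by simp
  qed
  have H: "H10 \<Omega> (\<lambda>x. \<zeta> (v x) - \<zeta> (v' x)) (\<lambda>x. G x - G' x)" by (rule H10_diff[OF \<Omega> s(5) s'(5)])
  have "lam_lo * (sqnorm M (\<lambda>x. G x - G' x))\<^sup>2 \<le> 0"
    using eq[OF H] sqip_monotone_nonneg[of v v'] \<Lambda>_coercive[OF sd(2)] by linarith
  then show G0: "sqnorm M (\<lambda>x. G x - G' x) = 0"
    using \<Lambda>(2) by (simp add: mult_le_0_iff)
  show "sqnorm M (\<lambda>x. \<zeta> (v x) - \<zeta> (v' x)) = 0" by (rule H10_grad_zero[OF H G0])
  have "sqip M (\<lambda>x. \<beta> (v x) - \<beta> (v' x)) \<phi> = 0" if \<phi>: "Cc_inf \<Omega> \<phi>" for \<phi>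
  proof -
    have "\<bar>sqip M (\<lambda>x. \<Lambda> x *v (G x - G' x)) (grad \<phi>)\<bar>
        \<le> sqnorm M (\<lambda>x. \<Lambda> x *v (G x - G' x)) * sqnorm M (grad \<phi>)"
      by (intro sqip_Cauchy_Schwarz \<Lambda>_sqint sd Cc_inf_imp_sqint \<Omega> \<phi>)
    moreover have "sqnorm M (\<lambda>x. \<Lambda> x *v (G x - G' x)) = 0"
      using \<Lambda>_sqnorm[OF sd(2)] G0 sqnorm_nonneg[of M "\<lambda>x. \<Lambda> x *v (G x - G' x)"] by simp
    ultimately show ?thesis using eq[OF Cc_inf_imp_H10[OF \<Omega> \<phi>]] by simp
  qed
  then have "AE x in M. \<beta> (v x) - \<beta> (v' x) = 0"
    by (rule sqip_Cc_inf_zero_imp_AE[OF \<Omega> sd(1)])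
  then have AE: "AE x in M. \<beta> (v x) = \<beta> (v' x)" by simp
  show "sqip M (\<lambda>x. \<beta> (v x)) h = sqip M (\<lambda>x. \<beta> (v' x)) h" if "sqint M h" for h
    by (rule sqip_cong_AE_left[OF _ _ _ AE]) (use s s' that in \<open>auto intro: sqint_measurable\<close>)
qed

text \<open>Testing the scheme with \<open>\<zeta> (u m)\<close> makes the zero-order term
  nonnegative, because \<open>\<beta>\<close> and \<open>\<zeta>\<close> have the same sign.
  Coercivity of \<open>\<Lambda>\<close> and the uniform discrete Poincare constant \<open>K\<close>
  then bound the gradient, and the bounds on \<open>z\<close> and \<open>b\<close> follow from
  it.\<close>

lemma apriori_bound:
  obtains C where "C \<ge> 0" "\<And>m. sqnorm M (g m) \<le> C" "\<And>m. sqnorm M (z m) \<le> C" "\<And>m. sqnorm M (b m) \<le> C"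
    "\<And>m. sqnorm M (q m) \<le> C"
proof -
  obtain K where K: "K \<ge> 0" "\<And>m v. v \<in> gd_X (D m) \<Longrightarrow> sqnorm M (gd_Pi (D m) v) \<le> K * sqnorm M (gd_grad (D m) v)"
    using coercivity_constant by blast
  have zK: "sqnorm M (z m) \<le> K * sqnorm M (g m)" for m
    unfolding z_def g_def by (rule K(2)[OF \<zeta>u_X])
  have "bounded (range (\<lambda>m. sqnorm M (\<lambda>x. q m x - f x)))"
    by (rule convergent_imp_bounded[OF q_tendsto])
  then obtain B where B: "\<And>m. sqnorm M (\<lambda>x. q m x - f x) \<le> B" by (auto simp: bounded_iff)
  define Cq where "Cq = B + sqnorm M f"
  have Cq: "sqnorm M (q m) \<le> Cq" for m
    using sqnorm_le_add_diff[OF q_sqint f_sqint, of m] B[of m] by (simp add: Cq_def)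
  \<comment> \<open>From \<open>lam_lo * n\<^sup>2 \<le> (Cq * K + sqnorm M F) * n\<close> with
    \<open>n = sqnorm M (g m)\<close>, after division by a positive \<open>n\<close>.\<close>
  define Cg where "Cg = (Cq * K + sqnorm M F) / lam_lo"
  have Cg: "sqnorm M (g m) \<le> Cg" for m
  proof (cases "sqnorm M (g m) = 0")
    case True
    have "0 \<le> Cq" using order_trans[OF sqnorm_nonneg Cq] .
    then show ?thesis using True K(1) \<Lambda>(2) by (simp add: Cg_def)
  next
    case False
    have b0: "0 \<le> sqip M (b m) (z m)"
      unfolding sqip_def
      by (rule integral_nonneg_AE, rule AE_I2) (simp add: b_eq z_eq \<beta>_\<zeta>_nonneg)
    have "sqip M (b m) (z m) + sqip M (\<lambda>x. \<Lambda> x *v g m x) (g m) = sqip M (q m) (z m) - sqip M F (g m)"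
      using scheme[OF \<zeta>u_X] unfolding z_def g_def .
    moreover have "sqip M (q m) (z m) \<le> Cq * (K * sqnorm M (g m))"
      using sqip_Cauchy_Schwarz[OF q_sqint z_sqint, of m m]
        mult_mono[OF Cq[of m] zK[of m] order_trans[OF sqnorm_nonneg Cq] sqnorm_nonneg] by linarith
    moreover have "- sqip M F (g m) \<le> sqnorm M F * sqnorm M (g m)"
      using sqip_Cauchy_Schwarz[OF F_sqint g_sqint, of m] by linarith
    ultimately have "lam_lo * (sqnorm M (g m))\<^sup>2 \<le> (Cq * K + sqnorm M F) * sqnorm M (g m)"
      using \<Lambda>_coercive[OF g_sqint, of m] b0 by (simp add: algebra_simps)
    then have "(lam_lo * sqnorm M (g m)) * sqnorm M (g m) \<le> (Cq * K + sqnorm M F) * sqnorm M (g m)"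
      by (simp add: power2_eq_square algebra_simps)
    then have "lam_lo * sqnorm M (g m) \<le> Cq * K + sqnorm M F"
      by (rule mult_right_le_imp_le) (use False sqnorm_nonneg[of M "g m"] in linarith)
    then show ?thesis using \<Lambda>(2) by (simp add: Cg_def field_simps)
  qed
  have Cz: "sqnorm M (z m) \<le> K * Cg" for m
    using zK[of m] mult_left_mono[OF Cg[of m] K(1)] by linarith
  define Cb where "Cb = K0 * inverse M0 * (K * Cg) + (K0 * inverse M0 * M1 + K1) * sqnorm M (\<lambda>x. 1::real)"
  have Cb: "sqnorm M (b m) \<le> Cb" for m
  proof -
    have eqs: "sqnorm M (\<lambda>x. \<zeta> (gd_Pi (D m) (u m) x)) = sqnorm M (z m)"
      "sqnorm M (\<lambda>x. \<beta> (gd_Pi (D m) (u m) x)) = sqnorm M (b m)"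
      unfolding sqnorm_def
      by (auto intro!: arg_cong[where f = sqrt] Bochner_Integration.integral_cong simp: z_eq b_eq)
    have zs: "sqint M (\<lambda>x. \<zeta> (gd_Pi (D m) (u m) x))"
      by (rule sqint_bound[OF comp_measurable(1)[OF sqint_measurable[OF Pi_sqint]] z_sqint[of m]]) (simp add: z_eq)
    have "sqnorm M (b m) \<le> K0 * inverse M0 * sqnorm M (z m) + (K0 * inverse M0 * M1 + K1) * sqnorm M (\<lambda>x. 1::real)"
      using sqint_of_\<zeta>(3)[OF sqint_measurable[OF Pi_sqint] zs] unfolding eqs .
    moreover have "K0 * inverse M0 * sqnorm M (z m) \<le> K0 * inverse M0 * (K * Cg)"
      using Cz \<beta>(4) \<zeta>(4) by (intro mult_left_mono) auto
    ultimately show ?thesis unfolding Cb_def by linarith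
  qed
  define C where "C = max (max Cg (K * Cg)) (max Cb Cq)"
  have le: "Cg \<le> C" "K * Cg \<le> C" "Cb \<le> C" "Cq \<le> C" by (auto simp: C_def)
  show ?thesis
  proof (rule that)
    show "0 \<le> C" using order_trans[OF sqnorm_nonneg order_trans[OF Cq le(4)]] .
  qed (use Cg Cz Cb Cq le in \<open>blast intro: order_trans\<close>)+
qed

text \<open>Weak limits commute neither with \<open>\<zeta>\<close> nor with \<open>\<beta>\<close>, so the limit is not sought among the weak limits
  of \<open>gd_Pi (D m) (u m)\<close>: it is the function \<open>v\<close> with \<open>\<beta> v + \<zeta> v = B + Z\<close>.\<close>

lemma limit_nonlinearities:
  assumes Z: "sqint M Z" "(\<lambda>j. sqnorm M (\<lambda>x. z (s j) x - Z x)) \<longlonglongrightarrow> 0"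
    and B: "sqint M B" "\<And>h. sqint M h \<Longrightarrow> (\<lambda>j. sqip M (b (s j)) h) \<longlonglongrightarrow> sqip M B h"
  obtains v where "sqint M v" "sqint M (\<lambda>x. \<zeta> (v x))" "sqint M (\<lambda>x. \<beta> (v x))"
    "(\<lambda>j. sqnorm M (\<lambda>x. z (s j) x - \<zeta> (v x))) \<longlonglongrightarrow> 0"
    "\<And>h. sqint M h \<Longrightarrow> (\<lambda>j. sqip M (b (s j)) h) \<longlonglongrightarrow> sqip M (\<lambda>x. \<beta> (v x)) h"
proof -
  obtain C where C: "C \<ge> 0" "\<And>m. sqnorm M (z m) \<le> C" "\<And>m. sqnorm M (b m) \<le> C"
    using apriori_bound by metis
  define w where "w x = B x + Z x" for x
  have w: "sqint M w" unfolding w_def by (intro sqint_add B Z)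
  define v where "v x = \<mu>inv (w x)" for x
  have vw: "\<beta> (v x) + \<zeta> (v x) = w x" for x by (simp add: v_def \<mu>inv)
  have vm: "v \<in> borel_measurable M"
    unfolding v_def by (rule measurable_compose[OF sqint_measurable[OF w] \<mu>inv_measurable])
  have zv: "sqint M (\<lambda>x. \<zeta> (v x))"
    by (rule sqint_bound[OF comp_measurable(1)[OF vm] w]) (use abs_\<zeta>_le vw in \<open>simp flip: vw\<close>)
  note sv = sqint_of_\<zeta>(1,2)[OF vm zv]
  \<comment> \<open>\<open>r j\<close> tends weakly to 0 because \<open>w = B + Z\<close>, while
    \<open>d j\<close> tends strongly to \<open>d'\<close>. That \<open>d'\<close> vanishes is
    deduced from the limit 0 of their pairing.\<close>
  define r where "r j x = b (s j) x + z (s j) x - w x" for j x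
  have r: "sqint M (r j)" for j unfolding r_def by (intro sqint_diff sqint_add b_sqint z_sqint w)
  have rC: "sqnorm M (r j) \<le> C + C + sqnorm M w" for j
    unfolding r_def
    using sqnorm_diff_le_add[OF sqint_add[OF b_sqint[of "s j"] z_sqint[of "s j"]] w]
      sqnorm_triangle[OF b_sqint[of "s j"] z_sqint[of "s j"]] C(2)[of "s j"] C(3)[of "s j"]
    by linarith
  define d where "d j x = z (s j) x - \<zeta> (v x)" for j x
  have d: "sqint M (d j)" for j unfolding d_def by (intro sqint_diff z_sqint zv)
  define d' where "d' x = Z x - \<zeta> (v x)" for x
  have d': "sqint M d'" unfolding d'_def by (intro sqint_diff Z zv)
  have "(\<lambda>j. sqip M (r j) (d j)) \<longlonglongrightarrow> 0"
  proof (rule tendsto_sqip_weak_strong[OF r rC d d'])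
    show "(\<lambda>j. sqnorm M (\<lambda>x. d j x - d' x)) \<longlonglongrightarrow> 0"
      using Z(2) by (simp add: d_def d'_def)
    have "sqip M (r j) d' = sqip M (b (s j)) d' + sqip M (z (s j)) d' - sqip M w d'" for j
      unfolding r_def sqip_diff_left[OF sqint_add[OF b_sqint z_sqint] w d'] sqip_add_left[OF b_sqint z_sqint d'] ..
    moreover have "(\<lambda>j. sqip M (b (s j)) d' + sqip M (z (s j)) d' - sqip M w d')
        \<longlonglongrightarrow> sqip M B d' + sqip M Z d' - sqip M w d'"
      by (intro tendsto_diff tendsto_add tendsto_const B(2) d' tendsto_sqip_left[OF z_sqint Z(1) d' Z(2)])
    moreover have "sqip M w d' = sqip M B d' + sqip M Z d'"
      unfolding w_def by (rule sqip_add_left[OF B(1) Z(1) d'])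
    ultimately show "(\<lambda>j. sqip M (r j) d') \<longlonglongrightarrow> 0" by simp
  qed
  from _ this have "(\<lambda>j. (sqnorm M (d j))\<^sup>2) \<longlonglongrightarrow> 0"
  proof (rule Lim_null_comparison[OF always_eventually], intro allI)
    fix j
    have "(sqnorm M (d j))\<^sup>2 \<le> sqip M (r j) (d j)"
      unfolding sqip_self[symmetric] sqip_def
    proof (rule integral_mono[OF integrable_inner_sqint[OF d d] integrable_inner_sqint[OF r d]])
      fix x assume "x \<in> space M"
      then have x: "x \<in> \<Omega>" by simp
      \<comment> \<open>Firm monotonicity between the discrete solution at \<open>x\<close> and
        \<open>v x\<close>: \<open>d j\<close> is the increment of \<open>\<zeta>\<close>, and
        \<open>r j\<close> that of \<open>\<beta> + \<zeta>\<close>, which maps \<open>v x\<close>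
        to \<open>w x\<close>.\<close>
      show "d j x \<bullet> d j x \<le> r j x \<bullet> d j x"
        using firmly_monotone[of "gd_Pi (D (s j)) (u (s j)) x" "v x"]
        by (simp add: d_def r_def z_eq[OF x] b_eq[OF x] vw power2_eq_square mult.commute)
    qed
    then show "norm ((sqnorm M (d j))\<^sup>2) \<le> sqip M (r j) (d j)" by simp
  qed
  then have d0: "(\<lambda>j. sqnorm M (d j)) \<longlonglongrightarrow> 0" by simp
  have "sqnorm M d' \<le> 0"
  proof (rule LIMSEQ_le_const)
    show "(\<lambda>j. sqnorm M (\<lambda>x. z (s j) x - Z x) + sqnorm M (d j)) \<longlonglongrightarrow> 0"
      using tendsto_add[OF Z(2) d0] by simp
    show "\<exists>N. \<forall>n\<ge>N. sqnorm M d' \<le> sqnorm M (\<lambda>x. z (s n) x - Z x) + sqnorm M (d n)"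
      unfolding d'_def d_def using sqnorm_triangle_diff[OF Z(1) z_sqint zv]
      by (simp add: sqnorm_minus_commute[of M Z])
  qed
  then have "AE x in M. d' x = 0"
    by (intro sqnorm_eq_0_imp_AE d') (simp add: order_antisym)
  then have AE: "AE x in M. B x = \<beta> (v x)"
  proof eventually_elim
    case (elim x)
    then show ?case using vw[of x] by (simp add: d'_def w_def)
  qed
  show ?thesis
  proof (rule that[OF sv(1) zv sv(2)])
    show "(\<lambda>j. sqnorm M (\<lambda>x. z (s j) x - \<zeta> (v x))) \<longlonglongrightarrow> 0" using d0 by (simp add: d_def[abs_def])
    fix h :: "real^'n \<Rightarrow> real" assume h: "sqint M h"
    have "sqip M B h = sqip M (\<lambda>x. \<beta> (v x)) h"
      by (rule sqip_cong_AE_left[OF _ _ _ AE]) (use B(1) sv(2) h in \<open>auto intro: sqint_measurable\<close>)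
    then show "(\<lambda>j. sqip M (b (s j)) h) \<longlonglongrightarrow> sqip M (\<lambda>x. \<beta> (v x)) h" using B(2)[OF h] by simp
  qed
qed

lemma limit_solves_W:
  assumes s: "strict_mono (s :: nat \<Rightarrow> nat)"
    and v: "sqint M v" "sqint M (\<lambda>x. \<zeta> (v x))" "sqint M (\<lambda>x. \<beta> (v x))"
    and Z: "(\<lambda>j. sqnorm M (\<lambda>x. z (s j) x - \<zeta> (v x))) \<longlonglongrightarrow> 0"
    and B: "\<And>h. sqint M h \<Longrightarrow> (\<lambda>j. sqip M (b (s j)) h) \<longlonglongrightarrow> sqip M (\<lambda>x. \<beta> (v x)) h"
    and G: "sqint M G" "\<And>h. sqint M h \<Longrightarrow> (\<lambda>j. sqip M (g (s j)) h) \<longlonglongrightarrow> sqip M G h"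
  shows "solves_W \<Omega> \<zeta> \<beta> \<Lambda> f F v G" "(\<lambda>j. sqnorm M (\<lambda>x. g (s j) x - G x)) \<longlonglongrightarrow> 0"
proof -
  obtain C where C: "C \<ge> 0" "\<And>m. sqnorm M (g m) \<le> C" "\<And>m. sqnorm M (b m) \<le> C" "\<And>m. sqnorm M (q m) \<le> C"
    using apriori_bound by metis
  have sub: "(\<lambda>j. a (s j)) \<longlonglongrightarrow> l" if "a \<longlonglongrightarrow> l" for a :: "nat \<Rightarrow> real" and l
    using LIMSEQ_subseq_LIMSEQ[OF that s] by (simp add: o_def)
  have qs: "(\<lambda>j. sqnorm M (\<lambda>x. q (s j) x - f x)) \<longlonglongrightarrow> 0" by (rule sub[OF q_tendsto])
  have H: "H10 \<Omega> (\<lambda>x. \<zeta> (v x)) G"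
  proof (rule orthogonal_Hdiv_imp_H10[OF \<Omega> v(2) G(1)])
    fix \<psi> d assume hd: "Hdiv \<Omega> \<psi> d"
    then have sd: "sqint M \<psi>" "sqint M d" by (simp_all add: Hdiv_def L2_iff_sqint L2v_iff_sqint)
    \<comment> \<open>The limit is computed twice: from the known weak and strong limits, and by
      limit-conformity, which bounds the sum by \<open>gd_W\<close> times a bounded gradient
      norm.\<close>
    have "(\<lambda>j. sqip M (g (s j)) \<psi> + sqip M (z (s j)) d) \<longlonglongrightarrow> sqip M G \<psi> + sqip M (\<lambda>x. \<zeta> (v x)) d"
      by (intro tendsto_add G(2) sd tendsto_sqip_left[OF z_sqint v(2) sd(2) Z])
    moreover have "(\<lambda>j. sqip M (g (s j)) \<psi> + sqip M (z (s j)) d) \<longlonglongrightarrow> 0"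
    proof (rule Lim_null_comparison[OF always_eventually])
      have "(\<lambda>m. \<bar>gd_W \<Omega> (D m) \<psi> d\<bar> * C) \<longlonglongrightarrow> \<bar>0\<bar> * C"
        by (intro tendsto_intros limit_conform[OF hd])
      from sub[OF this] show "(\<lambda>j. \<bar>gd_W \<Omega> (D (s j)) \<psi> d\<bar> * C) \<longlonglongrightarrow> 0" by simp
      show "\<forall>j. norm (sqip M (g (s j)) \<psi> + sqip M (z (s j)) d) \<le> \<bar>gd_W \<Omega> (D (s j)) \<psi> d\<bar> * C"
      proof
        fix j
        have "norm (sqip M (g (s j)) \<psi> + sqip M (z (s j)) d) \<le> \<bar>gd_W \<Omega> (D (s j)) \<psi> d\<bar> * sqnorm M (g (s j))"
          using gd_W_bound[OF fM \<Omega>_sets GD \<zeta>u_X sd] by (simp add: g_def z_def)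
        also have "\<dots> \<le> \<bar>gd_W \<Omega> (D (s j)) \<psi> d\<bar> * C" by (intro mult_left_mono C) simp
        finally show "norm (sqip M (g (s j)) \<psi> + sqip M (z (s j)) d) \<le> \<bar>gd_W \<Omega> (D (s j)) \<psi> d\<bar> * C" .
      qed
    qed
    ultimately show "sqip M (\<lambda>x. \<zeta> (v x)) d + sqip M G \<psi> = 0"
      using LIMSEQ_unique by fastforce
  qed
  have \<Lambda>g: "sqnorm M (\<lambda>x. \<Lambda> x *v g (s j) x) \<le> \<bar>lam_hi\<bar> * C" for j
    using \<Lambda>_sqnorm[OF g_sqint, of "s j"] mult_left_mono[OF C(2) abs_ge_zero, of lam_hi "s j"] by linarith
  \<comment> \<open>Symmetry of \<open>\<Lambda>\<close> moves it onto the fixed function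
    \<open>h\<close>, so weak convergence of the gradients suffices.\<close>
  have \<Lambda>w: "(\<lambda>j. sqip M (\<lambda>x. \<Lambda> x *v g (s j) x) h) \<longlonglongrightarrow> sqip M (\<lambda>x. \<Lambda> x *v G x) h" if h: "sqint M h" for h
    unfolding \<Lambda>_sym[OF g_sqint h] \<Lambda>_sym[OF G(1) h] by (intro G(2) \<Lambda>_sqint h)
  have W: "sqip M (\<lambda>x. \<beta> (v x)) w + sqip M (\<lambda>x. \<Lambda> x *v G x) Gw = sqip M f w - sqip M F Gw"
    if Hw: "H10 \<Omega> w Gw" for w Gw
  proof -
    note sw = H10_sqint[OF Hw]
    \<comment> \<open>Consistency provides test vectors whose reconstruction and gradient converge
      strongly, so every term of the scheme pairs a bounded weakly convergent sequence with a
      strongly convergent one.\<close>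
    obtain t where t: "\<And>m. t m \<in> gd_X (D m)" "(\<lambda>m. sqnorm M (\<lambda>x. gd_grad (D m) (t m) x - Gw x)) \<longlonglongrightarrow> 0"
      "(\<lambda>m. sqnorm M (\<lambda>x. gd_Pi (D m) (t m) x - w x)) \<longlonglongrightarrow> 0"
      using H10_approx[OF Hw] by blast
    define P where "P j = gd_Pi (D (s j)) (t (s j))" for j
    define N where "N j = gd_grad (D (s j)) (t (s j))" for j
    have P: "sqint M (P j)" "(\<lambda>j. sqnorm M (\<lambda>x. P j x - w x)) \<longlonglongrightarrow> 0" for j
      using Pi_sqint sub[OF t(3)] by (simp_all add: P_def)
    have N: "sqint M (N j)" "(\<lambda>j. sqnorm M (\<lambda>x. N j x - Gw x)) \<longlonglongrightarrow> 0" for j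
      using sqint_gd_grad[OF GD t(1)] sub[OF t(2)] by (simp_all add: N_def)
    have l1: "(\<lambda>j. sqip M (b (s j)) (P j)) \<longlonglongrightarrow> sqip M (\<lambda>x. \<beta> (v x)) w"
      by (rule tendsto_sqip_weak_strong[OF b_sqint C(3) P(1) sw(1) P(2) B[OF sw(1)]])
    have l2: "(\<lambda>j. sqip M (\<lambda>x. \<Lambda> x *v g (s j) x) (N j)) \<longlonglongrightarrow> sqip M (\<lambda>x. \<Lambda> x *v G x) Gw"
      by (rule tendsto_sqip_weak_strong[OF \<Lambda>_sqint[OF g_sqint] \<Lambda>g N(1) sw(2) N(2) \<Lambda>w[OF sw(2)]])
    have l3: "(\<lambda>j. sqip M (q (s j)) (P j)) \<longlonglongrightarrow> sqip M f w"
      by (rule tendsto_sqip_weak_strong[OF q_sqint C(4) P(1) sw(1) P(2)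
            tendsto_sqip_left[OF q_sqint f_sqint sw(1) qs]])
    have l4: "(\<lambda>j. sqip M F (N j)) \<longlonglongrightarrow> sqip M F Gw"
      by (rule tendsto_sqip_weak_strong[OF F_sqint order_refl N(1) sw(2) N(2) tendsto_const])
    have eq: "sqip M (b (s j)) (P j) + sqip M (\<lambda>x. \<Lambda> x *v g (s j) x) (N j)
        = sqip M (q (s j)) (P j) - sqip M F (N j)" for j
      unfolding P_def N_def by (rule scheme[OF t(1)])
    have "(\<lambda>j. sqip M (q (s j)) (P j) - sqip M F (N j)) \<longlonglongrightarrow> sqip M (\<lambda>x. \<beta> (v x)) w + sqip M (\<lambda>x. \<Lambda> x *v G x) Gw"
      using tendsto_add[OF l1 l2] unfolding eq .
    then show ?thesis using tendsto_diff[OF l3 l4] by (rule LIMSEQ_unique)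
  qed
  show "solves_W \<Omega> \<zeta> \<beta> \<Lambda> f F v G"
    using v(1) H W by (simp add: solves_W_iff)
  \<comment> \<open>A pairing of two weakly convergent gradients has no limit a priori. Here the
    scheme tested with \<open>\<zeta> (u m)\<close> expresses it through three convergent pairings,
    and the limit equation tested with \<open>\<zeta> v\<close> identifies their limit.\<close>
  have energy: "(\<lambda>j. sqip M (\<lambda>x. \<Lambda> x *v g (s j) x) (g (s j))) \<longlonglongrightarrow> sqip M (\<lambda>x. \<Lambda> x *v G x) G"
  proof -
    have l1: "(\<lambda>j. sqip M (q (s j)) (z (s j))) \<longlonglongrightarrow> sqip M f (\<lambda>x. \<zeta> (v x))"
      by (rule tendsto_sqip_weak_strong[OF q_sqint C(4) z_sqint v(2) Z
            tendsto_sqip_left[OF q_sqint f_sqint v(2) qs]])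
    have l2: "(\<lambda>j. sqip M F (g (s j))) \<longlonglongrightarrow> sqip M F G"
      using G(2)[OF F_sqint] by (simp add: sqip_commute)
    have l3: "(\<lambda>j. sqip M (b (s j)) (z (s j))) \<longlonglongrightarrow> sqip M (\<lambda>x. \<beta> (v x)) (\<lambda>x. \<zeta> (v x))"
      by (rule tendsto_sqip_weak_strong[OF b_sqint C(3) z_sqint v(2) Z B[OF v(2)]])
    have "sqip M (\<lambda>x. \<Lambda> x *v g m x) (g m) = sqip M (q m) (z m) - sqip M F (g m) - sqip M (b m) (z m)" for m
      using scheme[OF \<zeta>u_X, of m] by (simp add: z_def g_def)
    moreover have "sqip M (\<lambda>x. \<Lambda> x *v G x) G
        = sqip M f (\<lambda>x. \<zeta> (v x)) - sqip M F G - sqip M (\<lambda>x. \<beta> (v x)) (\<lambda>x. \<zeta> (v x))"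
      using W[OF H] by simp
    ultimately show ?thesis using tendsto_diff[OF tendsto_diff[OF l1 l2] l3] by simp
  qed
  \<comment> \<open>The \<open>\<Lambda>\<close> energy of \<open>g (s j) - G\<close>, expanded by
    symmetry. Its terms converge by \<open>energy\<close> and weak convergence, and the limits
    cancel as 1 - 2 + 1.\<close>
  define \<Delta> where "\<Delta> j = sqip M (\<lambda>x. \<Lambda> x *v g (s j) x) (g (s j)) - 2 * sqip M (\<lambda>x. \<Lambda> x *v g (s j) x) G
      + sqip M (\<lambda>x. \<Lambda> x *v G x) G" for j
  have "\<Delta> \<longlonglongrightarrow> sqip M (\<lambda>x. \<Lambda> x *v G x) G - 2 * sqip M (\<lambda>x. \<Lambda> x *v G x) G + sqip M (\<lambda>x. \<Lambda> x *v G x) G"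
    unfolding \<Delta>_def by (intro tendsto_intros energy \<Lambda>w G)
  then have \<Delta>: "(\<lambda>j. \<Delta> j / lam_lo) \<longlonglongrightarrow> 0"
    using tendsto_divide[OF _ tendsto_const, of \<Delta> 0 sequentially lam_lo] \<Lambda>(2) by simp
  have "(sqnorm M (\<lambda>x. g (s j) x - G x))\<^sup>2 \<le> \<Delta> j / lam_lo" for j
  proof -
    note gs = g_sqint[of "s j"] and Lg = \<Lambda>_sqint[OF g_sqint[of "s j"]] and LG = \<Lambda>_sqint[OF G(1)]
    have "sqip M (\<lambda>x. \<Lambda> x *v (g (s j) x - G x)) (\<lambda>x. g (s j) x - G x) = \<Delta> j"
      unfolding \<Lambda>_diff \<Delta>_def sqip_diff_left[OF Lg LG sqint_diff[OF gs G(1)]]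
        sqip_diff_right[OF gs G(1) Lg] sqip_diff_right[OF gs G(1) LG]
      using \<Lambda>_sym[OF gs G(1)] sqip_commute[of M "g (s j)"] by simp
    then show ?thesis
      using \<Lambda>_coercive[OF sqint_diff[OF gs G(1)]] \<Lambda>(2) by (simp add: field_simps)
  qed
  then have "\<forall>j. norm ((sqnorm M (\<lambda>x. g (s j) x - G x))\<^sup>2) \<le> \<Delta> j / lam_lo" by simp
  from Lim_null_comparison[OF always_eventually[OF this] \<Delta>]
  have "(\<lambda>j. (sqnorm M (\<lambda>x. g (s j) x - G x))\<^sup>2) \<longlonglongrightarrow> 0" .
  then show "(\<lambda>j. sqnorm M (\<lambda>x. g (s j) x - G x)) \<longlonglongrightarrow> 0" by simp
qed

section \<open>Extraction of subsequences and convergence of the whole sequence\<close>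

lemma convergent_subsequence:
  assumes k: "strict_mono (k :: nat \<Rightarrow> nat)"
  obtains r v G where "strict_mono (r :: nat \<Rightarrow> nat)" "solves_W \<Omega> \<zeta> \<beta> \<Lambda> f F v G"
    "(\<lambda>j. sqnorm M (\<lambda>x. z (k (r j)) x - \<zeta> (v x))) \<longlonglongrightarrow> 0"
    "(\<lambda>j. sqnorm M (\<lambda>x. g (k (r j)) x - G x)) \<longlonglongrightarrow> 0"
    "\<And>h. sqint M h \<Longrightarrow> (\<lambda>j. sqip M (b (k (r j))) h) \<longlonglongrightarrow> sqip M (\<lambda>x. \<beta> (v x)) h"
proof -
  obtain C where C: "C \<ge> 0" "\<And>m. sqnorm M (g m) \<le> C" "\<And>m. sqnorm M (b m) \<le> C"
    using apriori_bound by metis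
  have "bounded (range (\<lambda>m. L2vnorm \<Omega> (gd_grad (D m) (\<lambda>i. \<zeta> (u m i)))))"
    using C(2) by (intro boundedI[of _ C]) (auto simp: L2vnorm_eq g_def)
  with \<zeta>u_X have "\<forall>k::nat \<Rightarrow> nat. \<exists>r Z. strict_mono r \<and> L2 \<Omega> Z \<and>
      (\<lambda>j. L2norm \<Omega> (\<lambda>x. gd_Pi (D (k (r j))) (\<lambda>i. \<zeta> (u (k (r j)) i)) x - Z x)) \<longlonglongrightarrow> 0"
    by (intro compact allI)
  then obtain r1 Z where r1: "strict_mono (r1 :: nat \<Rightarrow> nat)" and Z: "sqint M Z"
    "(\<lambda>j. sqnorm M (\<lambda>x. z (k (r1 j)) x - Z x)) \<longlonglongrightarrow> 0"
    unfolding L2_iff_sqint L2norm_eq z_def[symmetric] by blast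
  \<comment> \<open>Pairing \<open>b\<close> and \<open>g\<close> yields both weak limits in a
    single extraction; testing with \<open>(w, 0)\<close> and \<open>(0, w)\<close> separates them
    again.\<close>
  define h where "h j = (\<lambda>x. (b (k (r1 j)) x, g (k (r1 j)) x))" for j
  have h: "sqint M (h j)" for j by (simp add: h_def sqint_Pair_iff b_sqint g_sqint)
  have hC: "sqnorm M (h j) \<le> C + C" for j
    unfolding h_def using sqnorm_Pair_le[OF b_sqint g_sqint] C(2,3) by (meson add_mono order_trans)
  obtain r2 p where r2: "strict_mono (r2 :: nat \<Rightarrow> nat)" and p: "sqint M p"
    "\<And>w. sqint M w \<Longrightarrow> (\<lambda>j. sqip M (h (r2 j)) w) \<longlonglongrightarrow> sqip M p w"
    using sq_weakly_compact[where h = h, OF fM h hC] by blast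
  define B where "B x = fst (p x)" for x
  define G where "G x = snd (p x)" for x
  have pe: "p = (\<lambda>x. (B x, G x))" by (simp add: B_def G_def)
  have BG: "sqint M B" "sqint M G" using p(1) unfolding pe sqint_Pair_iff by simp_all
  define r where "r j = r1 (r2 j)" for j
  have r: "strict_mono r" using strict_mono_o[OF r1 r2] by (simp add: r_def[abs_def] o_def)
  define s where "s j = k (r j)" for j
  have s: "strict_mono s" using strict_mono_o[OF k r] by (simp add: s_def[abs_def] o_def)
  have hs: "h (r2 j) = (\<lambda>x. (b (s j) x, g (s j) x))" for j by (simp add: h_def s_def r_def)
  have Bw: "(\<lambda>j. sqip M (b (s j)) w) \<longlonglongrightarrow> sqip M B w" if w: "sqint M w" for w
  proof -
    have "sqip M (\<lambda>x. (b (s j) x, g (s j) x)) (\<lambda>x. (w x, 0)) = sqip M (b (s j)) w" for j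
      by (subst sqip_Pair[OF b_sqint g_sqint w sqint_zero]) (simp add: sqip_def)
    moreover have "sqip M (\<lambda>x. (B x, G x)) (\<lambda>x. (w x, 0)) = sqip M B w"
      by (subst sqip_Pair[OF BG w sqint_zero]) (simp add: sqip_def)
    moreover have "sqint M (\<lambda>x. (w x, 0 :: real^'n))" by (simp add: sqint_Pair_iff w sqint_zero)
    ultimately show ?thesis using p(2)[of "\<lambda>x. (w x, 0)"] unfolding hs pe by simp
  qed
  have Gw: "(\<lambda>j. sqip M (g (s j)) w) \<longlonglongrightarrow> sqip M G w" if w: "sqint M w" for w
  proof -
    have "sqip M (\<lambda>x. (b (s j) x, g (s j) x)) (\<lambda>x. (0, w x)) = sqip M (g (s j)) w" for j
      by (subst sqip_Pair[OF b_sqint g_sqint sqint_zero w]) (simp add: sqip_def)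
    moreover have "sqip M (\<lambda>x. (B x, G x)) (\<lambda>x. (0, w x)) = sqip M G w"
      by (subst sqip_Pair[OF BG sqint_zero w]) (simp add: sqip_def)
    moreover have "sqint M (\<lambda>x. (0 :: real, w x))" by (simp add: sqint_Pair_iff w sqint_zero)
    ultimately show ?thesis using p(2)[of "\<lambda>x. (0, w x)"] unfolding hs pe by simp
  qed
  have Zs: "(\<lambda>j. sqnorm M (\<lambda>x. z (s j) x - Z x)) \<longlonglongrightarrow> 0"
    using LIMSEQ_subseq_LIMSEQ[OF Z(2) r2] by (simp add: o_def s_def r_def)
  obtain v where v: "sqint M v" "sqint M (\<lambda>x. \<zeta> (v x))" "sqint M (\<lambda>x. \<beta> (v x))"
    "(\<lambda>j. sqnorm M (\<lambda>x. z (s j) x - \<zeta> (v x))) \<longlonglongrightarrow> 0"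
    "\<And>h. sqint M h \<Longrightarrow> (\<lambda>j. sqip M (b (s j)) h) \<longlonglongrightarrow> sqip M (\<lambda>x. \<beta> (v x)) h"
    using limit_nonlinearities[OF Z(1) Zs BG(1) Bw] by blast
  note W = limit_solves_W[OF s v BG(2) Gw]
  show ?thesis
    by (rule that[OF r W(1) v(4)[unfolded s_def] W(2)[unfolded s_def] v(5)[unfolded s_def]])
qed

lemma full_sequence_converges:
  "\<exists>v G. solves_W \<Omega> \<zeta> \<beta> \<Lambda> f F v G
     \<and> (\<lambda>m. sqnorm M (\<lambda>x. z m x - \<zeta> (v x))) \<longlonglongrightarrow> 0
     \<and> (\<lambda>m. sqnorm M (\<lambda>x. g m x - G x)) \<longlonglongrightarrow> 0
     \<and> (\<forall>h. sqint M h \<longrightarrow> (\<lambda>m. sqip M (b m) h) \<longlonglongrightarrow> sqip M (\<lambda>x. \<beta> (v x)) h)"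
proof -
  \<comment> \<open>The limit along one subsequence is fixed as reference. Other limits may differ
    from it as functions, but uniqueness makes the relevant norms and pairings agree.\<close>
  obtain v G where W: "solves_W \<Omega> \<zeta> \<beta> \<Lambda> f F v G"
    using convergent_subsequence[OF strict_mono_id] by blast
  note sW = solves_W_sqint[OF W]
  have main: "\<exists>r. strict_mono r \<and> (\<lambda>j::nat. sqnorm M (\<lambda>x. z (k (r j)) x - \<zeta> (v x))) \<longlonglongrightarrow> 0
     \<and> (\<lambda>j. sqnorm M (\<lambda>x. g (k (r j)) x - G x)) \<longlonglongrightarrow> 0
     \<and> (\<forall>h. sqint M h \<longrightarrow> (\<lambda>j. sqip M (b (k (r j))) h) \<longlonglongrightarrow> sqip M (\<lambda>x. \<beta> (v x)) h)"
    if k: "strict_mono k" for k :: "nat \<Rightarrow> nat"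
  proof -
    obtain r v' G' where r: "strict_mono (r :: nat \<Rightarrow> nat)" and W': "solves_W \<Omega> \<zeta> \<beta> \<Lambda> f F v' G'"
      and z': "(\<lambda>j. sqnorm M (\<lambda>x. z (k (r j)) x - \<zeta> (v' x))) \<longlonglongrightarrow> 0"
      and g': "(\<lambda>j. sqnorm M (\<lambda>x. g (k (r j)) x - G' x)) \<longlonglongrightarrow> 0"
      and b': "\<And>h. sqint M h \<Longrightarrow> (\<lambda>j. sqip M (b (k (r j))) h) \<longlonglongrightarrow> sqip M (\<lambda>x. \<beta> (v' x)) h"
      using convergent_subsequence[OF k] by blast
    note sW' = solves_W_sqint[OF W'] and U = solves_W_unique[OF W' W]
    have "(\<lambda>j. sqnorm M (\<lambda>x. z (k (r j)) x - \<zeta> (v x))) \<longlonglongrightarrow> 0"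
      by (rule Lim_null_comparison[OF always_eventually z'])
        (use sqnorm_triangle_diff[OF z_sqint sW'(2) sW(2)] U(1) in simp)
    moreover have "(\<lambda>j. sqnorm M (\<lambda>x. g (k (r j)) x - G x)) \<longlonglongrightarrow> 0"
      by (rule Lim_null_comparison[OF always_eventually g'])
        (use sqnorm_triangle_diff[OF g_sqint sW'(4) sW(4)] U(2) in simp)
    ultimately show ?thesis using r b' U(3) by auto
  qed
  have "(\<lambda>m. sqnorm M (\<lambda>x. z m x - \<zeta> (v x))) \<longlonglongrightarrow> 0"
    by (rule LIMSEQ_subsubsequence) (use main in blast)
  moreover have "(\<lambda>m. sqnorm M (\<lambda>x. g m x - G x)) \<longlonglongrightarrow> 0"
    by (rule LIMSEQ_subsubsequence) (use main in blast)
  moreover have "(\<lambda>m. sqip M (b m) h) \<longlonglongrightarrow> sqip M (\<lambda>x. \<beta> (v x)) h" if "sqint M h" for h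
    by (rule LIMSEQ_subsubsequence) (use main that in blast)
  ultimately show ?thesis using W by blast
qed

end

theorem mainTheorem3:
  fixes \<Omega> :: "(real^'n) set"
    and \<zeta> \<beta> :: "real \<Rightarrow> real"
    and \<Lambda> :: "real^'n \<Rightarrow> real^'n^'n"
    and f :: "real^'n \<Rightarrow> real" and F :: "real^'n \<Rightarrow> real^'n"
    and M0 M1 K0 K1 lam_lo lam_hi :: real
    and D :: "nat \<Rightarrow> 'n gd"
    and u :: "nat \<Rightarrow> nat \<Rightarrow> real"
  assumes \<Omega>: "open \<Omega>" "bounded \<Omega>" "connected \<Omega>"
    and \<zeta>: "continuous_on UNIV \<zeta>" "mono \<zeta>" "\<zeta> 0 = 0" "M0 > 0" "M1 > 0"
           "\<And>s. \<bar>\<zeta> s\<bar> \<ge> M0 * \<bar>s\<bar> - M1"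
    and \<beta>: "continuous_on UNIV \<beta>" "mono \<beta>" "\<beta> 0 = 0" "K0 > 0" "K1 > 0"
           "\<And>s. \<bar>\<beta> s\<bar> \<le> K0 * \<bar>s\<bar> + K1"
    and \<beta>\<zeta>: "strict_mono (\<lambda>s. \<beta> s + \<zeta> s)"
    and \<Lambda>: "\<Lambda> \<in> borel_measurable (lebesgue_on \<Omega>)" "lam_hi \<ge> lam_lo" "lam_lo > 0"
           "AE x in lebesgue_on \<Omega>. transpose (\<Lambda> x) = \<Lambda> x \<and>
               (\<forall>c. (\<exists>\<xi>. \<xi> \<noteq> 0 \<and> \<Lambda> x *v \<xi> = c *\<^sub>R \<xi>) \<longrightarrow> lam_lo \<le> c \<and> c \<le> lam_hi)"
    and fF: "L2 \<Omega> f" "L2v \<Omega> F"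
    and GD: "\<And>m. is_pc_GD \<Omega> (D m)"
    and coercive: "bounded (range (\<lambda>m. gd_C \<Omega> (D m)))"
    and consistent: "\<And>\<phi> G\<phi>. H10 \<Omega> \<phi> G\<phi> \<Longrightarrow> (\<lambda>m. gd_S \<Omega> (D m) \<phi> G\<phi>) \<longlonglongrightarrow> 0"
       "(\<lambda>m. L2norm \<Omega> (\<lambda>x. gd_Q (D m) f x - f x)) \<longlonglongrightarrow> 0"
    and limit_conform: "\<And>\<psi> div\<psi>. Hdiv \<Omega> \<psi> div\<psi> \<Longrightarrow> (\<lambda>m. gd_W \<Omega> (D m) \<psi> div\<psi>) \<longlonglongrightarrow> 0"
    and compact: "\<And>v. (\<forall>m. v m \<in> gd_X (D m)) \<Longrightarrow>
        bounded (range (\<lambda>m. L2vnorm \<Omega> (gd_grad (D m) (v m)))) \<Longrightarrow>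
        (\<forall>k::nat \<Rightarrow> nat. \<exists>r g. strict_mono r \<and> L2 \<Omega> g \<and>
            (\<lambda>j. L2norm \<Omega> (\<lambda>x. gd_Pi (D (k (r j))) (v (k (r j))) x - g x)) \<longlonglongrightarrow> 0)"
    and sol: "\<And>m. solves_GS \<Omega> \<zeta> \<beta> \<Lambda> f F (D m) (u m)"
  shows "\<exists>ubar G. solves_W \<Omega> \<zeta> \<beta> \<Lambda> f F ubar G
     \<and> (\<lambda>m. L2norm \<Omega> (\<lambda>x. gd_Pi (D m) (\<lambda>i. \<zeta> (u m i)) x - \<zeta> (ubar x))) \<longlonglongrightarrow> 0
     \<and> (\<lambda>m. L2vnorm \<Omega> (\<lambda>x. gd_grad (D m) (\<lambda>i. \<zeta> (u m i)) x - G x)) \<longlonglongrightarrow> 0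
     \<and> (\<forall>g. L2 \<Omega> g \<longrightarrow>
          (\<lambda>m. integral\<^sup>L (lebesgue_on \<Omega>) (\<lambda>x. gd_Pi (D m) (\<lambda>i. \<beta> (u m i)) x * g x))
            \<longlonglongrightarrow> integral\<^sup>L (lebesgue_on \<Omega>) (\<lambda>x. \<beta> (ubar x) * g x))"
proof -
  interpret gradient_scheme_sequence \<Omega> \<zeta> \<beta> \<Lambda> f F M0 M1 K0 K1 lam_lo lam_hi D u
    by unfold_locales (fact assms)+
  show ?thesis
    using full_sequence_converges
    unfolding L2norm_eq L2vnorm_eq L2_iff_sqint sqip_def z_def g_def b_def by simp
qed

end
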